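(* Let $K$ be a field, $E$ an elliptic curve over $K$ given by a Weierstrass equation, and $p$ an odd prime with $p\equiv 2\pmod 3$ and $p\neq\mathrm{char}(K)$. Let $P_1=(x_1,y_1)$, $P_2=(x_2,y_2)$ be a $\mathbb{Z}/p\mathbb{Z}$-basis of $E[p]$ and $\zeta_p$ a primitive $p$-th root of unity. Then $K(E[p])=K(x_1,y_1,y_2)$ or $K(E[p])=K(x_1,y_1,\zeta_p)$.
   Context: $E[p]$ is the $p$-torsion subgroup of $E(\overline{K})$; $K(E[p])$ is the field obtained from $K$ by adjoining the coordinates of all points of $E[p]$. *)

theory Defs
  imports
    "HOL-Algebra.Algebraic_Closure_Type"
    "HOL-Algebra.Generated_Fields"
    "HOL-Number_Theory.Cong"
begin

section \<open>Weierstrass equations\<close>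

text \<open>
  \<open>Weierstrass a1 a2 a3 a4 a6\<close> stands for the general equation
  \<open>y\<^sup>2 + a1 x y + a3 y = x\<^sup>3 + a2 x\<^sup>2 + a4 x + a6\<close>, so that fields of characteristic 2 and 3 are covered.
  The map function \<open>map_weierstrass\<close> of the datatype is base change along a field embedding.
\<close>

datatype 'a weierstrass =
  Weierstrass (wa1: 'a) (wa2: 'a) (wa3: 'a) (wa4: 'a) (wa6: 'a)

definition w_discriminant :: "'a::field weierstrass \<Rightarrow> 'a" where
  "w_discriminant W =
    (let b2 = (wa1 W)\<^sup>2 + 4 * wa2 W;
         b4 = 2 * wa4 W + wa1 W * wa3 W;
         b6 = (wa3 W)\<^sup>2 + 4 * wa6 W;
         b8 = (wa1 W)\<^sup>2 * wa6 W + 4 * wa2 W * wa6 W - wa1 W * wa3 W * wa4 W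
              + wa2 W * (wa3 W)\<^sup>2 - (wa4 W)\<^sup>2
     in - b2\<^sup>2 * b8 - 8 * b4 ^ 3 - 27 * b6\<^sup>2 + 9 * b2 * b4 * b6)"

definition elliptic_curve :: "'a::field weierstrass \<Rightarrow> bool" where
  "elliptic_curve W \<longleftrightarrow> w_discriminant W \<noteq> 0"

definition on_curve :: "'a::field weierstrass \<Rightarrow> 'a \<Rightarrow> 'a \<Rightarrow> bool" where
  "on_curve W x y \<longleftrightarrow>
     y\<^sup>2 + wa1 W * x * y + wa3 W * y = x ^ 3 + wa2 W * x\<^sup>2 + wa4 W * x + wa6 W"


section \<open>The group of points\<close>

datatype 'a point = Infinity | Affine 'a 'a

definition ec_points :: "'a::field weierstrass \<Rightarrow> 'a point set" where
  "ec_points W = insert Infinity {Affine x y |x y. on_curve W x y}"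

text \<open>
  The chord-tangent law. The first test says that the second point is the negative of the first one;
  otherwise \<open>l\<close> is the slope and \<open>n\<close> the intercept of the line through the two points
  (the tangent line if they coincide).
\<close>

fun ec_add :: "'a::field weierstrass \<Rightarrow> 'a point \<Rightarrow> 'a point \<Rightarrow> 'a point" where
  "ec_add W Infinity Q = Q"
| "ec_add W (Affine x1 y1) Infinity = Affine x1 y1"
| "ec_add W (Affine x1 y1) (Affine x2 y2) =
    (if x1 = x2 \<and> y1 + y2 + wa1 W * x1 + wa3 W = 0 then Infinity
     else
       let l = (if x1 \<noteq> x2 then (y2 - y1) / (x2 - x1)
                else (3 * x1\<^sup>2 + 2 * wa2 W * x1 + wa4 W - wa1 W * y1)
                     / (2 * y1 + wa1 W * x1 + wa3 W));
           n = y1 - l * x1;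
           x3 = l\<^sup>2 + wa1 W * l - wa2 W - x1 - x2
       in Affine x3 (- (l + wa1 W) * x3 - n - wa3 W))"

text \<open>The group is written multiplicatively: the multiple \<open>nP\<close> is \<open>P [^] n\<close>.\<close>

definition ec_group :: "'a::field weierstrass \<Rightarrow> 'a point monoid" where
  "ec_group W = \<lparr>carrier = ec_points W, monoid.mult = ec_add W, one = Infinity\<rparr>"

definition torsion :: "('a, 'b) monoid_scheme \<Rightarrow> nat \<Rightarrow> 'a set" where
  "torsion G n = {P \<in> carrier G. P [^]\<^bsub>G\<^esub> n = \<one>\<^bsub>G\<^esub>}"

text \<open>
  A \<open>\<int>/n\<int>\<close>-basis consisting of two elements. Residue classes are represented by natural numbers.
\<close>

definition torsion_basis :: "('a, 'b) monoid_scheme \<Rightarrow> nat \<Rightarrow> 'a \<Rightarrow> 'a \<Rightarrow> bool" where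
  "torsion_basis G n P Q \<longleftrightarrow>
     P \<in> torsion G n \<and> Q \<in> torsion G n \<and>
     (\<forall>R \<in> torsion G n. \<exists>(i::nat) (j::nat). R = P [^]\<^bsub>G\<^esub> i \<otimes>\<^bsub>G\<^esub> Q [^]\<^bsub>G\<^esub> j) \<and>
     (\<forall>(i::nat) (j::nat). P [^]\<^bsub>G\<^esub> i \<otimes>\<^bsub>G\<^esub> Q [^]\<^bsub>G\<^esub> j = \<one>\<^bsub>G\<^esub> \<longrightarrow> n dvd i \<and> n dvd j)"


section \<open>Fields of definition inside the algebraic closure\<close>

definition ec_closure_group :: "'k::field weierstrass \<Rightarrow> 'k alg_closure point monoid" where
  "ec_closure_group E = ec_group (map_weierstrass to_ac E)"

definition adjoin :: "'k::field alg_closure set \<Rightarrow> 'k alg_closure set" where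
  "adjoin S = generate_field ring_of_type_algebra (range to_ac \<union> S)"

definition coordinates :: "'a point set \<Rightarrow> 'a set" where
  "coordinates T = (\<Union>P \<in> T. set_point P)"

definition division_field :: "'k::field weierstrass \<Rightarrow> nat \<Rightarrow> 'k alg_closure set" where
  "division_field E n = adjoin (coordinates (torsion (ec_closure_group E) n))"

definition primitive_root_of_unity :: "nat \<Rightarrow> 'a::field \<Rightarrow> bool" where
  "primitive_root_of_unity n z \<longleftrightarrow> n > 0 \<and> z ^ n = 1 \<and> (\<forall>k. 0 < k \<and> k < n \<longrightarrow> z ^ k \<noteq> 1)"

end

theory Submission
  imports Defs "HOL-Number_Theory.Pocklington"
begin

text \<open>
  Let \<open>L = K(P1, y2)\<close> and suppose that \<open>x2\<close> is not in \<open>L\<close>. Then \<open>x2\<close> has a conjugate \<open>u \<noteq> x2\<close> over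
  \<open>L\<close>, and the points with ordinate \<open>y2\<close> are collinear, so that they sum to \<open>O\<close>. As \<open>p = 2\<close> modulo
  \<open>3\<close>, the conjugation cannot permute them cyclically; it therefore acts on \<open>E[p]\<close> with \<open>P1 \<mapsto> P1\<close>
  and \<open>P2 \<mapsto> b P1 - P2\<close>, and \<open>y2\<close> lies in \<open>K(P1)\<close>. Its determinant is \<open>-1\<close>, so by the Weil pairing it
  moves \<open>\<zeta>\<close>, which gives \<open>K(E[p]) = K(P1, \<zeta>)\<close>.

  The Weil pairing enters only through the following elementary substitute. For a \<open>p\<close>-th root of
  unity \<open>w \<noteq> 1\<close>, a Lagrange resolvent of slopes of lines through the multiples of \<open>P1\<close> is a function
  on the curve with simple poles at \<open>\<langle>P1\<rangle>\<close> that translation by \<open>P1\<close> multiplies by \<open>1 / w\<close>. Its zeros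
  form one coset of \<open>\<langle>P1\<rangle>\<close>, and by Abel's theorem this coset lies in \<open>E[p]\<close>. Counting shows that \<open>w\<close>
  corresponds bijectively to the nontrivial cosets of \<open>\<langle>P1\<rangle>\<close> in \<open>E[p]\<close>, and this bijection commutes
  with conjugation over \<open>K(P1)\<close>.

  Abel's theorem, the bound on the number of zeros, and the associativity of the chord-tangent law
  all follow from linear equivalence of divisors, expressed by products of the maximal ideals of the
  points in the coordinate ring, together with the fact that no function has a single simple pole at
  infinity.
\<close>



section \<open>The coordinate ring of the affine curve\<close>

text \<open>
  The coordinate ring is realised as the subring \<open>{A(X) + B(X) Y}\<close> of an algebraic closure of \<open>k(X)\<close>,
  so that products of ideals can be compared by dividing inside a field.
\<close>

type_synonym 'a curve_fun = "'a poly fract alg_closure"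

definition emb :: "'a::field poly \<Rightarrow> 'a curve_fun" where
  "emb p = to_ac (to_fract p)"

lemma emb_0 [simp]: "emb 0 = 0" and emb_1 [simp]: "emb 1 = 1"
  and emb_add [simp]: "emb (p + q) = emb p + emb q"
  and emb_diff [simp]: "emb (p - q) = emb p - emb q"
  and emb_minus [simp]: "emb (- p) = - emb p"
  and emb_mult [simp]: "emb (p * q) = emb p * emb q"
  and emb_eq_iff [simp]: "emb p = emb q \<longleftrightarrow> p = q"
  by (simp_all add: emb_def)

lemma emb_eq_0_iff [simp]: "emb p = 0 \<longleftrightarrow> p = 0"
  using emb_eq_iff[of p 0] by simp

abbreviation cst :: "'a::field \<Rightarrow> 'a curve_fun" where
  "cst c \<equiv> emb [:c:]"

lemma cst_0 [simp]: "cst 0 = 0" and cst_1: "cst 1 = 1"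
  by (simp_all flip: one_pCons)

lemma cst_add: "cst (a + b) = cst a + cst b"
  and cst_diff: "cst (a - b) = cst a - cst b"
  and cst_minus: "cst (- a) = - cst a"
  and cst_mult: "cst (a * b) = cst a * cst b"
  by (simp_all flip: emb_add emb_diff emb_minus emb_mult)

lemma cst_power: "cst (a ^ n) = cst a ^ n"
  by (induction n) (auto simp: cst_mult cst_1)

lemma cst_of_nat: "cst (of_nat n) = of_nat n"
  by (induction n) (auto simp: cst_add cst_1)

lemma cst_numeral: "cst (numeral n) = numeral n"
  using cst_of_nat[of "numeral n"] by simp

lemmas cst_simps = cst_0 cst_1 cst_add cst_diff cst_minus cst_mult cst_power cst_numeral

definition genX :: "'a::field curve_fun" where
  "genX = emb [:0, 1:]"

lemma emb_pCons: "emb (pCons a (pCons b p)) = cst a + genX * emb (pCons b p)"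
  by (simp add: genX_def flip: emb_add emb_mult)

lemma genX_minus_cst: "genX - cst x = emb [:-x, 1:]"
  by (simp add: emb_pCons cst_simps)

lemma genX_minus_cst_neq_0: "genX - cst x \<noteq> 0"
  unfolding genX_minus_cst by simp

locale weierstrass_curve =
  fixes W :: "'a::field weierstrass"
begin

abbreviation "a1 \<equiv> wa1 W"
abbreviation "a2 \<equiv> wa2 W"
abbreviation "a3 \<equiv> wa3 W"
abbreviation "a4 \<equiv> wa4 W"
abbreviation "a6 \<equiv> wa6 W"

definition cubic :: "'a poly" where "cubic = [:a6, a4, a2, 1:]"
definition ycoeff :: "'a poly" where "ycoeff = [:a3, a1:]"

lemma on_curve_iff_poly: "on_curve W x y \<longleftrightarrow> y\<^sup>2 + poly ycoeff x * y = poly cubic x"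
  by (simp add: on_curve_def ycoeff_def cubic_def algebra_simps power2_eq_square power3_eq_cube)

definition genY :: "'a curve_fun" where
  "genY = (SOME y. y\<^sup>2 + emb ycoeff * y = emb cubic)"

lemma genY_eq: "genY\<^sup>2 + emb ycoeff * genY = emb cubic"
proof -
  have "\<exists>y. poly [:- emb cubic, emb ycoeff, 1:] y = 0"
    by (rule alg_closed_imp_poly_has_root) simp
  then obtain y where "poly [:- emb cubic, emb ycoeff, 1:] y = 0" ..
  hence "y\<^sup>2 + emb ycoeff * y = emb cubic"
    by (simp add: algebra_simps power2_eq_square add_eq_0_iff)
  thus ?thesis unfolding genY_def by (rule someI)
qed

lemma genY_square: "genY * genY = emb cubic - emb ycoeff * genY"
  using genY_eq by (simp add: power2_eq_square algebra_simps)

lemma generic_point_on_curve: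
  "genY\<^sup>2 + cst a1 * genX * genY + cst a3 * genY = genX ^ 3 + cst a2 * genX\<^sup>2 + cst a4 * genX + cst a6"
  using genY_eq
  by (simp add: ycoeff_def cubic_def emb_pCons algebra_simps power2_eq_square power3_eq_cube cst_1)

definition reg :: "'a poly \<Rightarrow> 'a poly \<Rightarrow> 'a curve_fun" where
  "reg A B = emb A + emb B * genY"

lemma emb_eq_reg: "emb A = reg A 0" and genY_eq_reg: "genY = reg 0 1"
  by (simp_all add: reg_def)

lemma reg_diff: "reg A B - reg C D = reg (A - C) (B - D)"
  and reg_add: "reg A B + reg C D = reg (A + C) (B + D)"
  and reg_minus: "- reg A B = reg (- A) (- B)"
  by (simp_all add: reg_def algebra_simps)

lemma reg_mult: "reg A B * reg C D = reg (A * C + B * D * cubic) (A * D + B * C - B * D * ycoeff)"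
proof -
  have "reg A B * reg C D =
      emb A * emb C + (emb A * emb D + emb B * emb C) * genY + emb B * emb D * (genY * genY)"
    by (simp add: reg_def algebra_simps)
  also have "\<dots> = reg (A * C + B * D * cubic) (A * D + B * C - B * D * ycoeff)"
    unfolding genY_square by (simp add: reg_def algebra_simps)
  finally show ?thesis .
qed

text \<open>The norm of \<open>A + B Y\<close> down to \<open>k[X]\<close>. Its degree is the pole order at infinity.\<close>

definition reg_norm :: "'a poly \<Rightarrow> 'a poly \<Rightarrow> 'a poly" where
  "reg_norm A B = A\<^sup>2 - A * B * ycoeff - B\<^sup>2 * cubic"

lemma reg_norm_mult:
  "reg_norm (A * C + B * D * cubic) (A * D + B * C - B * D * ycoeff) = reg_norm A B * reg_norm C D"
  unfolding reg_norm_def by (simp add: algebra_simps power2_eq_square)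

lemma reg_mult_conjugate: "reg A B * reg (A - B * ycoeff) (- B) = emb (reg_norm A B)"
  unfolding reg_mult by (simp add: emb_eq_reg reg_norm_def algebra_simps power2_eq_square)

lemma degree_reg_norm:
  "degree (reg_norm A B) = (if B = 0 then 2 * degree A else max (2 * degree A) (2 * degree B + 3))"
proof (cases "B = 0")
  case True
  thus ?thesis by (cases "A = 0") (simp_all add: reg_norm_def degree_power_eq)
next
  case False
  have square: "degree (A\<^sup>2) = 2 * degree A"
    by (cases "A = 0") (simp_all add: degree_power_eq)
  have "degree ycoeff \<le> 1" by (simp add: ycoeff_def)
  hence cross: "degree (A * B * ycoeff) \<le> degree A + degree B + 1"
    using degree_mult_le[of "A * B" ycoeff] degree_mult_le[of A B] by linarith
  have "degree cubic = 3" "cubic \<noteq> 0" by (simp_all add: cubic_def)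
  hence cubic: "degree (B\<^sup>2 * cubic) = 2 * degree B + 3"
    using False by (simp add: degree_mult_eq degree_power_eq)
  show ?thesis
  proof (cases "degree B + 2 \<le> degree A")
    case True
    have "degree (- (A * B * ycoeff + B\<^sup>2 * cubic)) < degree (A\<^sup>2)"
      unfolding square degree_minus using True cross cubic by (intro degree_add_less) linarith+
    from degree_add_eq_left[OF this] show ?thesis
      using True False square by (simp add: reg_norm_def algebra_simps)
  next
    case less: False
    have "degree (A\<^sup>2 - A * B * ycoeff) < degree (- (B\<^sup>2 * cubic))"
      unfolding degree_minus cubic using less cross square by (intro degree_diff_less) linarith+
    from degree_add_eq_right[OF this] show ?thesis
      using less False cubic by (simp add: reg_norm_def)
  qed
qed

lemma reg_norm_eq_0_iff [simp]: "reg_norm A B = 0 \<longleftrightarrow> A = 0 \<and> B = 0"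
proof
  assume norm: "reg_norm A B = 0"
  hence "B = 0" using degree_reg_norm[of A B] by (auto split: if_splits)
  thus "A = 0 \<and> B = 0" using norm by (simp add: reg_norm_def)
qed (simp add: reg_norm_def)

lemma reg_eq_0_iff [simp]: "reg A B = 0 \<longleftrightarrow> A = 0 \<and> B = 0"
proof
  assume "reg A B = 0"
  hence "emb (reg_norm A B) = 0" using reg_mult_conjugate[of A B] by simp
  thus "A = 0 \<and> B = 0" by simp
qed (simp add: reg_def)

lemma reg_eq_iff [simp]: "reg A B = reg C D \<longleftrightarrow> A = C \<and> B = D"
  using reg_eq_0_iff[of "A - C" "B - D"] unfolding reg_diff[symmetric] by auto

definition coord_ring :: "'a curve_fun set" where
  "coord_ring = {reg A B |A B. True}"

lemma reg_in_coord_ring [simp, intro]: "reg A B \<in> coord_ring"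
  by (auto simp: coord_ring_def)

lemma coord_ringE:
  assumes "z \<in> coord_ring"
  obtains A B where "z = reg A B"
  using assms by (auto simp: coord_ring_def)

lemma emb_in_coord_ring [simp, intro]: "emb A \<in> coord_ring"
  and genX_in_coord_ring [simp, intro]: "genX \<in> coord_ring"
  and genY_in_coord_ring [simp, intro]: "genY \<in> coord_ring"
  and zero_in_coord_ring [simp, intro]: "0 \<in> coord_ring"
  and one_in_coord_ring [simp, intro]: "1 \<in> coord_ring"
  using reg_in_coord_ring emb_eq_reg genY_eq_reg genX_def emb_0 emb_1 by metis+

lemma coord_ring_add [simp, intro]: "z \<in> coord_ring \<Longrightarrow> w \<in> coord_ring \<Longrightarrow> z + w \<in> coord_ring"
  and coord_ring_diff [simp, intro]: "z \<in> coord_ring \<Longrightarrow> w \<in> coord_ring \<Longrightarrow> z - w \<in> coord_ring"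
  and coord_ring_minus [simp, intro]: "z \<in> coord_ring \<Longrightarrow> - z \<in> coord_ring"
  and coord_ring_mult [simp, intro]: "z \<in> coord_ring \<Longrightarrow> w \<in> coord_ring \<Longrightarrow> z * w \<in> coord_ring"
  by (auto elim!: coord_ringE simp: reg_add reg_diff reg_minus reg_mult)

definition pole_order :: "'a curve_fun \<Rightarrow> nat" where
  "pole_order z = (THE n. \<exists>A B. z = reg A B \<and> n = degree (reg_norm A B))"

lemma pole_order_reg: "pole_order (reg A B) = degree (reg_norm A B)"
  unfolding pole_order_def by (rule the_equality) auto

lemma pole_order_mult:
  assumes "z \<in> coord_ring" "w \<in> coord_ring" "z \<noteq> 0" "w \<noteq> 0"
  shows "pole_order (z * w) = pole_order z + pole_order w"
proof -
  from assms obtain A B C D where "z = reg A B" "w = reg C D" by (auto elim!: coord_ringE)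
  thus ?thesis using assms by (simp add: reg_mult pole_order_reg reg_norm_mult degree_mult_eq)
qed

lemma pole_order_emb: "pole_order (emb A) = 2 * degree A"
  by (simp add: emb_eq_reg pole_order_reg degree_reg_norm)

lemma pole_order_1 [simp]: "pole_order 1 = 0"
  using pole_order_emb[of 1] by simp

lemma pole_order_genX_minus_cst: "pole_order (genX - cst x) = 2"
  unfolding genX_minus_cst pole_order_emb by simp

lemma pole_order_less_2D:
  assumes "z \<in> coord_ring" "pole_order z < 2"
  shows "\<exists>c. z = cst c"
proof -
  from assms obtain A B where z: "z = reg A B" and "degree (reg_norm A B) < 2"
    by (auto elim!: coord_ringE simp: pole_order_reg)
  hence "B = 0" "degree A = 0" by (auto simp: degree_reg_norm split: if_splits)
  thus ?thesis unfolding z by (auto simp: emb_eq_reg elim: degree_eq_zeroE)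
qed


section \<open>Ideals of points\<close>

definition is_ideal :: "'a curve_fun set \<Rightarrow> bool" where
  "is_ideal I \<longleftrightarrow> I \<subseteq> coord_ring \<and> 0 \<in> I \<and> (\<forall>a\<in>I. \<forall>b\<in>I. a + b \<in> I) \<and> (\<forall>r\<in>coord_ring. \<forall>a\<in>I. r * a \<in> I)"

lemma
  assumes "is_ideal I"
  shows ideal_subset: "a \<in> I \<Longrightarrow> a \<in> coord_ring"
    and ideal_0: "0 \<in> I"
    and ideal_add: "a \<in> I \<Longrightarrow> b \<in> I \<Longrightarrow> a + b \<in> I"
    and ideal_mult_left: "r \<in> coord_ring \<Longrightarrow> a \<in> I \<Longrightarrow> r * a \<in> I"
    and ideal_mult_right: "r \<in> coord_ring \<Longrightarrow> a \<in> I \<Longrightarrow> a * r \<in> I"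
  using assms by (auto simp: is_ideal_def mult.commute)

lemma ideal_minus: "is_ideal I \<Longrightarrow> a \<in> I \<Longrightarrow> - a \<in> I"
  using ideal_mult_left[of I "-1" a] by simp

lemma ideal_diff: "is_ideal I \<Longrightarrow> a \<in> I \<Longrightarrow> b \<in> I \<Longrightarrow> a - b \<in> I"
  using ideal_add[of I a "- b"] ideal_minus by simp

lemma ideal_cst_cancel:
  assumes I: "is_ideal I" and "c \<noteq> 0" "cst c * z \<in> I"
  shows "z \<in> I"
proof -
  have "cst (1 / c) * (cst c * z) \<in> I" by (rule ideal_mult_left[OF I _ assms(3)]) simp
  also have "cst (1 / c) * (cst c * z) = cst (1 / c * c) * z" by (simp only: cst_mult mult.assoc)
  finally show ?thesis using assms(2) by (simp add: cst_1)
qed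

lemma is_ideal_coord_ring [simp]: "is_ideal coord_ring"
  by (auto simp: is_ideal_def)

definition point_ideal :: "'a point \<Rightarrow> 'a curve_fun set" where
  "point_ideal T = (case T of Infinity \<Rightarrow> coord_ring
     | Affine x y \<Rightarrow> {reg A B |A B. poly A x + poly B x * y = 0})"

lemma point_ideal_Infinity [simp]: "point_ideal Infinity = coord_ring"
  by (simp add: point_ideal_def)

lemma reg_in_point_ideal_iff [simp]:
  "reg A B \<in> point_ideal (Affine x y) \<longleftrightarrow> poly A x + poly B x * y = 0"
  by (auto simp: point_ideal_def)

lemma point_idealE:
  assumes "z \<in> point_ideal (Affine x y)"
  obtains A B where "z = reg A B" "poly A x + poly B x * y = 0"
  using assms by (auto simp: point_ideal_def)

lemma cst_in_point_ideal_iff: "cst c \<in> point_ideal (Affine x y) \<longleftrightarrow> c = 0"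
  by (simp add: emb_eq_reg)

lemma genX_in_point_ideal [simp, intro]: "genX - cst x \<in> point_ideal (Affine x y)"
  and genY_in_point_ideal [simp, intro]: "genY - cst y \<in> point_ideal (Affine x y)"
proof -
  have "genX - cst x = reg [:-x, 1:] 0" "genY - cst y = reg [:-y:] 1"
    by (simp_all add: reg_def emb_pCons cst_simps)
  thus "genX - cst x \<in> point_ideal (Affine x y)" "genY - cst y \<in> point_ideal (Affine x y)"
    by simp_all
qed

lemma affine_in_ec_points [simp]: "Affine x y \<in> ec_points W \<longleftrightarrow> on_curve W x y"
  and Infinity_in_ec_points [simp]: "Infinity \<in> ec_points W"
  by (auto simp: ec_points_def)

lemma is_ideal_point_ideal:
  assumes "T \<in> ec_points W"
  shows "is_ideal (point_ideal T)"
proof (cases T)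
  case (Affine x y)
  hence curve: "y\<^sup>2 + poly ycoeff x * y = poly cubic x" using assms by (simp add: on_curve_iff_poly)
  have mult: "reg C D * reg A B \<in> point_ideal T" if "poly A x + poly B x * y = 0" for A B C D
  proof -
    have "poly (C * A + D * B * cubic) x + poly (C * B + D * A - D * B * ycoeff) x * y =
      (poly C x + poly D x * y) * (poly A x + poly B x * y)"
      unfolding poly_add poly_mult poly_diff curve[symmetric] by Groebner_Basis.algebra
    thus ?thesis using that by (simp add: Affine reg_mult)
  qed
  have add: "reg A B + reg C D \<in> point_ideal T"
    if "poly A x + poly B x * y = 0" "poly C x + poly D x * y = 0" for A B C D
  proof -
    have "poly (A + C) x + poly (B + D) x * y =
      (poly A x + poly B x * y) + (poly C x + poly D x * y)" by (simp add: algebra_simps)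
    thus ?thesis using that by (simp add: Affine reg_add)
  qed
  show ?thesis unfolding is_ideal_def
  proof (intro conjI ballI)
    show "0 \<in> point_ideal T"
      using reg_in_point_ideal_iff[of 0 0 x y] by (simp add: Affine reg_def)
  qed (use mult add in \<open>auto simp: Affine elim!: point_idealE coord_ringE\<close>)
qed simp

text \<open>
  Dividing \<open>A + B y\<close> by \<open>X - x\<close> shows that the ideal of \<open>(x, y)\<close> is generated by \<open>X - x\<close> and
  \<open>Y - y\<close>.
\<close>

lemma point_ideal_generators:
  assumes "z \<in> point_ideal (Affine x y)"
  obtains r s where "r \<in> coord_ring" "s \<in> coord_ring" "z = r * (genX - cst x) + s * (genY - cst y)"
proof -
  from assms obtain A B where z: "z = reg A B" and "poly A x + poly B x * y = 0" by (rule point_idealE)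
  hence "poly (A + B * [:y:]) x = 0" by (simp add: mult.commute)
  then obtain q where q: "A + B * [:y:] = [:-x, 1:] * q" unfolding poly_eq_0_iff_dvd by (elim dvdE)
  have "z = emb (A + B * [:y:]) + emb B * (genY - cst y)"
    unfolding z emb_add emb_mult by (simp add: reg_def algebra_simps)
  also have "emb (A + B * [:y:]) = emb q * (genX - cst x)"
    unfolding q genX_minus_cst emb_mult by (rule mult.commute)
  finally show thesis by (intro that) auto
qed

inductive_set ideal_mult :: "'a curve_fun set \<Rightarrow> 'a curve_fun set \<Rightarrow> 'a curve_fun set" for I J where
  zero: "0 \<in> ideal_mult I J"
| step: "a \<in> I \<Longrightarrow> b \<in> J \<Longrightarrow> c \<in> ideal_mult I J \<Longrightarrow> a * b + c \<in> ideal_mult I J"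

lemma mult_in_ideal_mult: "a \<in> I \<Longrightarrow> b \<in> J \<Longrightarrow> a * b \<in> ideal_mult I J"
  using ideal_mult.step[OF _ _ ideal_mult.zero, of a I b J] by simp

lemma ideal_mult_add: "x \<in> ideal_mult I J \<Longrightarrow> y \<in> ideal_mult I J \<Longrightarrow> x + y \<in> ideal_mult I J"
  by (induction rule: ideal_mult.induct) (auto simp: add.assoc intro: ideal_mult.step)

lemma scaled_ideal_mult_in_ideal:
  assumes "z \<in> ideal_mult I J" "is_ideal K" "\<And>a b. a \<in> I \<Longrightarrow> b \<in> J \<Longrightarrow> t * (a * b) \<in> K"
  shows "t * z \<in> K"
  using assms(1)
  by (induction rule: ideal_mult.induct)
    (auto simp: distrib_left ideal_0[OF assms(2)] ideal_add[OF assms(2)] assms(3))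

lemma ideal_mult_subsetI:
  assumes "is_ideal K" "\<And>a b. a \<in> I \<Longrightarrow> b \<in> J \<Longrightarrow> a * b \<in> K"
  shows "ideal_mult I J \<subseteq> K"
  using scaled_ideal_mult_in_ideal[of _ I J K 1] assms by auto

lemma is_ideal_ideal_mult:
  assumes "is_ideal I" "is_ideal J"
  shows "is_ideal (ideal_mult I J)"
proof -
  have "r * z \<in> ideal_mult I J" if "r \<in> coord_ring" "z \<in> ideal_mult I J" for r z
    using that(2)
  proof (induction rule: ideal_mult.induct)
    case (step a b c)
    have "(r * a) * b + r * c \<in> ideal_mult I J"
      using step that by (intro ideal_mult.step ideal_mult_left[OF assms(1)])
    thus ?case by (simp add: algebra_simps)
  qed (simp add: ideal_mult.zero)
  moreover have "ideal_mult I J \<subseteq> coord_ring"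
    using assms by (intro ideal_mult_subsetI) (auto dest: ideal_subset)
  ultimately show ?thesis using ideal_mult_add ideal_mult.zero by (auto simp: is_ideal_def)
qed

lemma ideal_mult_coord_ring:
  assumes "is_ideal I"
  shows "ideal_mult coord_ring I = I" "ideal_mult I coord_ring = I"
proof -
  have "ideal_mult coord_ring I \<subseteq> I"
    by (intro ideal_mult_subsetI assms ideal_mult_left[OF assms])
  moreover have "ideal_mult I coord_ring \<subseteq> I"
    by (intro ideal_mult_subsetI assms ideal_mult_right[OF assms])
  moreover have "I \<subseteq> ideal_mult coord_ring I" "I \<subseteq> ideal_mult I coord_ring"
    using mult_in_ideal_mult[of 1 coord_ring _ I] mult_in_ideal_mult[of _ I 1 coord_ring] by auto
  ultimately show "ideal_mult coord_ring I = I" "ideal_mult I coord_ring = I" by auto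
qed

lemma ideal_mult_left_commute:
  assumes I: "is_ideal I" and J: "is_ideal J" and K: "is_ideal K"
  shows "ideal_mult I (ideal_mult J K) = ideal_mult J (ideal_mult I K)"
proof -
  have "ideal_mult I (ideal_mult J K) \<subseteq> ideal_mult J (ideal_mult I K)"
    if ideals: "is_ideal I" "is_ideal J" "is_ideal K" for I J K
  proof (rule ideal_mult_subsetI)
    show ideal: "is_ideal (ideal_mult J (ideal_mult I K))" using ideals by (intro is_ideal_ideal_mult)
    fix a b assume a: "a \<in> I" and "b \<in> ideal_mult J K"
    from this(2) show "a * b \<in> ideal_mult J (ideal_mult I K)"
    proof (rule scaled_ideal_mult_in_ideal[OF _ ideal])
      fix c d assume "c \<in> J" "d \<in> K"
      hence "c * (a * d) \<in> ideal_mult J (ideal_mult I K)" using a by (intro mult_in_ideal_mult)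
      thus "a * (c * d) \<in> ideal_mult J (ideal_mult I K)" by (simp add: ac_simps)
    qed
  qed
  thus ?thesis using assms by blast
qed

end


section \<open>Lines\<close>

definition ec_neg :: "'a::field weierstrass \<Rightarrow> 'a point \<Rightarrow> 'a point" where
  "ec_neg W T = (case T of Infinity \<Rightarrow> Infinity
     | Affine x y \<Rightarrow> Affine x (- y - wa1 W * x - wa3 W))"

lemma ec_neg_simps [simp]:
  "ec_neg W Infinity = Infinity"
  "ec_neg W (Affine x y) = Affine x (- y - wa1 W * x - wa3 W)"
  by (simp_all add: ec_neg_def)

lemma ec_neg_ec_neg [simp]: "ec_neg W (ec_neg W T) = T"
  by (cases T) auto

lemma ec_neg_eq_Infinity_iff [simp]: "ec_neg W T = Infinity \<longleftrightarrow> T = Infinity"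
  by (cases T) auto

definition slope :: "'a::field weierstrass \<Rightarrow> 'a point \<Rightarrow> 'a point \<Rightarrow> 'a" where
  "slope W S T = (case (S, T) of (Affine x1 y1, Affine x2 y2) \<Rightarrow>
       if x1 \<noteq> x2 then (y2 - y1) / (x2 - x1)
       else (3 * x1\<^sup>2 + 2 * wa2 W * x1 + wa4 W - wa1 W * y1) / (2 * y1 + wa1 W * x1 + wa3 W)
     | _ \<Rightarrow> 0)"

lemma ec_add_affine:
  "ec_add W (Affine x1 y1) (Affine x2 y2) =
    (if x1 = x2 \<and> y1 + y2 + wa1 W * x1 + wa3 W = 0 then Infinity
     else let l = slope W (Affine x1 y1) (Affine x2 y2);
              x3 = l\<^sup>2 + wa1 W * l - wa2 W - x1 - x2
          in Affine x3 (- (l + wa1 W) * x3 - (y1 - l * x1) - wa3 W))"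
  by (auto simp: slope_def Let_def)

lemma ec_add_Infinity_right [simp]: "ec_add W T Infinity = T"
  by (cases T) auto

lemma elliptic_curve_nonsingular:
  assumes "elliptic_curve W" "on_curve W x y"
  shows "2 * y + wa1 W * x + wa3 W \<noteq> 0 \<or> 3 * x\<^sup>2 + 2 * wa2 W * x + wa4 W - wa1 W * y \<noteq> 0"
proof (rule ccontr)
  assume "\<not> ?thesis"
  hence deriv: "2 * y + wa1 W * x + wa3 W = 0" "3 * x\<^sup>2 + 2 * wa2 W * x + wa4 W - wa1 W * y = 0"
    by auto
  have a3: "wa3 W = - 2 * y - wa1 W * x"
    using deriv(1) by (simp add: add_eq_0_iff)
  have a4: "wa4 W = wa1 W * y - 3 * x\<^sup>2 - 2 * wa2 W * x"
    using deriv(2) by (simp add: algebra_simps)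
  have a6: "wa6 W = y\<^sup>2 + wa1 W * x * y + wa3 W * y - (x ^ 3 + wa2 W * x\<^sup>2 + wa4 W * x)"
    using assms(2) by (simp add: on_curve_def)
  define b2 where "b2 = (wa1 W)\<^sup>2 + 4 * wa2 W"
  have b4: "2 * wa4 W + wa1 W * wa3 W = - 6 * x\<^sup>2 - b2 * x"
    unfolding b2_def a4 a3 by (simp add: algebra_simps power2_eq_square)
  have b6: "(wa3 W)\<^sup>2 + 4 * wa6 W = 8 * x ^ 3 + b2 * x\<^sup>2"
    unfolding b2_def a6 a4 a3 by (simp add: algebra_simps power2_eq_square power3_eq_cube)
  have b8: "(wa1 W)\<^sup>2 * wa6 W + 4 * wa2 W * wa6 W - wa1 W * wa3 W * wa4 W
      + wa2 W * (wa3 W)\<^sup>2 - (wa4 W)\<^sup>2 = - 9 * x ^ 4 - b2 * x ^ 3"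
    unfolding b2_def a6 a4 a3 by (simp add: algebra_simps power2_eq_square power3_eq_cube power4_eq_xxxx)
  have "w_discriminant W = 0"
    unfolding w_discriminant_def Let_def b4 b6 b8 b2_def[symmetric]
    by (simp add: algebra_simps power2_eq_square power3_eq_cube power4_eq_xxxx)
  with assms(1) show False by (simp add: elliptic_curve_def)
qed

context weierstrass_curve begin

lemma ec_neg_in_ec_points: "T \<in> ec_points W \<Longrightarrow> ec_neg W T \<in> ec_points W"
proof (cases T)
  case (Affine x y)
  have "(- y - a1 * x - a3)\<^sup>2 + a1 * x * (- y - a1 * x - a3) + a3 * (- y - a1 * x - a3)
      = y\<^sup>2 + a1 * x * y + a3 * y"
    by Groebner_Basis.algebra
  thus "T \<in> ec_points W \<Longrightarrow> ec_neg W T \<in> ec_points W"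
    by (simp add: Affine on_curve_def)
qed simp

lemma on_curve_same_x:
  assumes "on_curve W x y1" "on_curve W x y2"
  shows "y2 = y1 \<or> y2 = - y1 - a1 * x - a3"
proof -
  have "(y2 - y1) * (y2 - (- y1 - a1 * x - a3)) =
      (y2\<^sup>2 + a1 * x * y2 + a3 * y2) - (y1\<^sup>2 + a1 * x * y1 + a3 * y1)"
    by Groebner_Basis.algebra
  also have "\<dots> = 0" using assms by (simp add: on_curve_def)
  finally show ?thesis by auto
qed

lemma ec_add_eq_Infinity_iff: "ec_add W S T = Infinity \<longleftrightarrow> S = ec_neg W T"
proof (cases S; cases T)
  fix x1 y1 x2 y2 assume ST: "S = Affine x1 y1" "T = Affine x2 y2"
  have "y1 + y2 + a1 * x1 + a3 = 0 \<longleftrightarrow> y1 = - y2 - a1 * x1 - a3"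
    by (auto simp: algebra_simps add_eq_0_iff2)
  thus ?thesis using ST by (auto simp: Let_def)
qed auto

lemma ec_add_ec_neg [simp]: "ec_add W T (ec_neg W T) = Infinity" "ec_add W (ec_neg W T) T = Infinity"
  by (simp_all add: ec_add_eq_Infinity_iff)

definition line :: "'a \<Rightarrow> 'a \<Rightarrow> 'a curve_fun" where
  "line l n = genY - cst l * genX - cst n"

lemma line_eq_reg: "line l n = reg [:-n, -l:] 1"
  by (simp add: line_def reg_def emb_pCons cst_simps)

lemma line_in_coord_ring [simp, intro]: "line l n \<in> coord_ring" and line_neq_0 [simp]: "line l n \<noteq> 0"
  by (simp_all add: line_eq_reg)

lemma pole_order_line: "pole_order (line l n) = 3"
  by (simp add: line_eq_reg pole_order_reg degree_reg_norm)

abbreviation line_point :: "'a \<Rightarrow> 'a \<Rightarrow> 'a \<Rightarrow> 'a point" where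
  "line_point l n x \<equiv> Affine x (l * x + n)"

lemma ec_neg_line_point: "ec_neg W (line_point l n x) = line_point (- l - a1) (- n - a3) x"
  by (simp add: algebra_simps)

text \<open>
  The line \<open>y = l x + n\<close> meets the curve in three points with the abscissae \<open>x1\<close>, \<open>x2\<close>, \<open>x3\<close>,
  counted with multiplicity.
\<close>

definition collinear :: "'a \<Rightarrow> 'a \<Rightarrow> 'a \<Rightarrow> 'a \<Rightarrow> 'a \<Rightarrow> bool" where
  "collinear l n x1 x2 x3 \<longleftrightarrow> reg_norm [:-n, -l:] 1 = - ([:-x1, 1:] * [:-x2, 1:] * [:-x3, 1:])"

lemma collinear_swap: "collinear l n x1 x2 x3 \<longleftrightarrow> collinear l n x2 x1 x3"
  and collinear_rotate: "collinear l n x1 x2 x3 \<longleftrightarrow> collinear l n x2 x3 x1"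
  unfolding collinear_def by (simp_all only: mult_ac)

lemma collinear_neg: "collinear l n x1 x2 x3 \<Longrightarrow> collinear (- l - a1) (- n - a3) x1 x2 x3"
proof -
  have "reg_norm (ycoeff - A) 1 = reg_norm A 1" for A
    by (simp add: reg_norm_def algebra_simps power2_eq_square)
  from this[of "[:-n, -l:]"]
  show "collinear l n x1 x2 x3 \<Longrightarrow> collinear (- l - a1) (- n - a3) x1 x2 x3"
    by (simp add: collinear_def ycoeff_def add.commute)
qed

lemma collinear_iff_Vieta:
  "collinear l n x1 x2 x3 \<longleftrightarrow>
     x1 + x2 + x3 = l\<^sup>2 + a1 * l - a2 \<and>
     x1 * x2 + x1 * x3 + x2 * x3 = a4 - 2 * l * n - a3 * l - a1 * n \<and>
     x1 * x2 * x3 = n\<^sup>2 + a3 * n - a6"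
proof -
  have norm: "reg_norm [:-n, -l:] 1 =
      [:n\<^sup>2 + a3 * n - a6, 2 * l * n + a3 * l + a1 * n - a4, l\<^sup>2 + a1 * l - a2, -1:]"
    by (simp add: reg_norm_def ycoeff_def cubic_def power2_eq_square algebra_simps)
  have prod: "- ([:-x1, 1:] * [:-x2, 1:] * [:-x3, 1:]) =
      [:x1 * x2 * x3, - (x1 * x2 + x1 * x3 + x2 * x3), x1 + x2 + x3, -1:]"
    by (simp add: algebra_simps)
  have "2 * l * n + a3 * l + a1 * n - a4 = - (a4 - 2 * l * n - a3 * l - a1 * n)" by simp
  thus ?thesis unfolding collinear_def norm prod pCons_eq_iff by (simp only: neg_equal_iff_equal) auto
qed

lemma on_curve_iff_collinear:
  assumes "collinear l n x1 x2 x3"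
  shows "on_curve W x (l * x + n) \<longleftrightarrow> x = x1 \<or> x = x2 \<or> x = x3"
proof -
  have "on_curve W x (l * x + n) \<longleftrightarrow> poly (reg_norm [:-n, -l:] 1) x = 0"
    by (simp add: on_curve_iff_poly reg_norm_def algebra_simps power2_eq_square)
  also have "poly (reg_norm [:-n, -l:] 1) x = - (poly [:-x1, 1:] x * poly [:-x2, 1:] x * poly [:-x3, 1:] x)"
    using assms unfolding collinear_def by (simp only: poly_minus poly_mult)
  finally show ?thesis by simp
qed

lemma collinear_on_curve:
  assumes "collinear l n x1 x2 x3"
  shows "line_point l n x1 \<in> ec_points W" "line_point l n x2 \<in> ec_points W"
      "line_point l n x3 \<in> ec_points W"
  using on_curve_iff_collinear[OF assms] by simp_all

lemma line_mult_conjugate: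
  assumes "collinear l n x1 x2 x3"
  shows "line l n * line (- l - a1) (- n - a3) = (genX - cst x1) * (genX - cst x2) * (genX - cst x3)"
proof -
  have "line (- l - a1) (- n - a3) = - reg ([:-n, -l:] - 1 * ycoeff) (- 1)"
    unfolding line_eq_reg reg_minus by (simp add: ycoeff_def)
  hence "line l n * line (- l - a1) (- n - a3) = - emb (reg_norm [:-n, -l:] 1)"
    using reg_mult_conjugate[of "[:-n, -l:]" 1] by (simp add: line_eq_reg)
  thus ?thesis
    using assms unfolding collinear_def genX_minus_cst by (simp only: emb_mult emb_minus minus_minus)
qed

lemma line_cubic_residue:
  assumes "x3 = l\<^sup>2 + a1 * l - a2 - x1 - x2"
  shows "(a4 - 2 * l * n - a3 * l - a1 * n - (x1 * x2 + x1 * x3 + x2 * x3)) * x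
      - (n\<^sup>2 + a3 * n - a6 - x1 * x2 * x3) =
    (x - x1) * (x - x2) * (x3 - x) + (x ^ 3 + a2 * x\<^sup>2 + a4 * x + a6) -
      ((l * x + n)\<^sup>2 + a1 * x * (l * x + n) + a3 * (l * x + n))"
  unfolding assms by Groebner_Basis.algebra

lemma collinearI_secant:
  assumes "on_curve W x1 (l * x1 + n)" "on_curve W x2 (l * x2 + n)" "x1 \<noteq> x2"
  shows "collinear l n x1 x2 (l\<^sup>2 + a1 * l - a2 - x1 - x2)"
proof -
  define x3 where "x3 = l\<^sup>2 + a1 * l - a2 - x1 - x2"
  define d1 where "d1 = a4 - 2 * l * n - a3 * l - a1 * n - (x1 * x2 + x1 * x3 + x2 * x3)"
  define d0 where "d0 = n\<^sup>2 + a3 * n - a6 - x1 * x2 * x3"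
  note residue = line_cubic_residue[OF x3_def, of n, folded d1_def d0_def]
  have "d1 * x1 - d0 = 0" "d1 * x2 - d0 = 0"
    using residue[of x1] residue[of x2] assms(1,2) by (simp_all add: on_curve_def)
  moreover from this have "d1 * (x1 - x2) = 0" by (simp add: algebra_simps)
  ultimately have "d1 = 0" "d0 = 0" using assms(3) by auto
  thus ?thesis unfolding collinear_iff_Vieta x3_def[symmetric] d1_def d0_def by (simp add: x3_def)
qed

lemma collinearI_tangent:
  assumes "on_curve W x (l * x + n)"
    and tangent: "l * (2 * (l * x + n) + a1 * x + a3) = 3 * x\<^sup>2 + 2 * a2 * x + a4 - a1 * (l * x + n)"
  shows "collinear l n x x (l\<^sup>2 + a1 * l - a2 - x - x)"
proof -
  define x3 where "x3 = l\<^sup>2 + a1 * l - a2 - x - x"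
  define d1 where "d1 = a4 - 2 * l * n - a3 * l - a1 * n - (x * x + x * x3 + x * x3)"
  define d0 where "d0 = n\<^sup>2 + a3 * n - a6 - x * x * x3"
  have "d1 = 3 * x\<^sup>2 + 2 * a2 * x + a4 - a1 * (l * x + n) - l * (2 * (l * x + n) + a1 * x + a3)"
    unfolding d1_def x3_def by Groebner_Basis.algebra
  hence "d1 = 0" unfolding tangent by simp
  moreover from this have "d0 = 0"
    using line_cubic_residue[OF x3_def, of n x, folded d1_def d0_def] assms(1) by (simp add: on_curve_def)
  ultimately show ?thesis
    unfolding collinear_iff_Vieta x3_def[symmetric] d1_def d0_def by (simp add: x3_def)
qed

lemma collinear_tangentD:
  assumes "collinear l n x x x3"
  shows "l * (2 * (l * x + n) + a1 * x + a3) = 3 * x\<^sup>2 + 2 * a2 * x + a4 - a1 * (l * x + n)"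
proof -
  have "l * (2 * (l * x + n) + a1 * x + a3) - (3 * x\<^sup>2 + 2 * a2 * x + a4 - a1 * (l * x + n)) =
      x * x + x * x3 + x * x3 - (a4 - 2 * l * n - a3 * l - a1 * n) +
      2 * x * (l\<^sup>2 + a1 * l - a2 - (x + x + x3))"
    by Groebner_Basis.algebra
  thus ?thesis using assms unfolding collinear_iff_Vieta by simp
qed

lemma slope_collinear:
  assumes "S \<in> ec_points W" "T \<in> ec_points W" "S \<noteq> Infinity" "T \<noteq> Infinity" "ec_add W S T \<noteq> Infinity"
  obtains n x1 x2 x3 where
    "S = line_point (slope W S T) n x1" "T = line_point (slope W S T) n x2"
    "collinear (slope W S T) n x1 x2 x3"
proof -
  obtain x1 y1 x2 y2 where ST: "S = Affine x1 y1" "T = Affine x2 y2"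
    using assms(3,4) by (metis point.exhaust)
  define l where "l = slope W S T"
  define n where "n = y1 - l * x1"
  have y1: "l * x1 + n = y1" by (simp add: n_def)
  have curve: "on_curve W x1 y1" "on_curve W x2 y2" using assms(1,2) ST by simp_all
  have "l * x2 + n = y2 \<and> (\<exists>x3. collinear l n x1 x2 x3)"
  proof (cases "x1 = x2")
    case False
    hence "l * (x2 - x1) = y2 - y1" by (simp add: l_def slope_def ST)
    hence "l * x2 + n = y2" by (simp add: n_def algebra_simps)
    thus ?thesis using collinearI_secant[of x1 l n x2] curve False y1 by metis
  next
    case True
    have "y2 \<noteq> - y1 - a1 * x1 - a3"
      using assms(5) True by (auto simp: ST ec_add_eq_Infinity_iff algebra_simps)
    hence y2: "y2 = y1" using on_curve_same_x curve True by blast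
    hence "2 * y1 + a1 * x1 + a3 \<noteq> 0"
      using \<open>y2 \<noteq> - y1 - a1 * x1 - a3\<close> by (auto simp: algebra_simps eq_neg_iff_add_eq_0)
    hence "l * (2 * y1 + a1 * x1 + a3) = 3 * x1\<^sup>2 + 2 * a2 * x1 + a4 - a1 * y1"
      using True by (simp add: l_def slope_def ST)
    thus ?thesis using collinearI_tangent[of x1 l n] curve(1) y1 y2 True by auto
  qed
  then obtain x3 where "l * x2 + n = y2" "collinear l n x1 x2 x3" by blast
  with ST y1 show thesis unfolding l_def by (intro that[where n = n and ?x1.0 = x1 and ?x2.0 = x2]) simp_all
qed

lemma slope_commute:
  assumes "S \<in> ec_points W" "T \<in> ec_points W" "S \<noteq> Infinity" "T \<noteq> Infinity" "ec_add W S T \<noteq> Infinity"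
  shows "slope W S T = slope W T S"
proof -
  obtain n x1 x2 where ST: "S = line_point (slope W S T) n x1" "T = line_point (slope W S T) n x2"
    using slope_collinear[OF assms] by metis
  show ?thesis
  proof (cases "x1 = x2")
    case True
    thus ?thesis using ST by metis
  next
    case False
    have "slope W (line_point l n x2) (line_point l n x1) = l" for l
      using False by (simp add: slope_def flip: right_diff_distrib)
    thus ?thesis using ST by metis
  qed
qed

end


section \<open>Products of point ideals\<close>

context weierstrass_curve begin

lemma collinear_ideal_mult_subset:
  assumes collinear: "collinear l n x1 x2 x3"
    and z: "z \<in> ideal_mult (point_ideal (line_point l n x1)) (point_ideal (line_point l n x2))"
  shows "(genX - cst x3) / line l n * z \<in> point_ideal (ec_neg W (line_point l n x3))" (is "_ \<in> ?K")
proof -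
  have ideal: "is_ideal ?K"
    by (intro is_ideal_point_ideal ec_neg_in_ec_points collinear_on_curve(3)[OF collinear])
  show ?thesis using z ideal
  proof (rule scaled_ideal_mult_in_ideal)
    fix a b assume "a \<in> point_ideal (line_point l n x1)" "b \<in> point_ideal (line_point l n x2)"
    then obtain r s r' s' where coeffs: "r \<in> coord_ring" "s \<in> coord_ring" "r' \<in> coord_ring"
      "s' \<in> coord_ring"
      and ab: "a = r * (genX - cst x1) + s * (genY - cst (l * x1 + n))"
        "b = r' * (genX - cst x2) + s' * (genY - cst (l * x2 + n))"
      by (auto elim!: point_ideal_generators)
    define u where "u = r + s * cst l"
    define u' where "u' = r' + s' * cst l"
    have ab': "a = u * (genX - cst x1) + s * line l n" "b = u' * (genX - cst x2) + s' * line l n"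
      unfolding ab u_def u'_def line_def cst_simps by Groebner_Basis.algebra+
    let ?m = "line (- l - a1) (- n - a3)"
    let ?w = "u * u' * ?m + (s * b + s' * u * (genX - cst x1)) * (genX - cst x3)"
    have "a * b * (genX - cst x3) - line l n * ?w = u * u' *
        ((genX - cst x1) * (genX - cst x2) * (genX - cst x3) - line l n * ?m)"
      unfolding ab' by Groebner_Basis.algebra
    hence "(genX - cst x3) / line l n * (a * b) = ?w"
      unfolding line_mult_conjugate[OF collinear] by (simp add: field_simps)
    moreover have "?m \<in> ?K" "genX - cst x3 \<in> ?K"
      unfolding line_eq_reg by (simp_all add: algebra_simps)
    moreover have "u \<in> coord_ring" "u' \<in> coord_ring" "b \<in> coord_ring"
      unfolding u_def u'_def ab using coeffs by auto
    ultimately show "(genX - cst x3) / line l n * (a * b) \<in> ?K"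
      using coeffs ideal by (auto intro!: ideal_add ideal_mult_left)
  qed
qed

definition vertical_cofactor :: "'a \<Rightarrow> 'a curve_fun" where
  "vertical_cofactor x =
     genX\<^sup>2 + cst x * genX + (cst x)\<^sup>2 + cst a2 * (genX + cst x) + cst a4 - cst a1 * genY"

lemma vertical_cofactor_in_coord_ring [simp]: "vertical_cofactor x \<in> coord_ring"
  by (auto simp: vertical_cofactor_def power2_eq_square)

lemma genY_mult_conjugate:
  assumes "on_curve W x y"
  shows "(genY - cst y) * (genY - cst (- y - a1 * x - a3)) = (genX - cst x) * vertical_cofactor x"
proof -
  have point: "(cst y)\<^sup>2 + cst a1 * cst x * cst y + cst a3 * cst y
      = (cst x) ^ 3 + cst a2 * (cst x)\<^sup>2 + cst a4 * cst x + cst a6"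
    using assms[unfolded on_curve_def] unfolding cst_simps[symmetric] emb_eq_iff by auto
  have "(genY - cst y) * (genY - cst (- y - a1 * x - a3)) - (genX - cst x) * vertical_cofactor x =
      (genY\<^sup>2 + cst a1 * genX * genY + cst a3 * genY
        - (genX ^ 3 + cst a2 * genX\<^sup>2 + cst a4 * genX + cst a6))
      - ((cst y)\<^sup>2 + cst a1 * cst x * cst y + cst a3 * cst y
         - ((cst x) ^ 3 + cst a2 * (cst x)\<^sup>2 + cst a4 * cst x + cst a6))"
    unfolding vertical_cofactor_def cst_simps by Groebner_Basis.algebra
  thus ?thesis unfolding generic_point_on_curve point by simp
qed

lemma point_ideal_neg_subset:
  assumes T: "Affine x y \<in> ec_points W"
    and z: "z \<in> ideal_mult (point_ideal (Affine x y)) (point_ideal (ec_neg W (Affine x y)))"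
  shows "1 / (genX - cst x) * z \<in> coord_ring"
  using z is_ideal_coord_ring
proof (rule scaled_ideal_mult_in_ideal)
  fix a b assume "a \<in> point_ideal (Affine x y)" "b \<in> point_ideal (ec_neg W (Affine x y))"
  then obtain r s r' s' where coeffs: "r \<in> coord_ring" "s \<in> coord_ring" "r' \<in> coord_ring" "s' \<in> coord_ring"
    and ab: "a = r * (genX - cst x) + s * (genY - cst y)"
      "b = r' * (genX - cst x) + s' * (genY - cst (- y - a1 * x - a3))"
    by (auto elim!: point_ideal_generators)
  let ?w = "r * b + r' * s * (genY - cst y) + s * s' * vertical_cofactor x"
  have "a * b - (genX - cst x) * ?w = s * s' *
      ((genY - cst y) * (genY - cst (- y - a1 * x - a3)) - (genX - cst x) * vertical_cofactor x)"
    unfolding ab by Groebner_Basis.algebra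
  hence "a * b = (genX - cst x) * ?w" using T by (simp add: genY_mult_conjugate)
  hence "1 / (genX - cst x) * (a * b) = ?w" using genX_minus_cst_neq_0[of x] by simp
  moreover have "?w \<in> coord_ring" unfolding ab using coeffs by auto
  ultimately show "1 / (genX - cst x) * (a * b) \<in> coord_ring" by metis
qed

end

locale ell_curve = weierstrass_curve +
  assumes elliptic: "elliptic_curve W"
begin

text \<open>This is where the curve has to be nonsingular.\<close>

lemma genX_in_ideal_mult_neg:
  assumes "Affine x y \<in> ec_points W"
  shows "genX - cst x \<in> ideal_mult (point_ideal (Affine x y)) (point_ideal (ec_neg W (Affine x y)))"
    (is "_ \<in> ?I")
proof -
  have curve: "on_curve W x y" using assms by simp
  have ideal: "is_ideal ?I"
    using assms ec_neg_in_ec_points[OF assms] by (intro is_ideal_ideal_mult is_ideal_point_ideal)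
  let ?y = "- y - a1 * x - a3"
  have XX: "(genX - cst x) * (genX - cst x) \<in> ?I" by (intro mult_in_ideal_mult) auto
  have XY: "(genX - cst x) * (genY - cst ?y) \<in> ?I" by (intro mult_in_ideal_mult) auto
  have YX: "(genY - cst y) * (genX - cst x) \<in> ?I" by (intro mult_in_ideal_mult) auto
  have YY: "(genX - cst x) * vertical_cofactor x \<in> ?I"
    unfolding genY_mult_conjugate[OF curve, symmetric] by (intro mult_in_ideal_mult) auto
  let ?dy = "2 * y + a1 * x + a3" and ?dx = "3 * x\<^sup>2 + 2 * a2 * x + a4 - a1 * y"
  have "cst ?dy * (genX - cst x) = (genX - cst x) * (genY - cst ?y) - (genY - cst y) * (genX - cst x)"
    unfolding cst_simps by Groebner_Basis.algebra
  also have "\<dots> \<in> ?I" by (rule ideal_diff[OF ideal XY YX])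
  finally have dy: "cst ?dy * (genX - cst x) \<in> ?I" .
  have "cst ?dx * (genX - cst x) = (genX - cst x) * vertical_cofactor x
      - (genX + 2 * cst x + cst a2) * ((genX - cst x) * (genX - cst x))
        + cst a1 * ((genY - cst y) * (genX - cst x))"
    unfolding cst_simps vertical_cofactor_def by Groebner_Basis.algebra
  also have "\<dots> \<in> ?I"
    by (intro ideal_add[OF ideal] ideal_diff[OF ideal] YY
      ideal_mult_left[OF ideal _ XX] ideal_mult_left[OF ideal _ YX])
      (auto simp flip: cst_numeral)
  finally have dx: "cst ?dx * (genX - cst x) \<in> ?I" .
  have "?dy \<noteq> 0 \<or> ?dx \<noteq> 0" by (rule elliptic_curve_nonsingular[OF elliptic curve])
  thus ?thesis using ideal_cst_cancel[OF ideal _ dy] ideal_cst_cancel[OF ideal _ dx] by blast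
qed

lemma neg_products_in_coord_ring:
  assumes collinear: "collinear l n x1 x2 x3" and w: "w \<in> point_ideal (ec_neg W (line_point l n x3))"
    and b: "b1 \<in> point_ideal (ec_neg W (line_point l n x1))"
        "b2 \<in> point_ideal (ec_neg W (line_point l n x2))"
  shows "w / line (- l - a1) (- n - a3) * (b1 * b2) \<in> coord_ring"
proof -
  let ?l = "- l - a1" and ?n = "- n - a3"
  let ?S = "line_point ?l ?n x3"
  have "(genX - cst x3) / line ?l ?n * (b1 * b2) \<in> point_ideal (ec_neg W ?S)"
    using b unfolding ec_neg_line_point[where l = l and n = n]
    by (intro collinear_ideal_mult_subset[OF collinear_neg[OF collinear]] mult_in_ideal_mult)
  hence "w * ((genX - cst x3) / line ?l ?n * (b1 * b2))
      \<in> ideal_mult (point_ideal ?S) (point_ideal (ec_neg W ?S))"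
    using w unfolding ec_neg_line_point[where l = l and n = n] by (intro mult_in_ideal_mult)
  hence "1 / (genX - cst x3) * (w * ((genX - cst x3) / line ?l ?n * (b1 * b2))) \<in> coord_ring"
    by (rule point_ideal_neg_subset[OF collinear_on_curve(3)[OF collinear_neg[OF collinear]]])
  thus ?thesis using genX_minus_cst_neq_0[of x3] by simp
qed

lemma collinear_ideal_mult_superset:
  assumes collinear: "collinear l n x1 x2 x3" and w: "w \<in> point_ideal (ec_neg W (line_point l n x3))"
  shows "line l n / (genX - cst x3) * w \<in>
    ideal_mult (point_ideal (line_point l n x1)) (point_ideal (line_point l n x2))" (is "_ \<in> ?I")
proof -
  let ?m = "line (- l - a1) (- n - a3)"
  note points = collinear_on_curve[OF collinear]
  have ideal: "is_ideal ?I" using points by (intro is_ideal_ideal_mult is_ideal_point_ideal)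
  have "w / ?m * (genX - cst x2) * (genX - cst x1) \<in> ?I"
    using genX_in_ideal_mult_neg[OF points(1)] ideal
  proof (rule scaled_ideal_mult_in_ideal)
    fix a b assume ab: "a \<in> point_ideal (line_point l n x1)"
      "b \<in> point_ideal (ec_neg W (line_point l n x1))"
    have "w / ?m * (a * b) * (genX - cst x2) \<in> ?I"
      using genX_in_ideal_mult_neg[OF points(2)] ideal
    proof (rule scaled_ideal_mult_in_ideal)
      fix a' b' assume ab': "a' \<in> point_ideal (line_point l n x2)"
        "b' \<in> point_ideal (ec_neg W (line_point l n x2))"
      have "(w / ?m * (b * b')) * (a * a') \<in> ?I"
        using ab ab'
        by (intro ideal_mult_left[OF ideal] mult_in_ideal_mult neg_products_in_coord_ring[OF collinear w])
      thus "w / ?m * (a * b) * (a' * b') \<in> ?I" by (simp add: mult_ac)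
    qed
    thus "w / ?m * (genX - cst x2) * (a * b) \<in> ?I" by (simp add: mult_ac)
  qed
  moreover have "line l n / (genX - cst x3) = (genX - cst x2) * (genX - cst x1) / ?m"
    using line_mult_conjugate[OF collinear] genX_minus_cst_neq_0[of x3] by (simp add: field_simps)
  ultimately show ?thesis by (simp add: mult_ac)
qed

end


section \<open>Linear equivalence and the group law\<close>

context weierstrass_curve begin

text \<open>Lists of points stand for effective divisors; the point at infinity does not contribute.\<close>

fun points_ideal :: "'a point list \<Rightarrow> 'a curve_fun set" where
  "points_ideal [] = coord_ring"
| "points_ideal (T # Ts) = ideal_mult (point_ideal T) (points_ideal Ts)"

lemma is_ideal_points_ideal: "set Ts \<subseteq> ec_points W \<Longrightarrow> is_ideal (points_ideal Ts)"
  by (induction Ts) (auto intro: is_ideal_ideal_mult is_ideal_point_ideal)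

lemma points_ideal_singleton: "T \<in> ec_points W \<Longrightarrow> points_ideal [T] = point_ideal T"
  by (simp add: ideal_mult_coord_ring is_ideal_point_ideal)

lemma points_ideal_pair:
  "T \<in> ec_points W \<Longrightarrow> points_ideal [S, T] = ideal_mult (point_ideal S) (point_ideal T)"
  using points_ideal_singleton by simp

lemma points_ideal_Infinity: "set Ts \<subseteq> ec_points W \<Longrightarrow> points_ideal (Infinity # Ts) = points_ideal Ts"
  by (simp add: ideal_mult_coord_ring is_ideal_points_ideal)

lemma points_ideal_move_to_front:
  assumes "T \<in> ec_points W" "set Ts \<subseteq> ec_points W" "set Us \<subseteq> ec_points W"
  shows "points_ideal (Ts @ T # Us) = points_ideal (T # Ts @ Us)"
  using assms(2)
proof (induction Ts)
  case (Cons S Ts)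
  thus ?case
    using ideal_mult_left_commute[of "point_ideal S" "point_ideal T" "points_ideal (Ts @ Us)"] assms
    by (simp add: is_ideal_point_ideal is_ideal_points_ideal)
qed simp

definition affine_degree :: "'a point list \<Rightarrow> nat" where
  "affine_degree Ts = length (filter (\<lambda>T. T \<noteq> Infinity) Ts)"

lemma affine_degree_simps [simp]:
  "affine_degree [] = 0"
  "affine_degree (T # Ts) = (if T = Infinity then 0 else 1) + affine_degree Ts"
  by (simp_all add: affine_degree_def)

lemma affine_degree_eq_length: "Infinity \<notin> set Ts \<Longrightarrow> affine_degree Ts = length Ts"
  by (induction Ts) auto

text \<open>
  The function \<open>f\<close> has the divisor \<open>Ts - Us\<close> on the affine curve, and the right order at infinity.
\<close>

definition lin_equiv :: "'a curve_fun \<Rightarrow> 'a point list \<Rightarrow> 'a point list \<Rightarrow> bool" where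
  "lin_equiv f Ts Us \<longleftrightarrow> set Ts \<subseteq> ec_points W \<and> set Us \<subseteq> ec_points W \<and>
     (\<exists>g\<in>coord_ring - {0}. \<exists>h\<in>coord_ring - {0}. f = g / h \<and>
        pole_order g + affine_degree Us = pole_order h + affine_degree Ts) \<and>
     (\<forall>z. z \<in> points_ideal Us \<longleftrightarrow> f * z \<in> points_ideal Ts)"

lemma lin_equivI:
  assumes "g \<in> coord_ring" "h \<in> coord_ring" "g \<noteq> 0" "h \<noteq> 0" "set Ts \<subseteq> ec_points W" "set Us \<subseteq> ec_points W"
    and "pole_order g + affine_degree Us = pole_order h + affine_degree Ts"
    and "\<And>z. z \<in> points_ideal Us \<Longrightarrow> g / h * z \<in> points_ideal Ts"
    and "\<And>z. z \<in> points_ideal Ts \<Longrightarrow> h / g * z \<in> points_ideal Us"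
  shows "lin_equiv (g / h) Ts Us"
proof -
  have "z \<in> points_ideal Us" if "g / h * z \<in> points_ideal Ts" for z
    using assms(9)[OF that] assms(3,4) by simp
  thus ?thesis using assms(1-8) unfolding lin_equiv_def by blast
qed

lemma lin_equivD:
  assumes "lin_equiv f Ts Us"
  shows "set Ts \<subseteq> ec_points W" "set Us \<subseteq> ec_points W" "f \<noteq> 0"
      "z \<in> points_ideal Us \<longleftrightarrow> f * z \<in> points_ideal Ts"
  using assms by (auto simp: lin_equiv_def)

lemma lin_equiv_1:
  assumes "set Ts \<subseteq> ec_points W" "set Us \<subseteq> ec_points W"
    and "points_ideal Ts = points_ideal Us" "affine_degree Ts = affine_degree Us"
  shows "lin_equiv 1 Ts Us"
  using lin_equivI[of 1 1 Ts Us] assms by simp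

lemma lin_equiv_trans:
  assumes f: "lin_equiv f Ts Us" and f': "lin_equiv f' Us Vs"
  shows "lin_equiv (f * f') Ts Vs"
proof -
  obtain g h g' h' where gh: "g \<in> coord_ring" "h \<in> coord_ring" "g \<noteq> 0" "h \<noteq> 0" "f = g / h"
      "pole_order g + affine_degree Us = pole_order h + affine_degree Ts"
    and gh': "g' \<in> coord_ring" "h' \<in> coord_ring" "g' \<noteq> 0" "h' \<noteq> 0" "f' = g' / h'"
      "pole_order g' + affine_degree Vs = pole_order h' + affine_degree Us"
    using assms unfolding lin_equiv_def by blast
  have "f * f' = (g * g') / (h * h')" using gh gh' by simp
  moreover have "g * g' \<in> coord_ring - {0}" "h * h' \<in> coord_ring - {0}" using gh gh' by auto
  moreover have "pole_order (g * g') + affine_degree Vs = pole_order (h * h') + affine_degree Ts"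
    using gh gh' by (simp add: pole_order_mult)
  moreover have "z \<in> points_ideal Vs \<longleftrightarrow> f * f' * z \<in> points_ideal Ts" for z
    using lin_equivD(4)[OF f'] lin_equivD(4)[OF f] by (metis mult.assoc)
  ultimately show ?thesis unfolding lin_equiv_def using lin_equivD(1)[OF f] lin_equivD(2)[OF f'] by blast
qed

lemma lin_equiv_Cons:
  assumes f: "lin_equiv f Ts Us" and T: "T \<in> ec_points W"
  shows "lin_equiv f (T # Ts) (T # Us)"
proof -
  note sub = lin_equivD(1,2)[OF f]
  have ideals: "is_ideal (points_ideal (T # Ts))" "is_ideal (points_ideal (T # Us))"
    using sub T by (intro is_ideal_points_ideal; simp)+
  obtain g h where gh: "g \<in> coord_ring" "h \<in> coord_ring" "g \<noteq> 0" "h \<noteq> 0" "f = g / h"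
    "pole_order g + affine_degree Us = pole_order h + affine_degree Ts"
    using f unfolding lin_equiv_def by blast
  have forwards: "g / h * (a * b) \<in> points_ideal (T # Ts)" if "a \<in> point_ideal T" "b \<in> points_ideal Us"
    for a b
  proof -
    have "g / h * b \<in> points_ideal Ts" using that(2) lin_equivD(4)[OF f] gh(5) by simp
    hence "a * (g / h * b) \<in> points_ideal (T # Ts)" using that(1)
      by (simp only: points_ideal.simps mult_in_ideal_mult)
    thus ?thesis by (simp add: mult_ac)
  qed
  have backwards: "h / g * (a * b) \<in> points_ideal (T # Us)" if "a \<in> point_ideal T" "b \<in> points_ideal Ts"
    for a b
  proof -
    have "f * (h / g * b) \<in> points_ideal Ts" using that(2) gh(3-5) by simp
    hence "h / g * b \<in> points_ideal Us" using lin_equivD(4)[OF f] by simp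
    hence "a * (h / g * b) \<in> points_ideal (T # Us)" using that(1)
      by (simp only: points_ideal.simps mult_in_ideal_mult)
    thus ?thesis by (simp add: mult_ac)
  qed
  show ?thesis unfolding gh(5)
    using gh sub T
      scaled_ideal_mult_in_ideal[OF _ ideals(1) forwards] scaled_ideal_mult_in_ideal[OF _ ideals(2) backwards]
    by (intro lin_equivI) auto
qed

lemma lin_equiv_factor:
  assumes f: "lin_equiv f Ts Us" and u: "u \<in> points_ideal Ts" "u \<noteq> 0"
  obtains w where "w \<in> points_ideal Us" "u = f * w" "w \<noteq> 0"
    "pole_order u + affine_degree Us = pole_order w + affine_degree Ts"
proof -
  obtain g h where gh: "g \<in> coord_ring" "h \<in> coord_ring" "g \<noteq> 0" "h \<noteq> 0" "f = g / h"
    "pole_order g + affine_degree Us = pole_order h + affine_degree Ts"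
    using f unfolding lin_equiv_def by blast
  define w where "w = u / f"
  have u_eq: "u = f * w" using lin_equivD(3)[OF f] by (simp add: w_def)
  hence w: "w \<in> points_ideal Us" "w \<noteq> 0" using u lin_equivD(4)[OF f] by auto
  have "u \<in> coord_ring" "w \<in> coord_ring"
    using u(1) w(1) lin_equivD(1,2)[OF f] by (auto intro: ideal_subset[OF is_ideal_points_ideal])
  moreover have "u * h = g * w" using u_eq gh by simp
  ultimately have "pole_order u + pole_order h = pole_order g + pole_order w"
    using pole_order_mult[of u h] pole_order_mult[of g w] u(2) w(2) gh by simp
  thus thesis using that[OF w(1) u_eq w(2)] gh(6) by simp
qed

lemma lin_equiv_NilD:
  assumes "lin_equiv f Ts []"
  shows "f \<in> points_ideal Ts" "pole_order f = affine_degree Ts"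
proof -
  show f: "f \<in> points_ideal Ts" using lin_equivD(4)[OF assms, of 1] by simp
  obtain w where "f = f * w" "pole_order f + affine_degree [] = pole_order w + affine_degree Ts"
    using lin_equiv_factor[OF assms f lin_equivD(3)[OF assms]] .
  thus "pole_order f = affine_degree Ts" using lin_equivD(3)[OF assms] by simp
qed

lemma lin_equiv_three_points:
  assumes f: "lin_equiv f [A, B] [D]" and g: "lin_equiv g [C, D] [S]" and h: "lin_equiv h [T, S] []"
  shows "lin_equiv (f * g * h) [T, C, A, B] []"
proof -
  have C: "C \<in> ec_points W" and T: "T \<in> ec_points W" using lin_equivD(1)[OF g] lin_equivD(1)[OF h]
    by simp_all
  have "lin_equiv (f * g) [C, A, B] [S]" by (rule lin_equiv_trans[OF lin_equiv_Cons[OF f C] g])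
  thus ?thesis by (rule lin_equiv_trans[OF lin_equiv_Cons[OF _ T] h])
qed

end

context ell_curve begin

lemma lin_equiv_collinear:
  assumes collinear: "collinear l n x1 x2 x3"
  shows "lin_equiv (line l n / (genX - cst x3))
      [line_point l n x1, line_point l n x2] [ec_neg W (line_point l n x3)]"
proof (rule lin_equivI)
  note points = collinear_on_curve[OF collinear]
  show "set [line_point l n x1, line_point l n x2] \<subseteq> ec_points W"
    "set [ec_neg W (line_point l n x3)] \<subseteq> ec_points W"
    using points ec_neg_in_ec_points[OF points(3)] by simp_all
  show "pole_order (line l n) + affine_degree [ec_neg W (line_point l n x3)] =
      pole_order (genX - cst x3) + affine_degree [line_point l n x1, line_point l n x2]"
    by (simp add: pole_order_line pole_order_genX_minus_cst)
  note ideals = points_ideal_singleton[OF ec_neg_in_ec_points[OF points(3)]] points_ideal_pair[OF points(2)]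
  show "line l n / (genX - cst x3) * z \<in> points_ideal [line_point l n x1, line_point l n x2]"
    if "z \<in> points_ideal [ec_neg W (line_point l n x3)]" for z
    using that unfolding ideals by (rule collinear_ideal_mult_superset[OF collinear])
  show "(genX - cst x3) / line l n * z \<in> points_ideal [ec_neg W (line_point l n x3)]"
    if "z \<in> points_ideal [line_point l n x1, line_point l n x2]" for z
    using that unfolding ideals by (rule collinear_ideal_mult_subset[OF collinear])
qed (use genX_minus_cst_neq_0 in auto)

lemma lin_equiv_neg_Affine:
  assumes T: "Affine x y \<in> ec_points W"
  shows "lin_equiv (genX - cst x) [Affine x y, ec_neg W (Affine x y)] []"
proof -
  note pair = points_ideal_pair[OF ec_neg_in_ec_points[OF T], of "Affine x y"]
  have ideal: "is_ideal (points_ideal [Affine x y, ec_neg W (Affine x y)])"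
    using T ec_neg_in_ec_points[OF T] by (intro is_ideal_points_ideal) simp
  have "lin_equiv ((genX - cst x) / 1) [Affine x y, ec_neg W (Affine x y)] []"
  proof (rule lin_equivI)
    show "(genX - cst x) / 1 * z \<in> points_ideal [Affine x y, ec_neg W (Affine x y)]"
      if "z \<in> points_ideal []" for z
      using that genX_in_ideal_mult_neg[OF T, folded pair] ideal_mult_right[OF ideal]
      by (simp only: points_ideal.simps div_by_1)
    show "1 / (genX - cst x) * z \<in> points_ideal []"
      if "z \<in> points_ideal [Affine x y, ec_neg W (Affine x y)]" for z
      using that point_ideal_neg_subset[OF T] unfolding pair by simp
  qed (use T ec_neg_in_ec_points[OF T] genX_minus_cst_neq_0 in \<open>auto simp: pole_order_genX_minus_cst\<close>)
  thus ?thesis by simp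
qed

lemma ex_lin_equiv_neg:
  assumes "T \<in> ec_points W"
  shows "\<exists>f. lin_equiv f [T, ec_neg W T] []"
proof (cases T)
  case Infinity
  hence "lin_equiv 1 [T, ec_neg W T] []" by (intro lin_equiv_1) (simp_all add: ideal_mult_coord_ring)
  thus ?thesis ..
qed (use assms lin_equiv_neg_Affine in blast)

text \<open>
  A tangent that is not vertical has a finite slope, so nonsingularity excludes \<open>S = - T\<close> for its
  point of contact.
\<close>

lemma ec_add_collinear:
  assumes collinear: "collinear l n x1 x2 x3"
  shows "ec_add W (line_point l n x1) (line_point l n x2) = ec_neg W (line_point l n x3)"
proof -
  let ?S = "line_point l n x1" and ?T = "line_point l n x2"
  have "\<not> (x1 = x2 \<and> (l * x1 + n) + (l * x2 + n) + a1 * x1 + a3 = 0) \<and> slope W ?S ?T = l"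
    (is "?not_opposite \<and> ?slope")
  proof (cases "x1 = x2")
    case False
    thus ?thesis by (simp add: slope_def flip: right_diff_distrib)
  next
    case True
    define y where "y = l * x1 + n"
    have "l * (2 * y + a1 * x1 + a3) = 3 * x1\<^sup>2 + 2 * a2 * x1 + a4 - a1 * y"
      unfolding y_def using collinear by (intro collinear_tangentD[where ?x3.0 = x3]) (simp only: True)
    moreover have "on_curve W x1 y" unfolding y_def using collinear_on_curve(1)[OF collinear] by simp
    note elliptic_curve_nonsingular[OF elliptic this]
    ultimately have nonzero: "2 * y + a1 * x1 + a3 \<noteq> 0"
      and l: "(3 * x1\<^sup>2 + 2 * a2 * x1 + a4 - a1 * y) / (2 * y + a1 * x1 + a3) = l"
      by (auto simp: divide_eq_eq)
    show ?thesis unfolding True[symmetric] y_def[symmetric] using nonzero[unfolded mult_2]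
      by (simp add: slope_def l)
  qed
  hence not_opposite: ?not_opposite and slope: ?slope by blast+
  have x3: "l\<^sup>2 + a1 * l - a2 - x1 - x2 = x3"
    using collinear[unfolded collinear_iff_Vieta, THEN conjunct1, symmetric] by simp
  show ?thesis unfolding ec_add_affine if_not_P[OF not_opposite] slope x3 Let_def
    by (simp add: algebra_simps)
qed

lemma ec_add_cases [consumes 2, case_names Infinity_left Infinity_right neg collinear]:
  assumes "S \<in> ec_points W" "T \<in> ec_points W"
  obtains "S = Infinity" | "T = Infinity" | "S = ec_neg W T"
  | n x1 x2 x3 where "S = line_point (slope W S T) n x1" "T = line_point (slope W S T) n x2"
      "collinear (slope W S T) n x1 x2 x3" "ec_add W S T = ec_neg W (line_point (slope W S T) n x3)"
  using slope_collinear[OF assms] ec_add_collinear ec_add_eq_Infinity_iff by metis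

lemma ec_add_closed:
  assumes "S \<in> ec_points W" "T \<in> ec_points W"
  shows "ec_add W S T \<in> ec_points W"
  using assms
proof (cases rule: ec_add_cases)
  case (collinear n x1 x2 x3)
  show ?thesis unfolding collinear(4) by (intro ec_neg_in_ec_points collinear_on_curve(3)[OF collinear(3)])
qed (use assms in auto)

lemma ec_add_commute:
  assumes "S \<in> ec_points W" "T \<in> ec_points W"
  shows "ec_add W S T = ec_add W T S"
  using assms
proof (cases rule: ec_add_cases)
  case (collinear n x1 x2 x3)
  thus ?thesis using ec_add_collinear collinear_swap by metis
qed auto

lemma ex_lin_equiv_ec_add:
  assumes "S \<in> ec_points W" "T \<in> ec_points W"
  shows "\<exists>f. lin_equiv f [S, T] [ec_add W S T]"
  using assms
proof (cases rule: ec_add_cases)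
  case Infinity_left
  hence "lin_equiv 1 [S, T] [ec_add W S T]"
    using assms points_ideal_Infinity[of "[T]"] by (intro lin_equiv_1) simp_all
  thus ?thesis ..
next
  case Infinity_right
  hence "lin_equiv 1 [S, T] [ec_add W S T]"
    using assms by (intro lin_equiv_1) (simp_all add: ideal_mult_coord_ring)
  thus ?thesis ..
next
  case neg
  then obtain f where "lin_equiv f [S, T] []" using ex_lin_equiv_neg[OF assms(1)] by auto
  moreover have "lin_equiv 1 [] [ec_add W S T]"
    using neg by (intro lin_equiv_1) (simp_all add: ideal_mult_coord_ring)
  ultimately show ?thesis using lin_equiv_trans by blast
next
  case (collinear n x1 x2 x3)
  thus ?thesis using lin_equiv_collinear by metis
qed

fun point_sum :: "'a point list \<Rightarrow> 'a point" where
  "point_sum [] = Infinity"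
| "point_sum (T # Ts) = ec_add W T (point_sum Ts)"

lemma point_sum_closed: "set Ts \<subseteq> ec_points W \<Longrightarrow> point_sum Ts \<in> ec_points W"
  by (induction Ts) (auto intro: ec_add_closed)

lemma ex_lin_equiv_point_sum: "set Ts \<subseteq> ec_points W \<Longrightarrow> \<exists>f. lin_equiv f Ts [point_sum Ts]"
proof (induction Ts)
  case Nil
  have "lin_equiv 1 [] [point_sum []]" by (intro lin_equiv_1) (simp_all add: ideal_mult_coord_ring)
  thus ?case ..
next
  case (Cons T Ts)
  then obtain f where "lin_equiv f (T # Ts) [T, point_sum Ts]" using lin_equiv_Cons[of _ Ts _ T] by auto
  moreover obtain g where "lin_equiv g [T, point_sum Ts] [ec_add W T (point_sum Ts)]"
    using ex_lin_equiv_ec_add Cons.prems point_sum_closed by fastforce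
  ultimately show ?case using lin_equiv_trans by fastforce
qed

text \<open>The second part is Abel's theorem.\<close>

lemma
  assumes "set Ts \<subseteq> ec_points W" "u \<in> points_ideal Ts" "u \<noteq> 0"
  shows affine_degree_le_pole_order: "affine_degree Ts \<le> pole_order u"
    and point_sum_eq_Infinity: "affine_degree Ts = pole_order u \<Longrightarrow> point_sum Ts = Infinity"
proof -
  note closed = point_sum_closed[OF assms(1)]
  obtain f where "lin_equiv f Ts [point_sum Ts]" using ex_lin_equiv_point_sum[OF assms(1)] ..
  from lin_equiv_factor[OF this assms(2,3)] obtain w
    where w: "w \<in> point_ideal (point_sum Ts)" "w \<noteq> 0"
      "pole_order u + affine_degree [point_sum Ts] = pole_order w + affine_degree Ts"
    unfolding points_ideal_singleton[OF closed] by blast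
  have "2 \<le> pole_order w" if "point_sum Ts = Affine x y" for x y
  proof (rule ccontr)
    assume "\<not> 2 \<le> pole_order w"
    moreover have "w \<in> coord_ring" using w(1) ideal_subset[OF is_ideal_point_ideal[OF closed]] by blast
    ultimately obtain c where "w = cst c" using pole_order_less_2D by fastforce
    thus False using w(1,2) that by (simp add: cst_in_point_ideal_iff)
  qed
  thus "affine_degree Ts \<le> pole_order u" "affine_degree Ts = pole_order u \<Longrightarrow> point_sum Ts = Infinity"
    using w(3) by (cases "point_sum Ts"; simp)+
qed

text \<open>
  With \<open>S = C + (A + B)\<close> the divisor \<open>(- S) + C + A + B\<close> is principal, so its points sum to \<open>O\<close> in
  every order.
\<close>

lemma ec_add_assoc:
  assumes points: "A \<in> ec_points W" "B \<in> ec_points W" "C \<in> ec_points W"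
  shows "ec_add W (ec_add W A B) C = ec_add W A (ec_add W B C)"
proof -
  define S where "S = ec_add W C (ec_add W A B)"
  have S: "S \<in> ec_points W" "ec_neg W S \<in> ec_points W"
    unfolding S_def using points ec_add_closed ec_neg_in_ec_points by auto
  obtain f where f: "lin_equiv f [A, B] [ec_add W A B]"
    using ex_lin_equiv_ec_add[OF points(1,2)] ..
  obtain g where g: "lin_equiv g [C, ec_add W A B] [S]"
    using ex_lin_equiv_ec_add[OF points(3) ec_add_closed[OF points(1,2)]] unfolding S_def ..
  obtain h where h: "lin_equiv h [ec_neg W S, S] []"
    using ex_lin_equiv_neg[OF S(2)] by auto
  note fgh = lin_equiv_three_points[OF f g h]
  have "points_ideal [ec_neg W S, C, A, B] = points_ideal [ec_neg W S, A, B, C]"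
    using points_ideal_move_to_front[of C "[A, B]" "[]"] points by simp
  hence "f * g * h \<in> points_ideal [ec_neg W S, A, B, C]" using lin_equiv_NilD(1)[OF fgh] by simp
  moreover have "affine_degree [ec_neg W S, A, B, C] = pole_order (f * g * h)"
    using lin_equiv_NilD(2)[OF fgh] by simp
  ultimately have "point_sum [ec_neg W S, A, B, C] = Infinity"
    using points S lin_equivD(3)[OF fgh] by (intro point_sum_eq_Infinity) auto
  hence "S = ec_add W A (ec_add W B C)"
    by (simp add: ec_add_eq_Infinity_iff) (metis ec_neg_ec_neg)
  thus ?thesis unfolding S_def using ec_add_commute[OF points(3) ec_add_closed[OF points(1,2)]] by simp
qed

lemma comm_group_ec_group: "comm_group (ec_group W)"
proof (rule comm_groupI)
  fix x assume "x \<in> carrier (ec_group W)"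
  thus "\<exists>y\<in>carrier (ec_group W). y \<otimes>\<^bsub>ec_group W\<^esub> x = \<one>\<^bsub>ec_group W\<^esub>"
    using ec_neg_in_ec_points by (intro bexI[of _ "ec_neg W x"]) (auto simp: ec_group_def)
qed (auto simp: ec_group_def ec_add_closed ec_add_assoc intro: ec_add_commute)

end


section \<open>Slopes and zeros\<close>

context weierstrass_curve begin

lemma line_product_quotient:
  assumes "g \<in> coord_ring" "g * (genX - cst x0) = line l n * line l' n'"
  obtains A where "g = reg A [:- l - l' - a1:]" "degree A = 2" "lead_coeff A = 1"
proof -
  from assms(1) obtain A B where g: "g = reg A B" by (rule coord_ringE)
  have "reg A B * reg [:-x0, 1:] 0 = reg [:-n, -l:] 1 * reg [:-n', -l':] 1"
    using assms(2) unfolding g genX_minus_cst line_eq_reg unfolding emb_eq_reg .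
  hence A_eq: "A * [:-x0, 1:] = [:-n, -l:] * [:-n', -l':] + cubic"
    and B_eq: "B * [:-x0, 1:] = [:-n, -l:] + [:-n', -l':] - ycoeff"
    unfolding reg_mult reg_eq_iff by (simp_all add: algebra_simps)
  have "degree (B * [:-x0, 1:]) \<le> 1" unfolding B_eq ycoeff_def by simp
  hence "degree B = 0" by (cases "B = 0") (simp_all add: degree_mult_eq del: mult_pCons_right)
  then obtain b where b: "B = [:b:]" by (rule degree_eq_zeroE)
  have "b = - l - l' - a1"
    using arg_cong[OF B_eq, of "\<lambda>p. coeff p 1"] unfolding b ycoeff_def by simp
  moreover have degree: "degree (A * [:-x0, 1:]) = 3" unfolding A_eq cubic_def by simp
  hence "A \<noteq> 0" by auto
  hence "degree A = 2" using degree by (simp add: degree_mult_eq del: mult_pCons_right)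
  moreover have "lead_coeff A = lead_coeff (A * [:-x0, 1:])" by (simp only: lead_coeff_mult) simp
  hence "lead_coeff A = 1" unfolding A_eq cubic_def by simp
  ultimately show thesis using that g b by blast
qed

end

context ell_curve begin

lemma lin_equiv_chord:
  assumes "S \<in> ec_points W" "T \<in> ec_points W" "S \<noteq> Infinity" "T \<noteq> Infinity" "ec_add W S T = Affine x y"
  obtains n where "lin_equiv (line (slope W S T) n / (genX - cst x)) [S, T] [Affine x y]"
  using assms(1,2)
proof (cases rule: ec_add_cases)
  case (collinear n x1 x2 x3)
  hence "x3 = x" using assms(5) by simp
  thus thesis using that lin_equiv_collinear[OF collinear(3)] collinear assms(5) by metis
qed (use assms in simp_all)

lemma chord_product_in_points_ideal:
  assumes points: "A \<in> ec_points W" "B \<in> ec_points W" "C \<in> ec_points W"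
    and affine: "A \<noteq> Infinity" "B \<noteq> Infinity" "C \<noteq> Infinity" "ec_add W A B \<noteq> Infinity"
    and S: "S = ec_add W C (ec_add W A B)" "S \<noteq> Infinity"
  obtains U where
    "reg U [:- slope W A B - slope W C (ec_add W A B) - a1:] \<in> points_ideal [ec_neg W S, C, A, B]"
    "degree U = 2" "lead_coeff U = 1"
proof -
  define D where "D = ec_add W A B"
  have D: "D \<in> ec_points W" "D \<noteq> Infinity" unfolding D_def using ec_add_closed points affine by blast+
  obtain x y where D_xy: "ec_add W A B = Affine x y" using affine(4) by (metis point.exhaust)
  obtain n where f: "lin_equiv (line (slope W A B) n / (genX - cst x)) [A, B] [D]" (is "lin_equiv ?f _ _")
    using lin_equiv_chord[OF points(1,2) affine(1,2) D_xy] unfolding D_def D_xy .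
  have "ec_add W C D \<noteq> Infinity" using S by (simp add: D_def)
  then obtain x' y' where S_xy: "ec_add W C D = Affine x' y'" by (metis point.exhaust)
  obtain n' where g: "lin_equiv (line (slope W C D) n' / (genX - cst x')) [C, D] [S]"
    (is "lin_equiv ?g _ _")
    using lin_equiv_chord[OF points(3) D(1) affine(3) D(2) S_xy] S(1) unfolding D_def[symmetric] S_xy
    by metis
  have "S = Affine x' y'" using S(1) S_xy by (simp add: D_def)
  hence h: "lin_equiv (genX - cst x') [ec_neg W S, S] []"
    using lin_equivD(2)[OF g] ec_neg_in_ec_points[of S] lin_equiv_neg_Affine[of x' "- y' - a1 * x' - a3"]
    by simp
  let ?F = "?f * ?g * (genX - cst x')"
  note F = lin_equiv_three_points[OF f g h]
  have "?F \<in> coord_ring"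
    using lin_equiv_NilD(1)[OF F] ideal_subset[OF is_ideal_points_ideal[OF lin_equivD(1)[OF F]]] by blast
  moreover have "?F * (genX - cst x) = line (slope W A B) n * line (slope W C D) n'"
    using genX_minus_cst_neq_0[of x] genX_minus_cst_neq_0[of x'] by simp
  ultimately obtain U where "?F = reg U [:- slope W A B - slope W C D - a1:]" "degree U = 2"
    "lead_coeff U = 1"
    by (rule line_product_quotient)
  thus thesis using that[of U] lin_equiv_NilD(1)[OF F] unfolding D_def by simp
qed

text \<open>
  The difference of the two functions would have at least four zeros, but a pole of order at most
  three.
\<close>

lemma monic_quadratic_function_unique:
  assumes Ts: "set Ts \<subseteq> ec_points W" "affine_degree Ts = 4"
    and U: "reg U [:u:] \<in> points_ideal Ts" "degree U = 2" "lead_coeff U = 1"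
    and V: "reg V [:v:] \<in> points_ideal Ts" "degree V = 2" "lead_coeff V = 1"
  shows "u = v"
proof (rule ccontr)
  assume "u \<noteq> v"
  have "degree (U - V) \<le> 1"
  proof (rule degree_le, intro allI impI)
    fix i :: nat assume "1 < i"
    hence "i = 2 \<or> i > 2" by auto
    thus "coeff (U - V) i = 0" using U V by (auto simp: coeff_eq_0)
  qed
  hence "pole_order (reg (U - V) [:u - v:]) = 3"
    using \<open>u \<noteq> v\<close> by (simp add: pole_order_reg degree_reg_norm)
  moreover have "reg (U - V) [:u - v:] \<in> points_ideal Ts"
    using ideal_diff[OF is_ideal_points_ideal[OF Ts(1)] U(1) V(1)] by (simp add: reg_diff)
  ultimately show False
    using affine_degree_le_pole_order[OF Ts(1)] Ts(2) \<open>u \<noteq> v\<close> by fastforce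
qed

text \<open>
  The coefficient of \<open>Y\<close> in the function with the divisor \<open>A + B + C + (- (A + B + C)) - 4 O\<close> and
  leading term \<open>X\<^sup>2\<close> is, up to sign and \<open>a1\<close>, the sum of the two slopes in either way of adding
  three points.
\<close>

lemma slope_cocycle:
  assumes points: "A \<in> ec_points W" "B \<in> ec_points W" "C \<in> ec_points W"
    and affine: "A \<noteq> Infinity" "B \<noteq> Infinity" "C \<noteq> Infinity" "ec_add W A B \<noteq> Infinity"
      "ec_add W B C \<noteq> Infinity" "ec_add W (ec_add W A B) C \<noteq> Infinity"
  shows "slope W A B + slope W (ec_add W A B) C = slope W A (ec_add W B C) + slope W B C"
proof -
  define S where "S = ec_add W A (ec_add W B C)"
  note AB = ec_add_closed[OF points(1,2)]
  have assoc: "ec_add W (ec_add W A B) C = S" unfolding S_def by (rule ec_add_assoc[OF points])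
  have S: "S = ec_add W C (ec_add W A B)" "S \<noteq> Infinity" "S \<in> ec_points W"
    using ec_add_commute[OF AB points(3)] affine(6) ec_add_closed[OF AB points(3)] unfolding assoc .
  obtain U where
    U: "reg U [:- slope W A B - slope W C (ec_add W A B) - a1:] \<in> points_ideal [ec_neg W S, C, A, B]"
      "degree U = 2" "lead_coeff U = 1"
    using chord_product_in_points_ideal[OF points affine(1-4) S(1,2)] .
  obtain V where
    V: "reg V [:- slope W B C - slope W A (ec_add W B C) - a1:] \<in> points_ideal [ec_neg W S, A, B, C]"
      "degree V = 2" "lead_coeff V = 1"
    using chord_product_in_points_ideal[OF points(2,3,1) affine(2,3,1,5) S_def S(2)] .
  have "points_ideal [ec_neg W S, C, A, B] = points_ideal [ec_neg W S, A, B, C]"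
    using points_ideal_move_to_front[of C "[A, B]" "[]"] points by simp
  note U_permuted = U(1)[unfolded this]
  have set: "set [ec_neg W S, A, B, C] \<subseteq> ec_points W" using points S(3) by (simp add: ec_neg_in_ec_points)
  have degree: "affine_degree [ec_neg W S, A, B, C] = 4" using affine(1-3) S(2) by simp
  have "- slope W A B - slope W C (ec_add W A B) - a1 = - slope W B C - slope W A (ec_add W B C) - a1"
    by (rule monic_quadratic_function_unique[OF set degree U_permuted U(2,3) V])
  moreover have "slope W C (ec_add W A B) = slope W (ec_add W A B) C"
    using S by (intro slope_commute points ec_add_closed affine) simp
  ultimately show ?thesis by (simp add: algebra_simps)
qed

lemma slope_ec_add_neg:
  assumes points: "S \<in> ec_points W" "T \<in> ec_points W"
    and affine: "S \<noteq> Infinity" "T \<noteq> Infinity" "ec_add W S T \<noteq> Infinity"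
    and distinct: "ec_add W S T \<noteq> T" "ec_add W S T \<noteq> ec_neg W T"
  shows "slope W (ec_add W S T) (ec_neg W T) = - slope W S T - a1"
  using points
proof (cases rule: ec_add_cases)
  case (collinear n x1 x2 x3)
  define l where "l = slope W S T"
  have T: "T = Affine x2 (l * x2 + n)" and sum: "ec_add W S T = Affine x3 (- (l * x3 + n) - a1 * x3 - a3)"
    using collinear unfolding l_def by simp_all
  have "on_curve W x3 (- (l * x3 + n) - a1 * x3 - a3)" "on_curve W x2 (l * x2 + n)"
    using ec_add_closed[OF points, unfolded sum] points(2)[unfolded T] by simp_all
  hence "x2 \<noteq> x3" using distinct[unfolded sum, unfolded T] by (auto dest: on_curve_same_x)
  have "(- (l * x2 + n) - a1 * x2 - a3) - (- (l * x3 + n) - a1 * x3 - a3) = (- l - a1) * (x2 - x3)"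
    by (simp add: algebra_simps)
  thus ?thesis
    unfolding l_def[symmetric] sum unfolding T using \<open>x2 \<noteq> x3\<close> by (simp add: slope_def)
qed (use affine in \<open>simp_all add: ec_add_eq_Infinity_iff\<close>)

lemma idempotent_separating_points:
  assumes T: "T \<in> ec_points W" "T \<noteq> Infinity" and T': "T' \<in> ec_points W" "T' \<noteq> Infinity" and "T \<noteq> T'"
  obtains e where "e \<in> point_ideal T'" "1 - e \<in> point_ideal T"
proof -
  obtain x y x' y' where xy: "T = Affine x y" "T' = Affine x' y'" using assms by (metis point.exhaust)
  have separated: thesis if "c \<noteq> 0" "h \<in> point_ideal T'" "h - cst c \<in> point_ideal T" for c h
  proof
    show "cst (1 / c) * h \<in> point_ideal T'"
      using is_ideal_point_ideal[OF T'(1)] that(2) by (intro ideal_mult_left) auto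
    have "cst (1 / c) * cst c = 1" using that(1) by (simp add: cst_1 flip: cst_mult)
    hence "1 - cst (1 / c) * h = - cst (1 / c) * (h - cst c)" by (simp add: algebra_simps)
    also have "\<dots> \<in> point_ideal T"
      using is_ideal_point_ideal[OF T(1)] that(3) by (intro ideal_mult_left) auto
    finally show "1 - cst (1 / c) * h \<in> point_ideal T" .
  qed
  consider (abscissa) "x - x' \<noteq> 0" | (ordinate) "y - y' \<noteq> 0" using \<open>T \<noteq> T'\<close> xy by auto
  thus thesis
  proof cases
    case abscissa
    have "genX - cst x' - cst (x - x') \<in> point_ideal T" by (simp add: xy cst_diff)
    thus ?thesis using separated[OF abscissa] genX_in_point_ideal xy(2) by blast
  next
    case ordinate
    have "genY - cst y' - cst (y - y') \<in> point_ideal T" by (simp add: xy cst_diff)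
    thus ?thesis using separated[OF ordinate] genY_in_point_ideal xy(2) by blast
  qed
qed

lemma idempotent_separating_point_from_list:
  assumes T: "T \<in> ec_points W" "T \<noteq> Infinity" and Ts: "set Ts \<subseteq> ec_points W" "Infinity \<notin> set Ts"
      "T \<notin> set Ts"
  shows "\<exists>h\<in>points_ideal Ts. 1 - h \<in> point_ideal T"
  using Ts
proof (induction Ts)
  case Nil
  have "0 \<in> point_ideal T" using ideal_0[OF is_ideal_point_ideal[OF T(1)]] .
  thus ?case by (intro bexI[of _ 1]) auto
next
  case (Cons T' Ts)
  note ideals = is_ideal_point_ideal[OF T(1)] is_ideal_point_ideal[of T']
  obtain h where h: "h \<in> points_ideal Ts" "1 - h \<in> point_ideal T" using Cons by auto
  obtain e where e: "e \<in> point_ideal T'" "1 - e \<in> point_ideal T"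
    using idempotent_separating_points[OF T, of T'] Cons.prems by auto
  have "e \<in> coord_ring" using e(1) ideal_subset[OF ideals(2)] Cons.prems by simp
  hence "(1 - e) + e * (1 - h) \<in> point_ideal T"
    using e(2) h(2) by (intro ideal_add[OF ideals(1)] ideal_mult_left[OF ideals(1)])
  hence "1 - e * h \<in> point_ideal T" by (simp add: algebra_simps)
  moreover have "e * h \<in> points_ideal (T' # Ts)" using e h by (simp add: mult_in_ideal_mult)
  ultimately show ?case by blast
qed

lemma points_ideal_distinctI:
  assumes "distinct Ts" "set Ts \<subseteq> ec_points W" "Infinity \<notin> set Ts"
    and "g \<in> coord_ring" "\<And>T. T \<in> set Ts \<Longrightarrow> g \<in> point_ideal T"
  shows "g \<in> points_ideal Ts"
  using assms
proof (induction Ts)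
  case (Cons T Ts)
  hence g: "g \<in> points_ideal Ts" "g \<in> point_ideal T" by auto
  obtain h where h: "h \<in> points_ideal Ts" "1 - h \<in> point_ideal T"
    using idempotent_separating_point_from_list[of T Ts] Cons.prems by auto
  have "(1 - h) * g + g * h \<in> ideal_mult (point_ideal T) (points_ideal Ts)"
    using g h by (intro ideal_mult_add mult_in_ideal_mult)
  thus ?case by (simp add: algebra_simps)
qed simp

lemma
  assumes Ts: "distinct Ts" "set Ts \<subseteq> ec_points W" "Infinity \<notin> set Ts" and "A \<noteq> 0 \<or> B \<noteq> 0"
    and zero: "\<And>x y. Affine x y \<in> set Ts \<Longrightarrow> poly A x + poly B x * y = 0"
  shows length_zeros_le: "length Ts \<le> degree (reg_norm A B)"
    and point_sum_zeros: "length Ts = degree (reg_norm A B) \<Longrightarrow> point_sum Ts = Infinity"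
proof -
  have "reg A B \<in> point_ideal T" if T: "T \<in> set Ts" for T
  proof (cases T)
    case (Affine x y)
    thus ?thesis using zero[of x y] T by simp
  qed simp
  hence "reg A B \<in> points_ideal Ts" by (intro points_ideal_distinctI Ts) auto
  moreover have "reg A B \<noteq> 0" using assms(4) by simp
  ultimately show "length Ts \<le> degree (reg_norm A B)"
    "length Ts = degree (reg_norm A B) \<Longrightarrow> point_sum Ts = Infinity"
    using affine_degree_le_pole_order[OF Ts(2), of "reg A B"] point_sum_eq_Infinity[OF Ts(2), of "reg A B"]
      affine_degree_eq_length[OF Ts(3)]
    by (simp_all add: pole_order_reg)
qed

end


section \<open>Eigenfunctions of the translation by a torsion point\<close>

lemma (in group) nat_pow_eq_iff_cong:
  assumes "x \<in> carrier G"
  shows "x [^] (i::nat) = x [^] (j::nat) \<longleftrightarrow> [i = j] (mod ord x)"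
proof -
  have "x [^] i = x [^] j \<longleftrightarrow> int (ord x) dvd int j - int i"
    using int_pow_eq[OF assms, of "int i" "int j"] unfolding int_pow_int .
  also have "\<dots> \<longleftrightarrow> [int j = int i] (mod int (ord x))" by (rule cong_iff_dvd_diff[symmetric])
  also have "\<dots> \<longleftrightarrow> [i = j] (mod ord x)" unfolding cong_int_iff by (rule cong_sym_eq)
  finally show ?thesis .
qed

lemma (in group) subgroup_mult_right_iff:
  assumes H: "subgroup H G" and x: "x \<in> carrier G" and h: "h \<in> H"
  shows "x \<otimes> h \<in> H \<longleftrightarrow> x \<in> H"
proof
  assume "x \<otimes> h \<in> H"
  hence "x \<otimes> h \<otimes> inv h \<in> H" by (rule subgroup.m_closed[OF H _ subgroup.m_inv_closed[OF H h]])
  also have "x \<otimes> h \<otimes> inv h = x" using x subgroup.mem_carrier[OF H h] by (simp add: m_assoc)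
  finally show "x \<in> H" .
qed (rule subgroup.m_closed[OF H _ h])

lemma sum_nontrivial_powers_root_of_unity:
  fixes w :: "'b::field"
  assumes "w ^ n = 1" "w \<noteq> 1" "n > 0"
  shows "(\<Sum>i=1..<n. w ^ i) = -1"
proof -
  have "(1 - w) * (\<Sum>i<n. w ^ i) = 0" using one_diff_power_eq[of w n] assms by simp
  hence "(\<Sum>i<n. w ^ i) = 0" using assms by simp
  moreover have "(\<Sum>i<n. w ^ i) = 1 + (\<Sum>i=1..<n. w ^ i)"
    using assms(3) by (simp add: lessThan_atLeast0 sum.atLeast_Suc_lessThan)
  ultimately show ?thesis by (simp add: add_eq_0_iff)
qed

lemma degree_monic_linear_product:
  fixes c :: "'i \<Rightarrow> 'b::field"
  shows "degree (\<Prod>j\<in>S. [:- c j, 1:]) = card S"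
  by (subst degree_prod_eq_sum_degree) auto

lemma lead_coeff_monic_linear_product:
  fixes c :: "'i \<Rightarrow> 'b::field"
  shows "coeff (\<Prod>j\<in>S. [:- c j, 1:]) (card S) = 1"
  using lead_coeff_prod[of "\<lambda>j. [:- c j, 1:]" S] by (simp add: degree_monic_linear_product)

lemma ec_group_simps [simp]:
  "carrier (ec_group W) = ec_points W" "monoid.mult (ec_group W) = ec_add W" "\<one>\<^bsub>ec_group W\<^esub> = Infinity"
  by (simp_all add: ec_group_def)

sublocale ell_curve \<subseteq> G: comm_group "ec_group W"
  rewrites "carrier (ec_group W) = ec_points W" and "monoid.mult (ec_group W) = ec_add W"
    and "\<one>\<^bsub>ec_group W\<^esub> = Infinity"
  using comm_group_ec_group by simp_all

abbreviation (in weierstrass_curve) mul :: "'a point \<Rightarrow> nat \<Rightarrow> 'a point" where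
  "mul T i \<equiv> T [^]\<^bsub>ec_group W\<^esub> i"

locale ec_odd_order_point = ell_curve W for W :: "'a::field weierstrass" +
  fixes n :: nat and P :: "'a point"
  assumes P: "P \<in> ec_points W" and ord_P: "group.ord (ec_group W) P = n" and odd: "odd n"
    and nontrivial: "n \<noteq> 1"
begin

lemma n_ge_3: "n \<ge> 3"
  using odd nontrivial by presburger

lemma mul_P_closed [simp, intro]: "mul P i \<in> ec_points W"
  using P by (rule G.nat_pow_closed)

lemma mul_P_add: "ec_add W (mul P i) (mul P j) = mul P (i + j)"
  using P by (rule G.nat_pow_mult)

lemma mul_P_eq_Infinity_iff: "mul P i = Infinity \<longleftrightarrow> n dvd i"
  using G.pow_eq_id[OF P] ord_P by simp

lemma P_neq_Infinity: "P \<noteq> Infinity"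
  using mul_P_eq_Infinity_iff[of 1] P nontrivial by auto

lemma mul_P_eq_iff: "mul P i = mul P j \<longleftrightarrow> [i = j] (mod n)"
  using G.nat_pow_eq_iff_cong[OF P] ord_P by simp

lemma mul_P_mod: "mul P (i mod n) = mul P i"
  by (simp add: mul_P_eq_iff)

lemma mul_P_inj: "mul P i = mul P j \<Longrightarrow> i < n \<Longrightarrow> j < n \<Longrightarrow> i = j"
  by (simp add: mul_P_eq_iff cong_def)

lemma ec_neg_mul_P: "i \<le> n \<Longrightarrow> ec_neg W (mul P i) = mul P (n - i)"
  using ec_add_eq_Infinity_iff[of "mul P (n - i)" "mul P i"] by (simp add: mul_P_add mul_P_eq_Infinity_iff)

definition multiples :: "'a point set" where "multiples = range (mul P)"

lemma mul_P_in_multiples [simp, intro]: "mul P i \<in> multiples"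
  by (simp add: multiples_def)

lemma Infinity_in_multiples [simp, intro]: "Infinity \<in> multiples"
  using mul_P_in_multiples[of 0] by simp

lemma P_in_multiples [simp, intro]: "P \<in> multiples"
  using mul_P_in_multiples[of 1] P by simp

lemma subgroup_multiples: "subgroup multiples (ec_group W)"
proof -
  have "multiples = generate (ec_group W) {P}"
    using G.generate_pow_nat[OF P] ord_P n_ge_3 by (auto simp: multiples_def)
  thus ?thesis using G.generate_is_subgroup P by simp
qed

lemma ec_add_multiple_iff: "T \<in> ec_points W \<Longrightarrow> S \<in> multiples \<Longrightarrow> ec_add W T S \<in> multiples \<longleftrightarrow> T \<in> multiples"
  using G.subgroup_mult_right_iff[OF subgroup_multiples] by simp

definition px :: "nat \<Rightarrow> 'a" where "px i = (case mul P i of Affine x y \<Rightarrow> x | Infinity \<Rightarrow> 0)"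
definition py :: "nat \<Rightarrow> 'a" where "py i = (case mul P i of Affine x y \<Rightarrow> y | Infinity \<Rightarrow> 0)"

lemma mul_P_eq_Affine:
  assumes "i \<in> {1..<n}"
  shows "mul P i = Affine (px i) (py i)"
proof -
  have "mul P i \<noteq> Infinity" using assms by (auto simp: mul_P_eq_Infinity_iff dest: dvd_imp_le)
  thus ?thesis by (cases "mul P i") (auto simp: px_def py_def)
qed

lemma on_curve_px_py: "i \<in> {1..<n} \<Longrightarrow> on_curve W (px i) (py i)"
  using mul_P_closed[of i] mul_P_eq_Affine by simp

lemma Affine_px_cases:
  assumes "on_curve W (px i) y" "i \<in> {1..<n}"
  shows "Affine (px i) y = mul P i \<or> Affine (px i) y = mul P (n - i)"
  using on_curve_same_x[OF on_curve_px_py[OF assms(2)] assms(1)] assms(2) mul_P_eq_Affine[OF assms(2)]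
    ec_neg_mul_P[of i] by auto

lemma px_eq_iff:
  assumes "i \<in> {1..<n}" "j \<in> {1..<n}"
  shows "px i = px j \<longleftrightarrow> i = j \<or> i = n - j"
proof
  assume "px i = px j"
  hence "mul P i = mul P j \<or> mul P i = mul P (n - j)"
    using Affine_px_cases[of j "py i"] on_curve_px_py[OF assms(1)] mul_P_eq_Affine[OF assms(1)] assms
    by simp
  thus "i = j \<or> i = n - j" using mul_P_inj[of i j] mul_P_inj[of i "n - j"] assms by auto
next
  have "px (n - j) = px j"
    using ec_neg_mul_P[of j] mul_P_eq_Affine[OF assms(2)] mul_P_eq_Affine[of "n - j"] assms by auto
  thus "i = j \<or> i = n - j \<Longrightarrow> px i = px j" by auto
qed

lemma x_neq_px:
  assumes "on_curve W x y" "Affine x y \<notin> multiples" "i \<in> {1..<n}"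
  shows "x \<noteq> px i"
  using Affine_px_cases[of i y] assms mul_P_in_multiples by metis

lemma slope_mul_P:
  assumes "on_curve W x y" "Affine x y \<notin> multiples" "i \<in> {1..<n}"
  shows "slope W (Affine x y) (mul P i) = (y - py i) / (x - px i)"
proof -
  have "(py i - y) / (px i - x) = (y - py i) / (x - px i)" by (metis minus_diff_eq minus_divide_divide)
  thus ?thesis using x_neq_px[OF assms] by (simp add: slope_def mul_P_eq_Affine[OF assms(3)])
qed

definition slope_const :: "nat \<Rightarrow> 'a" where
  "slope_const i = (if i = n - 1 then - a1 else slope W P (mul P i))"

lemma slope_shift_last:
  assumes T: "T \<in> ec_points W" "T \<notin> multiples"
  shows "slope W (ec_add W T P) (mul P (n - 1)) = - slope W T P - a1"
proof -
  have neg: "mul P (n - 1) = ec_neg W P" using ec_neg_mul_P[of 1] P n_ge_3 by simp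
  have "ec_add W T P \<notin> multiples" using T by (simp add: ec_add_multiple_iff)
  hence "ec_add W T P \<noteq> Infinity" "ec_add W T P \<noteq> P" "ec_add W T P \<noteq> ec_neg W P"
    using Infinity_in_multiples P_in_multiples mul_P_in_multiples[of "n - 1"] unfolding neg by metis+
  thus ?thesis unfolding neg using T by (intro slope_ec_add_neg P P_neq_Infinity) auto
qed

lemma slope_shift_generic:
  assumes T: "T \<in> ec_points W" "T \<notin> multiples" and i: "i \<in> {1..<n - 1}"
  shows "slope W (ec_add W T P) (mul P i) = slope W T (mul P (i + 1)) - slope W T P + slope W P (mul P i)"
proof -
  have sum: "ec_add W P (mul P i) = mul P (i + 1)" using mul_P_add[of 1 i] P by simp
  have "slope W T P + slope W (ec_add W T P) (mul P i)
      = slope W T (ec_add W P (mul P i)) + slope W P (mul P i)"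
  proof (rule slope_cocycle[OF T(1) P mul_P_closed])
    have "\<not> n dvd i" "\<not> n dvd i + 1" using i by (auto dest: dvd_imp_le)
    thus "mul P i \<noteq> Infinity" "ec_add W P (mul P i) \<noteq> Infinity"
      unfolding sum mul_P_eq_Infinity_iff .
    have "ec_add W T P \<notin> multiples" using T by (simp add: ec_add_multiple_iff)
    moreover from this have "ec_add W (ec_add W T P) (mul P i) \<notin> multiples"
      using T P ec_add_closed by (simp add: ec_add_multiple_iff)
    ultimately show "T \<noteq> Infinity" "ec_add W T P \<noteq> Infinity" "ec_add W (ec_add W T P) (mul P i) \<noteq> Infinity"
      using T(2) Infinity_in_multiples by metis+
  qed (rule P_neq_Infinity)
  thus ?thesis unfolding sum by (simp add: algebra_simps)
qed

lemma slope_shift: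
  assumes T: "T \<in> ec_points W" "T \<notin> multiples" and i: "i \<in> {1..<n}"
  shows "slope W (ec_add W T P) (mul P i) =
    (if i + 1 = n then 0 else slope W T (mul P (i + 1))) - slope W T P + slope_const i"
proof (cases "i = n - 1")
  case True
  thus ?thesis using slope_shift_last[OF T] i by (simp add: slope_const_def)
next
  case False
  thus ?thesis using slope_shift_generic[OF T, of i] i by (auto simp: slope_const_def)
qed

definition eigen_const :: "'a \<Rightarrow> 'a" where
  "eigen_const w = w * (\<Sum>i=1..<n. w ^ i * slope_const i)"

text \<open>
  As a function of \<open>T\<close>, \<open>slope W T (i P)\<close> plays the role of \<open>zeta(T + i P) - zeta(T)\<close> for the
  Weierstrass zeta function, up to a constant. Hence this sum is a Lagrange resolvent: translation
  by \<open>P\<close> divides it by \<open>w\<close>.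
\<close>

definition eigenfun :: "'a \<Rightarrow> 'a point \<Rightarrow> 'a" where
  "eigenfun w T = (1 - w) * (\<Sum>i=1..<n. w ^ i * slope W T (mul P i)) + eigen_const w"

definition nontrivial_root :: "'a \<Rightarrow> bool" where
  "nontrivial_root w \<longleftrightarrow> w ^ n = 1 \<and> w \<noteq> 1"

lemma sum_powers_nontrivial_root: "nontrivial_root w \<Longrightarrow> (\<Sum>i=1..<n. w ^ i) = -1"
  using sum_nontrivial_powers_root_of_unity[of w n] n_ge_3 by (simp add: nontrivial_root_def)

lemma nontrivial_root_neq_0: "nontrivial_root w \<Longrightarrow> w \<noteq> 0"
  using n_ge_3 by (auto simp: nontrivial_root_def power_0_left)

lemma eigenfun_shift:
  assumes w: "nontrivial_root w" and T: "T \<in> ec_points W" "T \<notin> multiples"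
  shows "w * eigenfun w (ec_add W T P) = eigenfun w T"
proof -
  define F where "F j = w ^ j * (if j = n then 0 else slope W T (mul P j))" for j
  define c where "c = (\<Sum>i=1..<n. w ^ i * slope_const i)"
  define s where "s = (\<Sum>i=1..<n. w ^ i * slope W T (mul P i))"
  define s' where "s' = (\<Sum>i=1..<n. w ^ i * slope W (ec_add W T P) (mul P i))"
  have "w * s' = (\<Sum>i=1..<n. F (Suc i) - w * slope W T P * w ^ i + w * (w ^ i * slope_const i))"
    unfolding s'_def sum_distrib_left F_def
    by (intro sum.cong refl, subst slope_shift[OF T]) (auto simp: algebra_simps)
  also have "\<dots> = (\<Sum>i=1..<n. F (Suc i)) - w * slope W T P * (\<Sum>i=1..<n. w ^ i) + w * c"
    unfolding sum.distrib sum_subtractf sum_distrib_left c_def ..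
  also have "(\<Sum>i=1..<n. F (Suc i)) = (\<Sum>i=Suc 1..<Suc n. F i)"
    by (simp only: sum.shift_bounds_Suc_ivl)
  also have "\<dots> = (\<Sum>i=1..<Suc n. F i) - F 1"
    using sum.atLeast_Suc_lessThan[of 1 "Suc n" F] n_ge_3 by simp
  also have "(\<Sum>i=1..<Suc n. F i) = s"
    unfolding s_def using n_ge_3 by (simp add: F_def)
  also have "F 1 = w * slope W T P" using n_ge_3 P by (simp add: F_def)
  finally have "w * s' = s + w * c" using sum_powers_nontrivial_root[OF w] by simp
  have "w * eigenfun w (ec_add W T P) = (1 - w) * (w * s') + w * w * c"
    unfolding eigenfun_def eigen_const_def s'_def[symmetric] c_def[symmetric] by (simp add: algebra_simps)
  also have "\<dots> = (1 - w) * s + w * c" unfolding \<open>w * s' = s + w * c\<close> by (simp add: algebra_simps)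
  finally show ?thesis unfolding eigenfun_def eigen_const_def s_def[symmetric] c_def[symmetric] .
qed

lemma eigenfun_shift_multiple:
  assumes w: "nontrivial_root w" and T: "T \<in> ec_points W" "T \<notin> multiples"
  shows "w ^ k * eigenfun w (ec_add W T (mul P k)) = eigenfun w T"
proof (induction k)
  case (Suc k)
  let ?T = "ec_add W T (mul P k)"
  have "ec_add W T (mul P (Suc k)) = ec_add W ?T P"
    using ec_add_assoc[OF T(1) mul_P_closed P] by simp
  moreover have "w * eigenfun w (ec_add W ?T P) = eigenfun w ?T"
    using T by (intro eigenfun_shift w ec_add_closed) (simp_all add: ec_add_multiple_iff)
  ultimately have "w ^ Suc k * eigenfun w (ec_add W T (mul P (Suc k))) = w ^ k * eigenfun w ?T"
    by (metis mult.assoc power_Suc2)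
  thus ?case using Suc by simp
qed simp

lemma eigenfun_add_multiple_eq_0_iff:
  assumes w: "nontrivial_root w" and T: "T \<in> ec_points W" "T \<notin> multiples"
  shows "eigenfun w (ec_add W T (mul P k)) = 0 \<longleftrightarrow> eigenfun w T = 0"
  using eigenfun_shift_multiple[OF assms, of k] nontrivial_root_neq_0[OF w]
  by (metis mult_eq_0_iff power_not_zero)


subsection \<open>Numerators of the eigenfunctions\<close>

text \<open>
  Multiplying by \<open>denom\<close> clears the simple poles of \<open>eigenfun w\<close> at the multiples of \<open>P\<close>; half of
  the multiples suffice because \<open>i P\<close> and \<open>(n - i) P\<close> have the same abscissa.
\<close>

definition half :: nat where "half = (n - 1) div 2"

lemma n_eq_half: "n = 2 * half + 1" and half_ge_1: "half \<ge> 1"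
  using odd n_ge_3 by (auto simp: half_def elim!: oddE)

definition rep :: "nat \<Rightarrow> nat" where "rep i = (if i \<le> half then i else n - i)"

lemma rep_range: "i \<in> {1..<n} \<Longrightarrow> rep i \<in> {1..half}"
  using n_eq_half by (auto simp: rep_def)

lemma rep_eq_iff: "i \<in> {1..<n} \<Longrightarrow> j \<in> {1..<n} \<Longrightarrow> rep i = rep j \<longleftrightarrow> i = j \<or> i = n - j"
  using n_eq_half by (auto simp: rep_def)

lemma px_rep: "i \<in> {1..<n} \<Longrightarrow> px (rep i) = px i"
  using rep_range[of i] n_eq_half px_eq_iff[of "rep i" i] by (auto simp: rep_def)

lemma px_eq_px_iff_rep: "i \<in> {1..half} \<Longrightarrow> k \<in> {1..<n} \<Longrightarrow> px k = px i \<longleftrightarrow> i = rep k"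
  using px_eq_iff[of k i] n_eq_half by (auto simp: rep_def)

definition denom :: "'a poly" where "denom = (\<Prod>j\<in>{1..half}. [:- px j, 1:])"

definition denom_without :: "nat \<Rightarrow> 'a poly" where
  "denom_without i = (\<Prod>j\<in>{1..half} - {rep i}. [:- px j, 1:])"

lemma degree_denom: "degree denom = half"
  by (simp add: denom_def degree_monic_linear_product)

lemma degree_denom_without: "i \<in> {1..<n} \<Longrightarrow> degree (denom_without i) = half - 1"
  using rep_range[of i] by (simp add: denom_without_def degree_monic_linear_product)

lemma lead_coeff_denom_without: "i \<in> {1..<n} \<Longrightarrow> coeff (denom_without i) (half - 1) = 1"
  using lead_coeff_monic_linear_product[where S = "{1..half} - {rep i}" and c = px]
    degree_denom_without[of i]
  unfolding denom_without_def degree_monic_linear_product by simp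

lemma poly_denom_without:
  assumes "i \<in> {1..<n}"
  shows "(x - px i) * poly (denom_without i) x = poly denom x"
proof -
  have "denom = [:- px (rep i), 1:] * denom_without i"
    unfolding denom_def denom_without_def using rep_range[OF assms]
    by (subst prod.remove[of _ "rep i"]) auto
  thus ?thesis unfolding px_rep[OF assms] by (simp only: poly_mult) simp
qed

lemma poly_denom_without_eq_0_iff:
  assumes "i \<in> {1..<n}" "k \<in> {1..<n}"
  shows "poly (denom_without i) (px k) = 0 \<longleftrightarrow> rep i \<noteq> rep k"
proof -
  have "poly (denom_without i) (px k) = 0 \<longleftrightarrow> (\<exists>j\<in>{1..half} - {rep i}. px k = px j)"
    unfolding denom_without_def by (auto simp: poly_prod)
  also have "\<dots> \<longleftrightarrow> (\<exists>j\<in>{1..half} - {rep i}. j = rep k)"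
    using px_eq_px_iff_rep[OF _ assms(2)] by (intro bex_cong refl) (metis DiffD1)
  also have "\<dots> \<longleftrightarrow> rep i \<noteq> rep k" using rep_range[OF assms(2)] by auto
  finally show ?thesis .
qed

definition eigen_A :: "'a \<Rightarrow> 'a poly" where
  "eigen_A w = smult (eigen_const w) denom
    - smult (1 - w) (\<Sum>i=1..<n. smult (w ^ i * py i) (denom_without i))"

definition eigen_B :: "'a \<Rightarrow> 'a poly" where
  "eigen_B w = smult (1 - w) (\<Sum>i=1..<n. smult (w ^ i) (denom_without i))"

lemma poly_eigen_numerator:
  "poly (eigen_A w) x + poly (eigen_B w) x * y =
    eigen_const w * poly denom x + (1 - w) * (\<Sum>i=1..<n. w ^ i * ((y - py i) * poly (denom_without i) x))"
proof -
  have sum_eq: "(\<Sum>i=1..<n. w ^ i * ((y - py i) * poly (denom_without i) x)) =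
     y * (\<Sum>i=1..<n. w ^ i * poly (denom_without i) x) - (\<Sum>i=1..<n. w ^ i * py i * poly (denom_without i) x)"
    unfolding sum_distrib_left sum_subtractf[symmetric] by (intro sum.cong refl) (simp add: algebra_simps)
  show ?thesis unfolding eigen_A_def eigen_B_def sum_eq by (simp add: poly_sum algebra_simps)
qed

lemma poly_denom_neq_0:
  assumes "on_curve W x y" "Affine x y \<notin> multiples"
  shows "poly denom x \<noteq> 0"
proof -
  have "x \<noteq> px j" if "j \<in> {1..half}" for j
    using x_neq_px[OF assms, of j] that n_eq_half by auto
  thus ?thesis unfolding denom_def by (auto simp: poly_prod)
qed

lemma eigen_numerator_eq:
  assumes "on_curve W x y" "Affine x y \<notin> multiples"
  shows "poly (eigen_A w) x + poly (eigen_B w) x * y = poly denom x * eigenfun w (Affine x y)"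
proof -
  have "(y - py i) * poly (denom_without i) x = poly denom x * slope W (Affine x y) (mul P i)"
    if i: "i \<in> {1..<n}" for i
    unfolding slope_mul_P[OF assms i] poly_denom_without[OF i, symmetric] using x_neq_px[OF assms i] by simp
  hence "(\<Sum>i=1..<n. w ^ i * ((y - py i) * poly (denom_without i) x)) =
      poly denom x * (\<Sum>i=1..<n. w ^ i * slope W (Affine x y) (mul P i))"
    unfolding sum_distrib_left by (intro sum.cong refl) (simp add: mult_ac)
  thus ?thesis unfolding poly_eigen_numerator eigenfun_def by (simp add: algebra_simps)
qed

lemma degree_eigen_A: "degree (eigen_A w) \<le> half"
  unfolding eigen_A_def
  by (intro degree_diff_le degree_sum_le order_trans[OF degree_smult_le])
    (auto simp: degree_denom degree_denom_without)

lemma degree_eigen_B: "degree (eigen_B w) \<le> half - 1"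
  unfolding eigen_B_def
  by (intro degree_sum_le order_trans[OF degree_smult_le]) (auto simp: degree_denom_without)

lemma coeff_eigen_B:
  assumes "nontrivial_root w"
  shows "coeff (eigen_B w) (half - 1) = w - 1"
proof -
  have "coeff (eigen_B w) (half - 1) = (1 - w) * (\<Sum>i=1..<n. w ^ i)"
    unfolding eigen_B_def coeff_smult coeff_sum by (intro arg_cong2[of _ _ _ _ "(*)"] sum.cong refl)
      (use lead_coeff_denom_without in simp)
  thus ?thesis unfolding sum_powers_nontrivial_root[OF assms] by simp
qed

lemma degree_reg_norm_eigen:
  assumes w: "nontrivial_root w"
  shows "degree (reg_norm (eigen_A w) (eigen_B w)) = n"
proof -
  have lead: "coeff (eigen_B w) (half - 1) \<noteq> 0" using coeff_eigen_B[OF w] w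
    by (simp add: nontrivial_root_def)
  hence "degree (eigen_B w) = half - 1" using degree_eigen_B[of w] le_degree by (metis le_antisym)
  moreover have "eigen_B w \<noteq> 0" using lead by auto
  ultimately show ?thesis using degree_eigen_A[of w] half_ge_1 n_eq_half by (simp add: degree_reg_norm)
qed

lemma sum_denom_without_at_multiple:
  assumes k: "k \<in> {1..<n}"
  shows "(\<Sum>i=1..<n. w ^ i * ((py k - py i) * poly (denom_without i) (px k))) =
    w ^ (n - k) * ((py k - py (n - k)) * poly (denom_without (n - k)) (px k))" (is "sum ?F _ = _")
proof -
  have "?F i = 0" if i: "i \<in> {1..<n} - {n - k}" for i
  proof (cases "i = k")
    case False
    hence "rep i \<noteq> rep k" using rep_eq_iff[of i k] i k by auto
    thus ?thesis using poly_denom_without_eq_0_iff[of i k] i k by simp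
  qed simp
  hence "sum ?F ({1..<n} - {n - k}) = 0" by (intro sum.neutral) blast
  moreover have "sum ?F {1..<n} = ?F (n - k) + sum ?F ({1..<n} - {n - k})"
    using k by (intro sum.remove) auto
  ultimately show ?thesis by simp
qed

lemma eigen_numerator_neq_0_at_multiple:
  assumes w: "nontrivial_root w" and k: "k \<in> {1..<n}"
  shows "poly (eigen_A w) (px k) + poly (eigen_B w) (px k) * py k \<noteq> 0"
proof -
  have k': "n - k \<in> {1..<n}" using k by auto
  have "poly denom (px k) = 0" using poly_denom_without[OF k, of "px k"] by simp
  hence value_eq: "poly (eigen_A w) (px k) + poly (eigen_B w) (px k) * py k =
     (1 - w) * (w ^ (n - k) * ((py k - py (n - k)) * poly (denom_without (n - k)) (px k)))"
    unfolding poly_eigen_numerator sum_denom_without_at_multiple[OF k] by simp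
  have "rep (n - k) = rep k" using rep_eq_iff[OF k' k] by simp
  hence "poly (denom_without (n - k)) (px k) \<noteq> 0" using poly_denom_without_eq_0_iff[OF k' k] by simp
  moreover have "py k \<noteq> py (n - k)"
  proof
    assume "py k = py (n - k)"
    moreover have "px k = px (n - k)" using px_eq_iff[OF k k'] k by simp
    ultimately have "mul P k = mul P (n - k)" using mul_P_eq_Affine[OF k] mul_P_eq_Affine[OF k'] by simp
    hence "k = n - k" using mul_P_inj[of k "n - k"] k k' by auto
    thus False using odd k by (metis add_diff_inverse_nat atLeastLessThan_iff even_add less_not_sym)
  qed
  ultimately show ?thesis unfolding value_eq using w nontrivial_root_neq_0[OF w]
    by (simp add: nontrivial_root_def)
qed


subsection \<open>Zeros of the eigenfunctions\<close>

lemma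
  assumes w: "nontrivial_root w"
    and Ts: "distinct Ts" "set Ts \<subseteq> ec_points W - multiples" "\<And>T. T \<in> set Ts \<Longrightarrow> eigenfun w T = 0"
  shows length_eigenfun_zeros_le: "length Ts \<le> n"
    and point_sum_eigenfun_zeros: "length Ts = n \<Longrightarrow> point_sum Ts = Infinity"
proof -
  have "poly (eigen_A w) x + poly (eigen_B w) x * y = 0" if "Affine x y \<in> set Ts" for x y
    using eigen_numerator_eq[of x y w] that Ts(2) Ts(3)[OF that] by auto
  moreover have "Infinity \<notin> set Ts" "set Ts \<subseteq> ec_points W" using Ts(2) by auto
  moreover have "eigen_A w \<noteq> 0 \<or> eigen_B w \<noteq> 0"
    using degree_reg_norm_eigen[OF w] n_ge_3 by (auto simp: degree_reg_norm)
  ultimately show "length Ts \<le> n" "length Ts = n \<Longrightarrow> point_sum Ts = Infinity"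
    using length_zeros_le[of Ts "eigen_A w" "eigen_B w"] point_sum_zeros[of Ts "eigen_A w" "eigen_B w"]
      Ts(1) degree_reg_norm_eigen[OF w] by auto
qed

definition coset_list :: "'a point \<Rightarrow> 'a point list" where
  "coset_list T = map (\<lambda>i. ec_add W T (mul P i)) [0..<n]"

lemma length_coset_list [simp]: "length (coset_list T) = n"
  by (simp add: coset_list_def)

lemma distinct_coset_list:
  assumes "T \<in> ec_points W"
  shows "distinct (coset_list T)"
proof -
  have "inj_on (\<lambda>i. ec_add W T (mul P i)) {0..<n}"
    using mul_P_inj assms by (intro inj_onI) (simp add: G.l_cancel)
  thus ?thesis by (simp add: coset_list_def distinct_map)
qed

lemma in_coset_list_iff: "S \<in> set (coset_list T) \<longleftrightarrow> (\<exists>i. S = ec_add W T (mul P i))"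
proof
  assume "\<exists>i. S = ec_add W T (mul P i)"
  then obtain i where "S = ec_add W T (mul P (i mod n))" by (auto simp: mul_P_mod)
  moreover have "i mod n < n" using n_ge_3 by simp
  ultimately show "S \<in> set (coset_list T)" unfolding coset_list_def by auto
qed (auto simp: coset_list_def)

lemma coset_list_subset:
  assumes "T \<in> ec_points W" "T \<notin> multiples"
  shows "set (coset_list T) \<subseteq> ec_points W - multiples"
  using assms ec_add_closed by (auto simp: in_coset_list_iff ec_add_multiple_iff)

lemma eigenfun_eq_0_on_coset:
  assumes "nontrivial_root w" "T \<in> ec_points W" "T \<notin> multiples" "eigenfun w T = 0" "S \<in> set (coset_list T)"
  shows "eigenfun w S = 0"
  using assms eigenfun_add_multiple_eq_0_iff by (auto simp: in_coset_list_iff)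

lemma eigenfun_zeros_same_coset:
  assumes w: "nontrivial_root w" and T: "T \<in> ec_points W" "T \<notin> multiples" "eigenfun w T = 0"
    and S: "S \<in> ec_points W" "S \<notin> multiples" "eigenfun w S = 0"
  shows "\<exists>i. S = ec_add W T (mul P i)"
proof (rule ccontr)
  assume "\<not> ?thesis"
  hence "S \<notin> set (coset_list T)" by (simp add: in_coset_list_iff)
  hence "length (S # coset_list T) \<le> n"
    using distinct_coset_list[OF T(1)] coset_list_subset[OF T(1,2)] S eigenfun_eq_0_on_coset[OF w T]
    by (intro length_eigenfun_zeros_le[OF w]) auto
  thus False by simp
qed

lemma point_sum_translates:
  assumes "T \<in> ec_points W"
  shows "point_sum (map (\<lambda>i. ec_add W T (mul P i)) ks) = ec_add W (mul T (length ks)) (mul P (sum_list ks))"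
proof (induction ks)
  case (Cons i ks)
  note closed = G.nat_pow_closed[OF assms]
  have "point_sum (map (\<lambda>i. ec_add W T (mul P i)) (i # ks)) =
     ec_add W (ec_add W T (mul P i)) (ec_add W (mul T (length ks)) (mul P (sum_list ks)))"
    using Cons by simp
  also have "\<dots> = ec_add W (ec_add W T (mul T (length ks))) (ec_add W (mul P i) (mul P (sum_list ks)))"
    using assms closed by (simp add: G.m_assoc G.m_lcomm[of "mul P i" "mul T (length ks)"])
  also have "ec_add W T (mul T (length ks)) = mul T (length (i # ks))"
    using G.nat_pow_Suc2[OF assms] by simp
  finally show ?case by (simp add: mul_P_add)
qed simp

lemma regular_function_eq_0_of_coset_zeros:
  assumes T: "T \<in> ec_points W" "T \<notin> multiples"
    and zero: "\<And>x y. Affine x y \<in> set (coset_list T) \<Longrightarrow> poly A x + poly B x * y = 0"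
    and degree: "degree A \<le> half" "B \<noteq> 0 \<Longrightarrow> degree B + 1 < half"
  shows "A = 0 \<and> B = 0"
proof (rule ccontr)
  assume nonzero: "\<not> (A = 0 \<and> B = 0)"
  have "length (coset_list T) \<le> degree (reg_norm A B)"
    using coset_list_subset[OF T] distinct_coset_list[OF T(1)] nonzero zero by (intro length_zeros_le) auto
  thus False using degree n_eq_half by (auto simp: degree_reg_norm split: if_splits)
qed

lemma eigenfuns_proportional:
  assumes w: "nontrivial_root w" and w': "nontrivial_root w'"
    and T: "T \<in> ec_points W" "T \<notin> multiples" "eigenfun w T = 0" "eigenfun w' T = 0"
    and S: "S \<in> ec_points W" "S \<notin> multiples"
  shows "(1 - w') * eigenfun w S = (1 - w) * eigenfun w' S"
proof -
  define A where "A = smult (1 - w') (eigen_A w) - smult (1 - w) (eigen_A w')"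
  define B where "B = smult (1 - w') (eigen_B w) - smult (1 - w) (eigen_B w')"
  have eval: "poly A x + poly B x * y =
      poly denom x * ((1 - w') * eigenfun w (Affine x y) - (1 - w) * eigenfun w' (Affine x y))"
    if "on_curve W x y" "Affine x y \<notin> multiples" for x y
  proof -
    have "poly A x + poly B x * y = (1 - w') * (poly (eigen_A w) x + poly (eigen_B w) x * y) -
       (1 - w) * (poly (eigen_A w') x + poly (eigen_B w') x * y)"
      by (simp add: A_def B_def algebra_simps)
    thus ?thesis unfolding eigen_numerator_eq[OF that] by (simp add: algebra_simps)
  qed
  have "A = 0 \<and> B = 0"
  proof (rule regular_function_eq_0_of_coset_zeros[OF T(1,2)])
    fix x y assume xy: "Affine x y \<in> set (coset_list T)"
    hence "on_curve W x y" "Affine x y \<notin> multiples" using coset_list_subset[OF T(1,2)] by auto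
    thus "poly A x + poly B x * y = 0"
      using eval xy eigenfun_eq_0_on_coset[OF w T(1,2,3)] eigenfun_eq_0_on_coset[OF w' T(1,2,4)] by simp
  next
    show "degree A \<le> half" unfolding A_def
      by (intro degree_diff_le order_trans[OF degree_smult_le] degree_eigen_A)
  next
    assume "B \<noteq> 0"
    have "degree B \<le> half - 1" unfolding B_def
      by (intro degree_diff_le order_trans[OF degree_smult_le] degree_eigen_B)
    moreover have "coeff B (half - 1) = 0"
      unfolding B_def coeff_diff coeff_smult coeff_eigen_B[OF w] coeff_eigen_B[OF w']
      by (simp add: algebra_simps)
    hence "degree B \<noteq> half - 1" using \<open>B \<noteq> 0\<close> by (metis leading_coeff_0_iff)
    ultimately show "degree B + 1 < half" by linarith
  qed
  moreover obtain x y where "S = Affine x y" using S by (cases S) auto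
  ultimately show ?thesis using eval[of x y] poly_denom_neq_0[of x y] S by simp
qed

text \<open>
  If two eigenfunctions share a zero, they are proportional; outside the coset of the zero they do
  not vanish, so their eigenvalues agree.
\<close>

lemma eigenfun_root_unique:
  assumes w: "nontrivial_root w" and w': "nontrivial_root w'"
    and T: "T \<in> ec_points W" "T \<notin> multiples" "eigenfun w T = 0" "eigenfun w' T = 0"
    and S: "S \<in> ec_points W" "S \<notin> multiples" "\<And>i. S \<noteq> ec_add W T (mul P i)"
  shows "w = w'"
proof -
  note proportional = eigenfuns_proportional[OF w w' T]
  have "eigenfun w S \<noteq> 0" using eigenfun_zeros_same_coset[OF w T(1-3) S(1,2)] S(3) by blast
  have SP: "ec_add W S P \<in> ec_points W" "ec_add W S P \<notin> multiples"
    using ec_add_closed[OF S(1) P] S by (simp_all add: ec_add_multiple_iff)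
  have "(1 - w') * eigenfun w S = w * ((1 - w') * eigenfun w (ec_add W S P))"
    using eigenfun_shift[OF w S(1,2)] by (simp add: mult_ac)
  also have "\<dots> = w * (1 - w) * eigenfun w' (ec_add W S P)" using proportional[OF SP] by (simp add: mult_ac)
  finally have "w' * ((1 - w') * eigenfun w S) = w * (1 - w) * (w' * eigenfun w' (ec_add W S P))"
    by (simp add: mult_ac)
  also have "\<dots> = w * ((1 - w') * eigenfun w S)"
    using eigenfun_shift[OF w' S(1,2)] proportional[OF S(1,2)] by (simp add: mult_ac)
  finally show ?thesis using \<open>eigenfun w S \<noteq> 0\<close> w' by (simp add: nontrivial_root_def)
qed

end

locale ec_odd_order_point_alg_closed = ec_odd_order_point W n P
  for W :: "'a::alg_closed_field weierstrass" and n P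
begin

lemma regular_function_has_zero:
  assumes "degree (reg_norm A B) > 0"
  shows "\<exists>x y. on_curve W x y \<and> poly A x + poly B x * y = 0"
proof -
  obtain x where x: "poly (reg_norm A B) x = 0" using alg_closed_imp_poly_has_root[OF assms] by blast
  have "\<exists>y. poly [:- poly cubic x, poly ycoeff x, 1:] y = 0"
    by (rule alg_closed_imp_poly_has_root) simp
  then obtain y where "poly [:- poly cubic x, poly ycoeff x, 1:] y = 0" ..
  hence y: "y\<^sup>2 + poly ycoeff x * y = poly cubic x"
    by (simp add: algebra_simps power2_eq_square add_eq_0_iff)
  let ?y = "- y - poly ycoeff x"
  have y': "?y\<^sup>2 + poly ycoeff x * ?y = poly cubic x" unfolding y[symmetric] by Groebner_Basis.algebra
  have "(poly A x + poly B x * y) * (poly A x + poly B x * ?y) = poly (reg_norm A B) x"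
    unfolding reg_norm_def poly_diff poly_mult poly_power y[symmetric] by Groebner_Basis.algebra
  hence "poly A x + poly B x * y = 0 \<or> poly A x + poly B x * ?y = 0" unfolding x by simp
  thus ?thesis using y y' on_curve_iff_poly by blast
qed

lemma ex_eigenfun_zero:
  assumes w: "nontrivial_root w"
  obtains T where "T \<in> ec_points W" "T \<notin> multiples" "eigenfun w T = 0"
proof -
  have "degree (reg_norm (eigen_A w) (eigen_B w)) > 0" using degree_reg_norm_eigen[OF w] n_ge_3 by simp
  then obtain x y where xy: "on_curve W x y" "poly (eigen_A w) x + poly (eigen_B w) x * y = 0"
    using regular_function_has_zero by blast
  have "Affine x y \<notin> multiples"
  proof
    assume "Affine x y \<in> multiples"
    then obtain i where i: "Affine x y = mul P (i mod n)" by (auto simp: multiples_def mul_P_mod)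
    hence "i mod n \<in> {1..<n}" using n_ge_3 by (cases "i mod n = 0") auto
    thus False using eigen_numerator_neq_0_at_multiple[OF w] mul_P_eq_Affine i xy by fastforce
  qed
  moreover from this have "eigenfun w (Affine x y) = 0"
    using eigen_numerator_eq[of x y w] poly_denom_neq_0[of x y] xy by simp
  ultimately show thesis using that[of "Affine x y"] xy(1) by simp
qed

lemma eigenfun_zero_torsion:
  assumes w: "nontrivial_root w" and T: "T \<in> ec_points W" "T \<notin> multiples" "eigenfun w T = 0"
  shows "mul T n = Infinity"
proof -
  have "point_sum (coset_list T) = Infinity"
    using distinct_coset_list[OF T(1)] coset_list_subset[OF T(1,2)] eigenfun_eq_0_on_coset[OF w T]
    by (intro point_sum_eigenfun_zeros[OF w]) auto
  hence "ec_add W (mul T n) (mul P (sum_list [0..<n])) = Infinity"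
    unfolding coset_list_def point_sum_translates[OF T(1)] by simp
  moreover have "sum_list [0..<n] = n * half"
    by (simp add: sum_list_upt Sum_Ico_nat half_def) (simp add: odd div_mult_swap)
  hence "mul P (sum_list [0..<n]) = Infinity" by (simp add: mul_P_eq_Infinity_iff)
  ultimately show ?thesis by simp
qed

end


section \<open>Roots of unity and cosets in the torsion subgroup\<close>

lemma primitive_root_inj_on:
  assumes "primitive_root_of_unity n z"
  shows "inj_on (\<lambda>k. z ^ k) {..<n}"
proof (rule linorder_inj_onI)
  fix i j assume ij: "i < j" "i \<in> {..<n}" "j \<in> {..<n}"
  have z: "n > 0" "z ^ n = 1" "\<And>k. 0 < k \<Longrightarrow> k < n \<Longrightarrow> z ^ k \<noteq> 1"
    using assms by (auto simp: primitive_root_of_unity_def)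
  show "z ^ i \<noteq> z ^ j"
  proof
    assume "z ^ i = z ^ j"
    also have "z ^ j = z ^ i * z ^ (j - i)" using ij(1) by (simp flip: power_add)
    finally have "z ^ i = 0 \<or> z ^ (j - i) = 1" by simp
    moreover have "z ^ i \<noteq> 0" using z(1,2) by (auto simp: power_0_left)
    ultimately show False using z(3)[of "j - i"] ij by auto
  qed
qed auto

lemma primitive_root_power_generates:
  assumes "primitive_root_of_unity n z" "coprime k n" "n > 1"
  obtains l where "(z ^ k) ^ l = z"
proof -
  obtain l where "[k * l = 1] (mod n)" using cong_solve_coprime_nat[OF assms(2)] by auto
  hence "k * l mod n = 1" using assms(3) by (simp add: cong_def)
  hence "z ^ (k * l) = z ^ (n * (k * l div n) + 1)" by (metis mult_div_mod_eq)
  also have "\<dots> = z"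
    using assms(1) by (simp add: power_add power_mult primitive_root_of_unity_def)
  finally have "(z ^ k) ^ l = z" by (simp add: power_mult)
  thus thesis ..
qed

locale torsion_basis_group = comm_group G for G (structure) +
  fixes n :: nat and P Q
  assumes n_pos: "n > 0" and basis: "torsion_basis G n P Q"
begin

lemma basis_closed: "P \<in> carrier G" "Q \<in> carrier G" and basis_torsion: "P [^] n = \<one>" "Q [^] n = \<one>"
  using basis by (auto simp: torsion_basis_def torsion_def)

definition lincomb :: "nat \<Rightarrow> nat \<Rightarrow> 'a" where "lincomb i j = P [^] i \<otimes> Q [^] j"

lemma lincomb_closed [simp]: "lincomb i j \<in> carrier G"
  using basis_closed by (simp add: lincomb_def)

lemma lincomb_0_right: "lincomb i 0 = P [^] i" and lincomb_0_left: "lincomb 0 j = Q [^] j"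
  using basis_closed by (simp_all add: lincomb_def)

lemma torsion_eq_lincomb: "R \<in> carrier G \<Longrightarrow> R [^] n = \<one> \<Longrightarrow> \<exists>i j. R = lincomb i j"
  using basis by (auto simp: torsion_basis_def torsion_def lincomb_def)

lemma lincomb_mult: "lincomb a b \<otimes> lincomb c d = lincomb (a + c) (b + d)"
  using basis_closed by (simp add: lincomb_def nat_pow_mult[symmetric] m_ac)

lemma lincomb_pow: "lincomb a b [^] k = lincomb (a * k) (b * k)"
  using basis_closed by (simp add: lincomb_def nat_pow_distrib nat_pow_pow)

lemma lincomb_eq_one_iff: "lincomb i j = \<one> \<longleftrightarrow> n dvd i \<and> n dvd j"
proof
  show "lincomb i j = \<one> \<Longrightarrow> n dvd i \<and> n dvd j" using basis by (auto simp: torsion_basis_def lincomb_def)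
  show "n dvd i \<and> n dvd j \<Longrightarrow> lincomb i j = \<one>"
    using basis_closed basis_torsion by (auto simp: lincomb_def simp flip: nat_pow_pow elim!: dvdE)
qed

lemma ord_P: "ord P = n" and ord_Q: "ord Q = n"
  using basis_closed lincomb_eq_one_iff[of _ 0] lincomb_eq_one_iff[of 0]
  by (simp_all add: ord_unique lincomb_0_right lincomb_0_left)

lemma lincomb_eq_iff: "lincomb a b = lincomb c d \<longleftrightarrow> [a = c] (mod n) \<and> [b = d] (mod n)"
proof
  have multiple: "x + x * (n - 1) = x * n" for x
    using n_pos by (metis Suc_diff_1 mult_Suc_right)
  assume "lincomb a b = lincomb c d"
  hence "lincomb (a + c * (n - 1)) (b + d * (n - 1)) = lincomb (c + c * (n - 1)) (d + d * (n - 1))"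
    by (simp flip: lincomb_mult)
  also have "\<dots> = \<one>" unfolding multiple by (simp add: lincomb_eq_one_iff)
  finally have "[a + c * (n - 1) = 0] (mod n)" "[b + d * (n - 1) = 0] (mod n)"
    by (simp_all add: lincomb_eq_one_iff cong_0_iff)
  moreover have "[0 = c + c * (n - 1)] (mod n)" for c
    unfolding multiple by (simp add: cong_0_iff cong_sym_eq[of 0])
  ultimately have "[a + c * (n - 1) = c + c * (n - 1)] (mod n)"
    "[b + d * (n - 1) = d + d * (n - 1)] (mod n)"
    using cong_trans by blast+
  thus "[a = c] (mod n) \<and> [b = d] (mod n)" by (simp add: cong_add_rcancel_nat)
next
  assume "[a = c] (mod n) \<and> [b = d] (mod n)"
  hence "P [^] a = P [^] c" "Q [^] b = Q [^] d"
    by (simp_all add: nat_pow_eq_iff_cong basis_closed ord_P ord_Q)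
  thus "lincomb a b = lincomb c d" by (simp add: lincomb_def)
qed

end

locale ec_torsion_basis = ell_curve W for W :: "'a::alg_closed_field weierstrass" +
  fixes p :: nat and P Q :: "'a point"
  assumes p: "prime p" "odd p" and torsion_basis: "torsion_basis (ec_group W) p P Q"

sublocale ec_torsion_basis \<subseteq> B: torsion_basis_group "ec_group W" p P Q
  rewrites "carrier (ec_group W) = ec_points W" and "monoid.mult (ec_group W) = ec_add W"
    and "\<one>\<^bsub>ec_group W\<^esub> = Infinity"
  using p prime_gt_0_nat torsion_basis comm_group_ec_group
  by (auto intro!: torsion_basis_group.intro torsion_basis_group_axioms.intro)

sublocale ec_torsion_basis \<subseteq> ec_odd_order_point_alg_closed W p P
proof -
  have "ec_odd_order_point W p P"
    by unfold_locales (use p B.basis_closed B.ord_P in auto)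
  thus "ec_odd_order_point_alg_closed W p P" by (rule ec_odd_order_point_alg_closed.intro)
qed

context ec_torsion_basis begin

lemma Q: "Q \<in> ec_points W" "mul Q p = Infinity"
  using B.basis_closed B.basis_torsion by auto

lemma mul_Q_eq_Infinity_iff: "mul Q i = Infinity \<longleftrightarrow> p dvd i"
  using G.pow_eq_id[OF Q(1)] B.ord_Q by simp

lemma mul_Q_mod: "mul Q (i mod p) = mul Q i"
  using G.nat_pow_eq_iff_cong[OF Q(1)] B.ord_Q by simp

lemma lincomb_0_1 [simp]: "B.lincomb 0 1 = Q" "B.lincomb 0 (Suc 0) = Q"
  using Q by (simp_all add: B.lincomb_0_left)

lemma ec_add_mul_P_eq_lincomb: "T = B.lincomb i j \<Longrightarrow> ec_add W T (mul P k) = B.lincomb (i + k) j"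
  using B.lincomb_mult[of i j k 0] by (simp add: B.lincomb_0_right)

lemma lincomb_in_multiples_iff: "B.lincomb i j \<in> multiples \<longleftrightarrow> p dvd j"
proof
  assume "B.lincomb i j \<in> multiples"
  then obtain k where "B.lincomb i j = B.lincomb k 0" by (auto simp: multiples_def B.lincomb_0_right)
  thus "p dvd j" by (simp add: B.lincomb_eq_iff cong_0_iff)
next
  assume "p dvd j"
  hence "B.lincomb i j = B.lincomb i 0" by (simp add: B.lincomb_eq_iff cong_0_iff)
  thus "B.lincomb i j \<in> multiples" by (simp add: B.lincomb_0_right)
qed

lemma mul_Q_in_multiples_iff: "mul Q j \<in> multiples \<longleftrightarrow> p dvd j"
  using lincomb_in_multiples_iff[of 0] by (simp add: B.lincomb_0_left)

lemma not_p_dvd_2: "\<not> p dvd 2"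
  using n_ge_3 by (auto dest: dvd_imp_le)

lemma ex_eigenfun_zero_multiple_of_Q:
  assumes w: "nontrivial_root w"
  shows "\<exists>b\<in>{1..<p}. eigenfun w (mul Q b) = 0"
proof -
  obtain T where T: "T \<in> ec_points W" "T \<notin> multiples" "eigenfun w T = 0"
    using ex_eigenfun_zero[OF w] .
  then obtain i j where T_eq: "T = B.lincomb i j"
    using B.torsion_eq_lincomb eigenfun_zero_torsion[OF w] by blast
  hence j: "\<not> p dvd j" using T(2) lincomb_in_multiples_iff by simp
  have "T = ec_add W (mul Q j) (mul P i)"
    using ec_add_mul_P_eq_lincomb[OF B.lincomb_0_left[symmetric], of j i] by (simp add: T_eq)
  hence "eigenfun w (mul Q j) = 0"
    using eigenfun_add_multiple_eq_0_iff[OF w, of "mul Q j" i] T(3) j mul_Q_in_multiples_iff Q(1) by simp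
  hence "eigenfun w (mul Q (j mod p)) = 0" by (simp add: mul_Q_mod)
  moreover have "j mod p \<in> {1..<p}" using j n_ge_3 by (auto simp: dvd_eq_mod_eq_0 Suc_le_eq)
  ultimately show ?thesis by blast
qed

lemma eigenfun_root_unique_at_multiple_of_Q:
  assumes w: "nontrivial_root w" and w': "nontrivial_root w'"
    and b: "b \<in> {1..<p}" "eigenfun w (mul Q b) = 0" "eigenfun w' (mul Q b) = 0"
  shows "w = w'"
proof (rule eigenfun_root_unique[OF w w', of "mul Q b" "mul Q (2 * b)"])
  have b_ndvd: "\<not> p dvd b" using b(1) by (auto dest: dvd_imp_le)
  moreover from this have "\<not> p dvd 2 * b" using not_p_dvd_2 p(1) by (simp add: prime_dvd_mult_iff)
  ultimately show "mul Q b \<notin> multiples" "mul Q (2 * b) \<notin> multiples"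
    by (simp_all add: mul_Q_in_multiples_iff)
  show "mul Q (2 * b) \<noteq> ec_add W (mul Q b) (mul P i)" for i
  proof
    assume "mul Q (2 * b) = ec_add W (mul Q b) (mul P i)"
    hence "B.lincomb 0 (b + b) = B.lincomb i b"
      using ec_add_mul_P_eq_lincomb[OF B.lincomb_0_left[symmetric]] by (simp add: B.lincomb_0_left mult_2)
    hence "[b + b = 0 + b] (mod p)" by (simp add: B.lincomb_eq_iff)
    hence "[b = 0] (mod p)" using cong_add_rcancel_nat by blast
    thus False using b_ndvd by (simp add: cong_0_iff)
  qed
qed (use b Q(1) in auto)

lemma eigenfun_root_unique_at_Q:
  assumes "nontrivial_root w" "nontrivial_root w'" "eigenfun w Q = 0" "eigenfun w' Q = 0"
  shows "w = w'"
  using eigenfun_root_unique_at_multiple_of_Q[OF assms(1,2), of 1] assms(3,4) Q(1) n_ge_3 by simp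

lemma nontrivial_root_primitive_power:
  assumes "primitive_root_of_unity p z" "k \<in> {1..<p}"
  shows "nontrivial_root (z ^ k)"
proof -
  have "(z ^ k) ^ p = (z ^ p) ^ k" by (metis power_mult mult.commute)
  thus ?thesis using assms by (simp add: nontrivial_root_def primitive_root_of_unity_def)
qed

text \<open>
  Each nontrivial \<open>p\<close>-th root of unity \<open>w\<close> has its own coset \<open>b Q + \<langle>P\<rangle>\<close> of zeros of \<open>eigenfun w\<close>;
  there are \<open>p - 1\<close> roots and \<open>p - 1\<close> cosets.
\<close>

lemma ex_primitive_power_eigenfun_zero_at_Q:
  assumes z: "primitive_root_of_unity p z"
  obtains k where "k \<in> {1..<p}" "eigenfun (z ^ k) Q = 0"
proof -
  note root = nontrivial_root_primitive_power[OF z]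
  have "\<forall>k\<in>{1..<p}. \<exists>b\<in>{1..<p}. eigenfun (z ^ k) (mul Q b) = 0"
    using ex_eigenfun_zero_multiple_of_Q[OF root] by blast
  then obtain f where f: "\<And>k. k \<in> {1..<p} \<Longrightarrow> f k \<in> {1..<p} \<and> eigenfun (z ^ k) (mul Q (f k)) = 0"
    by metis
  have "inj_on f {1..<p}"
  proof (rule inj_onI)
    fix k l assume kl: "k \<in> {1..<p}" "l \<in> {1..<p}" "f k = f l"
    have "z ^ k = z ^ l"
      using eigenfun_root_unique_at_multiple_of_Q[OF root[OF kl(1)] root[OF kl(2)]]
        f[OF kl(1)] f[OF kl(2)] kl(3)
      by metis
    thus "k = l" using inj_onD[OF primitive_root_inj_on[OF z]] kl by auto
  qed
  hence "f ` {1..<p} = {1..<p}" using f by (intro endo_inj_surj) auto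
  moreover have "1 \<in> {1..<p}" using n_ge_3 by simp
  ultimately obtain k where "k \<in> {1..<p}" "f k = 1" by (metis imageE)
  thus thesis using that f[of k] Q(1) by auto
qed

lemma eigenfun_zero_lincombD:
  assumes w: "nontrivial_root w" "eigenfun w Q = 0" and "eigenfun w (B.lincomb i j) = 0" "\<not> p dvd j"
  shows "[j = 1] (mod p)"
proof -
  have "Q \<notin> multiples" using mul_Q_in_multiples_iff[of 1] Q(1) p(1) by auto
  then obtain k where "B.lincomb i j = ec_add W Q (mul P k)"
    using eigenfun_zeros_same_coset[OF w(1) Q(1) _ w(2) B.lincomb_closed]
      assms(3,4) lincomb_in_multiples_iff
    by blast
  also have "\<dots> = B.lincomb (0 + k) 1" by (rule ec_add_mul_P_eq_lincomb) simp
  finally show ?thesis by (simp add: B.lincomb_eq_iff)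
qed

end


section \<open>Subfields and conjugate elements\<close>

definition is_subfield :: "'b::field set \<Rightarrow> bool" where
  "is_subfield F \<longleftrightarrow> 0 \<in> F \<and> 1 \<in> F \<and> (\<forall>x\<in>F. \<forall>y\<in>F. x + y \<in> F \<and> x - y \<in> F \<and> x * y \<in> F \<and> x / y \<in> F)"

lemma is_subfieldD:
  assumes "is_subfield F"
  shows "0 \<in> F" "1 \<in> F" "x \<in> F \<Longrightarrow> y \<in> F \<Longrightarrow> x + y \<in> F" "x \<in> F \<Longrightarrow> y \<in> F \<Longrightarrow> x - y \<in> F"
    "x \<in> F \<Longrightarrow> y \<in> F \<Longrightarrow> x * y \<in> F" "x \<in> F \<Longrightarrow> y \<in> F \<Longrightarrow> x / y \<in> F"
  using assms by (auto simp: is_subfield_def)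

lemma is_subfield_minus: "is_subfield F \<Longrightarrow> x \<in> F \<Longrightarrow> - x \<in> F"
  using is_subfieldD(4)[of F 0 x] is_subfieldD(1)[of F] by simp

lemma is_subfield_inverse: "is_subfield F \<Longrightarrow> x \<in> F \<Longrightarrow> inverse x \<in> F"
  using is_subfieldD(6)[of F 1 x] is_subfieldD(2)[of F] by (simp add: divide_inverse)

lemma is_subfield_power: "is_subfield F \<Longrightarrow> x \<in> F \<Longrightarrow> x ^ k \<in> F"
  by (induction k) (auto simp: is_subfieldD)

lemma is_subfield_sum: "is_subfield F \<Longrightarrow> (\<And>i. i \<in> S \<Longrightarrow> f i \<in> F) \<Longrightarrow> (\<Sum>i\<in>S. f i) \<in> F"
  by (induction S rule: infinite_finite_induct) (auto simp: is_subfieldD)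

lemma is_subfield_of_nat: "is_subfield F \<Longrightarrow> of_nat k \<in> F"
  by (induction k) (auto simp: is_subfieldD)

lemma is_subfield_numeral: "is_subfield F \<Longrightarrow> numeral k \<in> F"
  using is_subfield_of_nat[of F "numeral k"] by simp

lemmas is_subfield_closed =
  is_subfieldD is_subfield_minus is_subfield_power is_subfield_sum is_subfield_of_nat is_subfield_numeral

lemma is_subfield_iff_subfield: "is_subfield F \<longleftrightarrow> subfield F ring_of_type_algebra"
proof -
  let ?R = "ring_of_type_algebra :: 'a ring"
  interpret R: field ?R by (rule field_from_type_algebra)
  have R: "carrier ?R = UNIV" "monoid.mult ?R = (*)" "ring.add ?R = (+)" "\<zero>\<^bsub>?R\<^esub> = 0" "\<one>\<^bsub>?R\<^esub> = 1"
    by (simp_all add: ring_of_type_algebra_def)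
  have neg: "\<ominus>\<^bsub>?R\<^esub> x = - x" for x
    by (rule R.minus_equality) (simp_all add: R)
  have inv: "inv\<^bsub>?R\<^esub> x = inverse x" if "x \<noteq> 0" for x
    using that by (intro R.inv_char) (simp_all add: R)
  show ?thesis
  proof
    assume F: "is_subfield F"
    have "subring F ?R"
      using F by (intro R.subringI) (simp_all add: R neg is_subfield_closed)
    thus "subfield F ?R"
      using F by (intro R.subfieldI') (simp_all add: R inv is_subfield_inverse)
  next
    assume F: "subfield F ?R"
    note F_closed = subringE[OF subfieldE(1)[OF F], unfolded R neg]
    have "x - y \<in> F" if "x \<in> F" "y \<in> F" for x y
      using F_closed(7)[OF that(1) F_closed(5)[OF that(2)]] by simp
    moreover have "x / y \<in> F" if "x \<in> F" "y \<in> F" for x y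
    proof (cases "y = 0")
      case False
      hence "inverse y \<in> F" using R.subfield_m_inv(1)[OF F, of y] that(2) by (simp add: R inv)
      thus ?thesis using F_closed(6)[OF that(1)] by (simp add: divide_inverse)
    qed (use F_closed(2) in simp)
    ultimately show "is_subfield F" using F_closed by (simp add: is_subfield_def)
  qed
qed

lemma is_subfield_adjoin: "is_subfield (adjoin S)"
  and adjoin_least: "is_subfield F \<Longrightarrow> range to_ac \<subseteq> F \<Longrightarrow> S \<subseteq> F \<Longrightarrow> adjoin S \<subseteq> F"
proof -
  interpret R: field "ring_of_type_algebra :: 'a alg_closure ring" by (rule field_from_type_algebra)
  have carrier: "range to_ac \<union> S \<subseteq> carrier (ring_of_type_algebra :: 'a alg_closure ring)"
    by (simp add: ring_of_type_algebra_def)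
  show "is_subfield (adjoin S)"
    unfolding is_subfield_iff_subfield adjoin_def by (rule R.generate_field_is_subfield[OF carrier])
  show "is_subfield F \<Longrightarrow> range to_ac \<subseteq> F \<Longrightarrow> S \<subseteq> F \<Longrightarrow> adjoin S \<subseteq> F"
    unfolding is_subfield_iff_subfield adjoin_def using R.generate_field_min_subfield1[OF carrier] by simp
qed

lemma in_adjoin: "x \<in> S \<Longrightarrow> x \<in> adjoin S" and range_to_ac_subset_adjoin: "range to_ac \<subseteq> adjoin S"
  unfolding adjoin_def by (auto intro: generate_field.incl)

lemma adjoin_subset_iff: "adjoin S \<subseteq> adjoin T \<longleftrightarrow> S \<subseteq> adjoin T"
  using adjoin_least[OF is_subfield_adjoin range_to_ac_subset_adjoin] in_adjoin by blast

lemma adjoin_eq_iff: "adjoin S = adjoin T \<longleftrightarrow> S \<subseteq> adjoin T \<and> T \<subseteq> adjoin S"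
  by (simp add: set_eq_subset adjoin_subset_iff)

definition coeffs_in :: "'b::field set \<Rightarrow> 'b poly \<Rightarrow> bool" where
  "coeffs_in F f \<longleftrightarrow> (\<forall>i. coeff f i \<in> F)"

lemma coeffs_in_closed:
  assumes "is_subfield F"
  shows "coeffs_in F 0" "coeffs_in F 1" "coeffs_in F f \<Longrightarrow> coeffs_in F g \<Longrightarrow> coeffs_in F (f + g)"
    "coeffs_in F f \<Longrightarrow> coeffs_in F g \<Longrightarrow> coeffs_in F (f - g)"
    "coeffs_in F f \<Longrightarrow> coeffs_in F g \<Longrightarrow> coeffs_in F (f * g)"
    "c \<in> F \<Longrightarrow> coeffs_in F f \<Longrightarrow> coeffs_in F (pCons c f)"
    "c \<in> F \<Longrightarrow> coeffs_in F f \<Longrightarrow> coeffs_in F (smult c f)"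
    "c \<in> F \<Longrightarrow> coeffs_in F (monom c k)"
  using assms
  by (auto simp: coeffs_in_def coeff_mult coeff_1 coeff_pCons is_subfield_closed split: nat.splits)

lemma coeffs_in_sum: "is_subfield F \<Longrightarrow> (\<And>i. i \<in> S \<Longrightarrow> coeffs_in F (f i)) \<Longrightarrow> coeffs_in F (\<Sum>i\<in>S. f i)"
  by (simp add: coeffs_in_def coeff_sum is_subfield_sum)

lemma coeffs_in_div_mod:
  assumes F: "is_subfield F" and m: "coeffs_in F m" and f: "coeffs_in F f"
  shows "coeffs_in F (f div m) \<and> coeffs_in F (f mod m)"
  using f
proof (induction f)
  case (pCons c f)
  have "c \<in> F" "coeffs_in F f"
    using pCons.prems coeff_pCons_0[of c f] coeff_pCons_Suc[of c f] unfolding coeffs_in_def by metis+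
  hence f: "coeffs_in F (f div m)" "coeffs_in F (pCons c (f mod m))"
    using pCons.IH by (auto intro: coeffs_in_closed[OF F])
  hence "coeff (pCons c (f mod m)) (degree m) / lead_coeff m \<in> F"
    using m unfolding coeffs_in_def by (intro is_subfieldD(6)[OF F]) blast+
  thus ?case
    using f m pCons.prems unfolding div_pCons_eq mod_pCons_eq by (auto intro: coeffs_in_closed[OF F])
qed (simp add: coeffs_in_closed[OF F])

lemma root_of_linear_in_subfield:
  assumes F: "is_subfield F" and q: "coeffs_in F q" "q \<noteq> 0" "degree q \<le> 1" "poly q v = 0"
  shows "v \<in> F"
proof -
  define c d where "c = coeff q 0" and "d = coeff q 1"
  have q_eq: "q = [:c, d:]"
    using q(3) by (intro poly_eqI) (auto simp: c_def d_def coeff_pCons coeff_eq_0 split: nat.splits)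
  have root: "c + v * d = 0" using q(4) unfolding q_eq by simp
  hence "d \<noteq> 0" using q(2) unfolding q_eq by auto
  hence "v = - c / d" using root by (simp add: field_simps add_eq_0_iff)
  moreover have "c \<in> F" "d \<in> F" using q(1) by (simp_all add: coeffs_in_def c_def d_def)
  ultimately show ?thesis by (simp add: is_subfield_closed[OF F])
qed

definition minpol :: "'b::field set \<Rightarrow> 'b \<Rightarrow> 'b poly \<Rightarrow> bool" where
  "minpol F a m \<longleftrightarrow> coeffs_in F m \<and> m \<noteq> 0 \<and> poly m a = 0 \<and>
     (\<forall>f. coeffs_in F f \<and> f \<noteq> 0 \<and> poly f a = 0 \<longrightarrow> degree m \<le> degree f)"

lemma ex_minpol:
  assumes "coeffs_in F f" "f \<noteq> 0" "poly f a = 0"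
  shows "\<exists>m. minpol F a m"
  using ex_has_least_nat[of "\<lambda>f. coeffs_in F f \<and> f \<noteq> 0 \<and> poly f a = 0" f degree] assms
  unfolding minpol_def by blast

lemma minpol_dvd:
  assumes F: "is_subfield F" and m: "minpol F a m" and f: "coeffs_in F f" "poly f a = 0"
  obtains q where "coeffs_in F q" "f = q * m"
proof -
  have qr: "coeffs_in F (f div m)" "coeffs_in F (f mod m)"
    using coeffs_in_div_mod[OF F _ f(1)] m by (auto simp: minpol_def)
  have "poly (f mod m) a = poly (f - f div m * m) a" by (simp only: minus_div_mult_eq_mod)
  also have "\<dots> = 0" using f(2) m by (simp add: minpol_def)
  finally have "f mod m = 0"
    using m qr(2) degree_mod_less[of m f] by (auto simp: minpol_def)
  hence "f = f div m * m" by (metis add.right_neutral div_mult_mod_eq)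
  thus thesis using that qr(1) by blast
qed

lemma degree_minpol_ge_1: "minpol F a m \<Longrightarrow> degree m \<ge> 1"
  by (rule ccontr) (auto simp: minpol_def not_le elim!: degree_eq_zeroE)

lemma degree_minpol_ge_2:
  assumes "is_subfield F" "minpol F a m" "a \<notin> F"
  shows "degree m \<ge> 2"
  by (rule ccontr)
    (use root_of_linear_in_subfield[OF assms(1), of m a] assms(2,3) in \<open>simp add: minpol_def\<close>)

lemma minpol_of_conjugate:
  assumes F: "is_subfield F" and m: "minpol F a m" and b: "poly m b = 0"
  shows "minpol F b m"
proof -
  obtain k where k: "minpol F b k" using ex_minpol[of F m b] m b by (auto simp: minpol_def)
  obtain q where q: "coeffs_in F q" "m = q * k" using minpol_dvd[OF F k _ b] m by (auto simp: minpol_def)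
  have nonzero: "q \<noteq> 0" "k \<noteq> 0" using m q(2) by (auto simp: minpol_def)
  have "poly q a \<noteq> 0"
  proof
    assume "poly q a = 0"
    hence "degree m \<le> degree q" using m q(1) nonzero by (simp add: minpol_def)
    thus False using degree_minpol_ge_1[OF k] q(2) nonzero by (simp add: degree_mult_eq)
  qed
  moreover have "poly m a = 0" using m by (simp add: minpol_def)
  ultimately have "poly k a = 0" unfolding q(2) by simp
  hence "degree m \<le> degree k" using m k by (simp add: minpol_def)
  thus ?thesis using m k b unfolding minpol_def by (meson order_trans)
qed

lemma minpol_conjugate_root_iff:
  assumes F: "is_subfield F" and m: "minpol F a m" and b: "poly m b = 0" and r: "coeffs_in F r"
  shows "poly r a = 0 \<longleftrightarrow> poly r b = 0"
proof -
  have "poly r b = 0" if "minpol F a m" "poly m b = 0" "poly r a = 0" for a b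
    using minpol_dvd[OF F that(1) r that(3)] that(2) by (metis poly_mult mult_zero_right)
  moreover have "poly m a = 0" using m by (simp add: minpol_def)
  ultimately show ?thesis using m b minpol_of_conjugate[OF F m b] by blast
qed

lemma ex_linear_product_dvd:
  fixes m :: "'b::alg_closed_field poly"
  assumes "poly m x = 0" "degree m \<ge> 2"
  shows "\<exists>t. [:-x, 1:] * [:-t, 1:] dvd m"
proof -
  obtain m' where m': "m = [:-x, 1:] * m'" using assms(1) unfolding poly_eq_0_iff_dvd by (elim dvdE)
  hence "m' \<noteq> 0" using assms(2) by auto
  hence "degree m' > 0" using assms(2) unfolding m' by (simp add: degree_mult_eq del: mult_pCons_left)
  then obtain t where "poly m' t = 0" using alg_closed_imp_poly_has_root by blast
  hence "[:-t, 1:] dvd m'" by (simp add: poly_eq_0_iff_dvd)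
  thus ?thesis unfolding m' by (intro exI mult_dvd_mono dvd_refl)
qed

text \<open>The polynomials \<open>f\<close> and \<open>g\<close> serve as certificates that the minimal polynomial of \<open>w\<close> is linear.\<close>

lemma unique_simple_common_root_in_subfield:
  fixes w :: "'b::alg_closed_field"
  assumes F: "is_subfield F" and f: "coeffs_in F f" "poly f w = 0" "poly (pderiv f) w \<noteq> 0"
    and g: "coeffs_in F g" "poly g w = 0" and unique: "\<And>t. poly f t = 0 \<Longrightarrow> poly g t = 0 \<Longrightarrow> t = w"
  shows "w \<in> F"
proof (rule ccontr)
  assume "w \<notin> F"
  have "f \<noteq> 0" using f(3) by auto
  then obtain m where m: "minpol F w m" using ex_minpol f by blast
  obtain q q' where q: "f = q * m" "g = q' * m"
    using minpol_dvd[OF F m f(1,2)] minpol_dvd[OF F m g] by metis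
  have "poly m w = 0" using m by (simp add: minpol_def)
  then obtain t m' where m': "m = [:-w, 1:] * [:-t, 1:] * m'"
    using ex_linear_product_dvd degree_minpol_ge_2[OF F m \<open>w \<notin> F\<close>] by (metis dvdE)
  hence "poly m t = 0" by (simp only: poly_mult) simp
  hence "t = w" by (intro unique) (simp_all add: q)
  hence "f = [:-w, 1:] * ([:-w, 1:] * (q * m'))" unfolding q m' by (simp only: mult_ac)
  hence "poly (pderiv f) w = 0" by (simp only: pderiv_mult poly_add poly_mult) simp
  thus False using f(3) by simp
qed

locale subfield_hom =
  fixes K :: "'a::field set" and s :: "'a \<Rightarrow> 'a"
  assumes hom_subfield: "is_subfield K" and map_1: "s 1 = 1"
    and map_add: "x \<in> K \<Longrightarrow> y \<in> K \<Longrightarrow> s (x + y) = s x + s y"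
    and map_mult: "x \<in> K \<Longrightarrow> y \<in> K \<Longrightarrow> s (x * y) = s x * s y"
begin

lemma map_0: "s 0 = 0"
  using map_add[of 0 0] is_subfieldD(1)[OF hom_subfield] by (metis add_0 add_cancel_right_left)

lemma map_diff: "x \<in> K \<Longrightarrow> y \<in> K \<Longrightarrow> s (x - y) = s x - s y"
  using map_add[of "x - y" y] is_subfieldD(4)[OF hom_subfield] by simp

lemma map_minus: "x \<in> K \<Longrightarrow> s (- x) = - s x"
  using map_diff[of 0 x] is_subfieldD(1)[OF hom_subfield] map_0 by simp

lemma map_eq_0_iff:
  assumes "x \<in> K"
  shows "s x = 0 \<longleftrightarrow> x = 0"
proof (cases "x = 0")
  case False
  have "s (x * (1 / x)) = s x * s (1 / x)"
    using assms is_subfieldD(2,6)[OF hom_subfield] by (intro map_mult) simp_all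
  thus ?thesis using False map_1 by auto
qed (simp add: map_0)

lemma map_eq_iff: "x \<in> K \<Longrightarrow> y \<in> K \<Longrightarrow> s x = s y \<longleftrightarrow> x = y"
  using map_eq_0_iff[of "x - y"] map_diff is_subfieldD(4)[OF hom_subfield] by auto

lemma map_divide:
  assumes "x \<in> K" "y \<in> K"
  shows "s (x / y) = s x / s y"
proof (cases "y = 0")
  case False
  have "s (x / y) * s y = s x"
    using map_mult[of "x / y" y] is_subfieldD(6)[OF hom_subfield assms] assms(2) False by simp
  thus ?thesis using map_eq_0_iff[OF assms(2)] False by (simp add: field_simps)
qed (simp add: map_0)

lemma map_sum: "(\<And>i. i \<in> S \<Longrightarrow> f i \<in> K) \<Longrightarrow> s (\<Sum>i\<in>S. f i) = (\<Sum>i\<in>S. s (f i))"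
  by (induction S rule: infinite_finite_induct) (auto simp: map_0 map_add is_subfield_sum[OF hom_subfield])

lemma map_power: "x \<in> K \<Longrightarrow> s (x ^ k) = s x ^ k"
  by (induction k) (auto simp: map_1 map_mult is_subfield_power[OF hom_subfield])

lemma map_of_nat: "s (of_nat k) = of_nat k"
  by (induction k) (auto simp: map_0 map_1 map_add is_subfield_closed[OF hom_subfield])

lemma map_numeral: "s (numeral k) = numeral k"
  using map_of_nat[of "numeral k"] by simp

lemmas map_simps =
  map_0 map_1 map_add map_mult map_diff map_minus map_eq_0_iff map_divide map_power map_numeral

end

text \<open>Fractions are allowed, so no inverses in \<open>F[a]\<close> have to be constructed.\<close>

definition simple_ext :: "'b::field set \<Rightarrow> 'b \<Rightarrow> 'b set" where
  "simple_ext F a = {poly r a / poly t a |r t. coeffs_in F r \<and> coeffs_in F t \<and> poly t a \<noteq> 0}"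

lemma in_simple_extI:
  "coeffs_in F r \<Longrightarrow> coeffs_in F t \<Longrightarrow> poly t a \<noteq> 0 \<Longrightarrow> poly r a / poly t a \<in> simple_ext F a"
  by (auto simp: simple_ext_def)

lemma simple_extE:
  assumes "x \<in> simple_ext F a"
  obtains r t where "coeffs_in F r" "coeffs_in F t" "poly t a \<noteq> 0" "x = poly r a / poly t a"
  using assms by (auto simp: simple_ext_def)

lemma subset_simple_ext: "is_subfield F \<Longrightarrow> F \<subseteq> simple_ext F a"
  using in_simple_extI[of F "[:c:]" 1 a for c] coeffs_in_closed[of F] by auto

lemma generator_in_simple_ext: "is_subfield F \<Longrightarrow> a \<in> simple_ext F a"
  using in_simple_extI[of F "[:0, 1:]" 1 a] coeffs_in_closed[of F] is_subfieldD(1,2)[of F] by simp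

lemma is_subfield_simple_ext:
  assumes F: "is_subfield F"
  shows "is_subfield (simple_ext F a)"
proof -
  have "x + y \<in> simple_ext F a \<and> x - y \<in> simple_ext F a \<and> x * y \<in> simple_ext F a \<and> x / y \<in> simple_ext F a"
    if xy: "x \<in> simple_ext F a" "y \<in> simple_ext F a" for x y
  proof -
    obtain r t where x: "coeffs_in F r" "coeffs_in F t" "poly t a \<noteq> 0" "x = poly r a / poly t a"
      using xy(1) by (rule simple_extE)
    obtain r' t' where y: "coeffs_in F r'" "coeffs_in F t'" "poly t' a \<noteq> 0" "y = poly r' a / poly t' a"
      using xy(2) by (rule simple_extE)
    have fractions: "x + y = poly (r * t' + r' * t) a / poly (t * t') a"
      "x - y = poly (r * t' - r' * t) a / poly (t * t') a" "x * y = poly (r * r') a / poly (t * t') a"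
      unfolding x(4) y(4) using x(3) y(3) by (simp_all add: field_simps)
    have "poly (t * t') a \<noteq> 0" using x(3) y(3) by simp
    hence "x + y \<in> simple_ext F a" "x - y \<in> simple_ext F a" "x * y \<in> simple_ext F a"
      unfolding fractions by (intro in_simple_extI coeffs_in_closed[OF F] x y; assumption)+
    moreover have "x / y \<in> simple_ext F a"
    proof (cases "poly r' a = 0")
      case True
      thus ?thesis using y(4) subset_simple_ext[OF F] is_subfieldD(1)[OF F] by auto
    next
      case False
      have "x / y = poly (r * t') a / poly (t * r') a" unfolding x(4) y(4) by simp
      thus ?thesis using in_simple_extI[of F "r * t'" "t * r'"] x y False
        by (simp add: coeffs_in_closed[OF F])
    qed
    ultimately show ?thesis by blast
  qed
  thus ?thesis
    using subset_simple_ext[OF F, of a] is_subfieldD(1,2)[OF F] by (auto simp: is_subfield_def)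
qed

lemma simple_ext_conjugate_value:
  assumes F: "is_subfield F" and conjugate: "\<And>r. coeffs_in F r \<Longrightarrow> poly r a = 0 \<longleftrightarrow> poly r b = 0"
    and r: "coeffs_in F r" "coeffs_in F t" "poly t a \<noteq> 0"
    and r': "coeffs_in F r'" "coeffs_in F t'" "poly t' a \<noteq> 0"
    and eq: "poly r a / poly t a = poly r' a / poly t' a"
  shows "poly r b / poly t b = poly r' b / poly t' b"
proof -
  have "poly (r * t' - r' * t) a = 0" using eq r(3) r'(3) by (simp add: field_simps)
  moreover have "coeffs_in F (r * t' - r' * t)" by (intro coeffs_in_closed[OF F] r r')
  ultimately have "poly (r * t' - r' * t) b = 0" using conjugate by blast
  moreover have "poly t b \<noteq> 0" "poly t' b \<noteq> 0" using conjugate r r' by auto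
  ultimately show ?thesis by (simp add: field_simps)
qed

definition conj_map :: "'b::field set \<Rightarrow> 'b \<Rightarrow> 'b \<Rightarrow> 'b \<Rightarrow> 'b" where
  "conj_map F a b x = (SOME y. \<exists>r t. coeffs_in F r \<and> coeffs_in F t \<and> poly t a \<noteq> 0 \<and>
     x = poly r a / poly t a \<and> y = poly r b / poly t b)"

lemma conj_map_poly_divide:
  assumes F: "is_subfield F" and conjugate: "\<And>r. coeffs_in F r \<Longrightarrow> poly r a = 0 \<longleftrightarrow> poly r b = 0"
    and r: "coeffs_in F r" "coeffs_in F t" "poly t a \<noteq> 0"
  shows "conj_map F a b (poly r a / poly t a) = poly r b / poly t b"
  unfolding conj_map_def
proof (rule someI2_ex)
  fix y assume "\<exists>r' t'. coeffs_in F r' \<and> coeffs_in F t' \<and> poly t' a \<noteq> 0 \<and>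
     poly r a / poly t a = poly r' a / poly t' a \<and> y = poly r' b / poly t' b"
  then obtain r' t' where r': "coeffs_in F r'" "coeffs_in F t'" "poly t' a \<noteq> 0"
    and eq: "poly r a / poly t a = poly r' a / poly t' a" and y: "y = poly r' b / poly t' b" by blast
  show "y = poly r b / poly t b"
    unfolding y by (rule simple_ext_conjugate_value[OF F conjugate r r' eq, symmetric])
qed (use r in blast)

lemma ex_conjugation:
  assumes F: "is_subfield F" and m: "minpol F a m" and b: "poly m b = 0"
  obtains s where "subfield_hom (simple_ext F a) s" "s a = b" "\<And>c. c \<in> F \<Longrightarrow> s c = c"
proof -
  note conjugate = minpol_conjugate_root_iff[OF F m b]
  note s = conj_map_poly_divide[OF F conjugate]
  let ?s = "conj_map F a b"
  have s_F: "?s c = c" if "c \<in> F" for c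
    using s[of "[:c:]" 1] that by (simp add: coeffs_in_closed[OF F])
  have s_a: "?s a = b"
    using s[of "[:0, 1:]" 1] by (simp add: coeffs_in_closed[OF F] is_subfieldD(1,2)[OF F])
  have "subfield_hom (simple_ext F a) ?s"
  proof
    fix x y assume xy: "x \<in> simple_ext F a" "y \<in> simple_ext F a"
    obtain r t where x: "coeffs_in F r" "coeffs_in F t" "poly t a \<noteq> 0" "x = poly r a / poly t a"
      using xy(1) by (rule simple_extE)
    obtain r' t' where y: "coeffs_in F r'" "coeffs_in F t'" "poly t' a \<noteq> 0" "y = poly r' a / poly t' a"
      using xy(2) by (rule simple_extE)
    have s_xy: "?s x = poly r b / poly t b" "?s y = poly r' b / poly t' b" using x y s by auto
    have nonzero: "poly t b \<noteq> 0" "poly t' b \<noteq> 0" using conjugate x y by auto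
    have "x + y = poly (r * t' + r' * t) a / poly (t * t') a"
      unfolding x(4) y(4) using x(3) y(3) by (simp add: field_simps)
    hence "?s (x + y) = poly (r * t' + r' * t) b / poly (t * t') b"
      using s[of "r * t' + r' * t" "t * t'"] x y by (simp add: coeffs_in_closed[OF F])
    thus "?s (x + y) = ?s x + ?s y" unfolding s_xy using nonzero by (simp add: field_simps)
    have "x * y = poly (r * r') a / poly (t * t') a" using x y by simp
    hence "?s (x * y) = poly (r * r') b / poly (t * t') b"
      using s[of "r * r'" "t * t'"] x y by (simp add: coeffs_in_closed[OF F])
    thus "?s (x * y) = ?s x * ?s y" unfolding s_xy by simp
  qed (use is_subfield_simple_ext[OF F] s_F is_subfieldD(2)[OF F] in auto)
  thus thesis using that s_a s_F by blast
qed


section \<open>Fields of definition of points\<close>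

definition pt_over :: "'b set \<Rightarrow> 'b point \<Rightarrow> bool" where
  "pt_over F T \<longleftrightarrow> set_point T \<subseteq> F"

lemma pt_over_simps [simp]: "pt_over F Infinity" "pt_over F (Affine x y) \<longleftrightarrow> x \<in> F \<and> y \<in> F"
  by (auto simp: pt_over_def)

lemma pt_over_mono: "pt_over F T \<Longrightarrow> F \<subseteq> F' \<Longrightarrow> pt_over F' T"
  by (auto simp: pt_over_def)

lemma map_point_id_on: "pt_over F T \<Longrightarrow> (\<And>c. c \<in> F \<Longrightarrow> s c = c) \<Longrightarrow> map_point s T = T"
  by (cases T) auto

locale curve_over = weierstrass_curve W for W :: "'a::field weierstrass" +
  fixes F :: "'a set"
  assumes field: "is_subfield F" and coefficients: "set_weierstrass W \<subseteq> F"
begin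

lemma coefficients_in [simp]: "a1 \<in> F" "a2 \<in> F" "a3 \<in> F" "a4 \<in> F" "a6 \<in> F"
  using coefficients by (cases W; simp)+

lemmas field_closed = is_subfield_closed[OF field]

lemma slope_in: "pt_over F S \<Longrightarrow> pt_over F T \<Longrightarrow> slope W S T \<in> F"
  by (cases S; cases T) (auto simp: slope_def field_closed)

lemma ec_add_over:
  assumes "pt_over F S" "pt_over F T"
  shows "pt_over F (ec_add W S T)"
proof (cases S; cases T)
  fix x1 y1 x2 y2 assume ST: "S = Affine x1 y1" "T = Affine x2 y2"
  have "slope W (Affine x1 y1) (Affine x2 y2) \<in> F" using slope_in assms ST by blast
  thus ?thesis using assms unfolding ST ec_add_affine Let_def by (simp add: field_closed)
qed (use assms in auto)

lemma ec_neg_over: "pt_over F T \<Longrightarrow> pt_over F (ec_neg W T)"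
  by (cases T) (simp_all add: field_closed)

lemma mul_over: "pt_over F T \<Longrightarrow> pt_over F (mul T k)"
  by (induction k) (auto intro: ec_add_over)

end

lemma curve_over_mono: "curve_over W F \<Longrightarrow> F \<subseteq> F' \<Longrightarrow> is_subfield F' \<Longrightarrow> curve_over W F'"
  by (auto simp: curve_over_def)

locale curve_hom = curve_over W K + subfield_hom K s
  for W :: "'a::field weierstrass" and K s +
  assumes map_coefficient: "c \<in> set_weierstrass W \<Longrightarrow> s c = c"
begin

lemma map_coefficients [simp]: "s a1 = a1" "s a2 = a2" "s a3 = a3" "s a4 = a4" "s a6 = a6"
  using map_coefficient by (cases W; simp)+

lemma slope_map_point:
  assumes "pt_over K S" "pt_over K T"
  shows "slope W (map_point s S) (map_point s T) = s (slope W S T)"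
  using assms by (cases S; cases T) (auto simp: slope_def map_simps map_eq_iff field_closed)

lemma ec_add_map_point:
  assumes "pt_over K S" "pt_over K T"
  shows "ec_add W (map_point s S) (map_point s T) = map_point s (ec_add W S T)"
proof (cases S; cases T)
  fix x1 y1 x2 y2 assume ST: "S = Affine x1 y1" "T = Affine x2 y2"
  define l where "l = slope W (Affine x1 y1) (Affine x2 y2)"
  have mem: "x1 \<in> K" "y1 \<in> K" "x2 \<in> K" "y2 \<in> K" "l \<in> K"
    using assms slope_in[of S T] unfolding ST l_def by simp_all
  have slope: "slope W (Affine (s x1) (s y1)) (Affine (s x2) (s y2)) = s l"
    using slope_map_point[OF assms] unfolding ST l_def by simp
  have "s (y1 + y2 + a1 * x1 + a3) = s y1 + s y2 + a1 * s x1 + a3"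
    using mem by (simp add: map_simps field_closed)
  hence opposite: "s x1 = s x2 \<and> s y1 + s y2 + a1 * s x1 + a3 = 0 \<longleftrightarrow> x1 = x2 \<and> y1 + y2 + a1 * x1 + a3 = 0"
    using map_eq_iff[OF mem(1,3)] map_eq_0_iff[of "y1 + y2 + a1 * x1 + a3"] mem by (auto simp: field_closed)
  show ?thesis unfolding ST point.map ec_add_affine slope opposite l_def[symmetric] Let_def
    using mem by (auto simp: map_simps field_closed)
qed auto

lemma mul_map_point: "pt_over K T \<Longrightarrow> mul (map_point s T) k = map_point s (mul T k)"
  by (induction k) (auto simp: ec_add_map_point mul_over)

end

context ec_odd_order_point begin

lemma slope_const_in:
  assumes "curve_over W F" "pt_over F P"
  shows "slope_const i \<in> F"
proof -
  interpret curve_over W F by (rule assms(1))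
  show ?thesis using slope_in[OF assms(2) mul_over[OF assms(2)]] by (simp add: slope_const_def field_closed)
qed

lemma eigenfun_map_point:
  assumes hom: "curve_hom W K s" and PK: "pt_over K P" "map_point s P = P" and w: "w \<in> K" "s w = w"
    and T: "pt_over K T"
  shows "eigenfun w (map_point s T) = s (eigenfun w T)"
proof -
  interpret curve_hom W K s by (rule hom)
  note mul_over = mul_over[OF PK(1)]
  have mul_fixed: "map_point s (mul P i) = mul P i" for i using mul_map_point[OF PK(1), of i] PK(2) by simp
  have const: "slope_const i \<in> K" "s (slope_const i) = slope_const i" for i
    using slope_const_in[OF curve_over_axioms PK(1)]
      slope_map_point[OF PK(1) mul_over[of i]] mul_fixed[of i] PK(2)
    by (simp_all add: slope_const_def map_minus)
  have slope: "slope W T (mul P i) \<in> K" "s (slope W T (mul P i)) = slope W (map_point s T) (mul P i)" for i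
    using slope_in[OF T mul_over[of i]] slope_map_point[OF T mul_over[of i]] mul_fixed[of i] by simp_all
  have "s (\<Sum>i=1..<n. w ^ i * f i) = (\<Sum>i=1..<n. w ^ i * s (f i))" "(\<Sum>i=1..<n. w ^ i * f i) \<in> K"
    if "\<And>i. f i \<in> K" for f
    using that w by (simp_all add: map_sum map_mult map_power field_closed)
  note sums = this[of slope_const, OF const(1)] this[of "\<lambda>i. slope W T (mul P i)", OF slope(1)]
  show ?thesis unfolding eigenfun_def eigen_const_def
    using sums w by (simp add: map_simps field_closed const(2) slope(2))
qed

lemma eigenfun_eq_poly:
  assumes F: "curve_over W F" "pt_over F P" "pt_over F T"
  obtains f where "coeffs_in F f" "\<And>w. poly f w = eigenfun w T"
proof
  interpret curve_over W F by (rule F(1))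
  let ?f = "[:1, -1:] * (\<Sum>i=1..<n. monom (slope W T (mul P i)) i)
      + [:0, 1:] * (\<Sum>i=1..<n. monom (slope_const i) i)"
  have "slope W T (mul P i) \<in> F" for i by (rule slope_in[OF F(3) mul_over[OF F(2)]])
  moreover note slope_const_in[OF F(1,2)]
  moreover have "coeffs_in F [:1, -1:]" "coeffs_in F [:0, 1:]"
    by (intro coeffs_in_closed[OF field] field_closed)+
  ultimately show "coeffs_in F ?f"
    by (intro coeffs_in_closed(3,5)[OF field] coeffs_in_sum[OF field] coeffs_in_closed(8)[OF field])
  show "poly ?f w = eigenfun w T" for w
    unfolding eigenfun_def eigen_const_def poly_add poly_mult poly_sum poly_monom
    by (simp add: mult.commute algebra_simps)
qed

end


section \<open>Eigenvalues lie in the field of the torsion basis\<close>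

lemma of_nat_prime_neq_0:
  assumes "prime p" "p \<noteq> CHAR('a::field)"
  shows "of_nat p \<noteq> (0::'a)"
proof
  assume "of_nat p = (0::'a)"
  hence "CHAR('a) dvd p" by (simp add: of_nat_eq_0_iff_char_dvd)
  moreover have "CHAR('a) \<noteq> 1" by (simp add: CHAR_not_1)
  ultimately show False using assms by (metis prime_nat_iff)
qed

lemma poly_geometric_sum: "(t - 1) * poly (\<Sum>i<k. [:0, 1:] ^ i) t = t ^ k - (1::'b::field)"
  by (simp add: poly_sum power_diff_1_eq)

text \<open>
  Differentiating \<open>(X - 1) (1 + X + \<dots> + X^(k-1)) = X^k - 1\<close> shows that the nontrivial roots of unity
  are simple roots.
\<close>

lemma poly_pderiv_geometric_sum_neq_0:
  fixes w :: "'b::field"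
  assumes w: "w ^ k = 1" "w \<noteq> 1" and k: "of_nat k \<noteq> (0::'b)"
  shows "poly (pderiv (\<Sum>i<k. [:0, 1:] ^ i)) w \<noteq> 0"
proof
  let ?f = "\<Sum>i<k. [:0, 1:] ^ i :: 'b poly"
  assume "poly (pderiv ?f) w = 0"
  moreover have "poly ?f w = 0" using poly_geometric_sum[of w k] w by simp
  moreover have "[:0, 1:] ^ k - 1 = ([:0, 1:] - 1) * ?f" by (rule power_diff_1_eq)
  hence "pderiv ([:0, 1:] ^ k - 1) = pderiv (([:0, 1:] - 1) * ?f)" by simp
  hence "poly (pderiv ([:0, 1:] ^ k - 1)) w = (w - 1) * poly (pderiv ?f) w + poly ?f w"
    by (simp add: pderiv_mult pderiv_diff pderiv_pCons)
  ultimately have "of_nat k * w ^ (k - 1) = 0"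
    by (simp add: pderiv_diff pderiv_power pderiv_pCons)
  moreover have "w \<noteq> 0" using w(1) k by (cases "k = 0") (auto simp: power_0_left)
  ultimately show False using k by simp
qed

lemma primitive_root_power_in_subfield_iff:
  assumes z: "primitive_root_of_unity p z" and "prime p" "k \<in> {1..<p}" and F: "is_subfield F"
  shows "z ^ k \<in> F \<longleftrightarrow> z \<in> F"
proof
  have "coprime k p"
    using assms(2,3) by (intro prime_imp_coprime[THEN coprime_commute[THEN iffD1]]) (auto dest: dvd_imp_le)
  then obtain l where "(z ^ k) ^ l = z"
    using primitive_root_power_generates[OF z] prime_gt_1_nat[OF assms(2)] by blast
  thus "z ^ k \<in> F \<Longrightarrow> z \<in> F" using is_subfield_power[OF F, of "z ^ k" l] by simp
qed (rule is_subfield_power[OF F])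

context ec_torsion_basis begin

lemma ex_eigenvalue_generating_roots_of_unity:
  assumes z: "primitive_root_of_unity p z"
  obtains w where "nontrivial_root w" "eigenfun w Q = 0" "\<And>F. is_subfield F \<Longrightarrow> w \<in> F \<longleftrightarrow> z \<in> F"
proof -
  obtain k where k: "k \<in> {1..<p}" "eigenfun (z ^ k) Q = 0"
    using ex_primitive_power_eigenfun_zero_at_Q[OF z] .
  thus thesis
    using that[of "z ^ k"] nontrivial_root_primitive_power[OF z k(1)]
      primitive_root_power_in_subfield_iff[OF z p(1) k(1)] by blast
qed

lemma eigenvalue_in_field:
  assumes F: "curve_over W F" "pt_over F P" "pt_over F Q"
    and w: "nontrivial_root w" "eigenfun w Q = 0" and char: "of_nat p \<noteq> (0::'a)"
  shows "w \<in> F"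
proof -
  interpret curve_over W F by (rule F(1))
  let ?f = "\<Sum>i<p. [:0, 1:] ^ i :: 'a poly"
  obtain g where g: "coeffs_in F g" "\<And>t. poly g t = eigenfun t Q" using eigenfun_eq_poly[OF F] by blast
  show ?thesis
  proof (rule unique_simple_common_root_in_subfield[OF field])
    have "coeffs_in F ([:0, 1:] ^ i)" for i
      using coeffs_in_closed(8)[OF field is_subfieldD(2)[OF field], of i] by (simp add: monom_altdef)
    thus "coeffs_in F ?f" by (intro coeffs_in_sum[OF field])
    show "poly ?f w = 0" using poly_geometric_sum[of w p] w(1) by (simp add: nontrivial_root_def)
    show "poly (pderiv ?f) w \<noteq> 0"
      using w(1) char by (intro poly_pderiv_geometric_sum_neq_0) (simp_all add: nontrivial_root_def)
    fix t assume t: "poly ?f t = 0" "poly g t = 0"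
    have "poly ?f 1 = of_nat p" by (simp add: poly_sum)
    hence "nontrivial_root t"
      using poly_geometric_sum[of t p] t(1) char by (auto simp: nontrivial_root_def)
    thus "t = w" using eigenfun_root_unique_at_Q w t(2) g(2) by metis
  qed (use g w in auto)
qed

end


section \<open>Horizontal lines\<close>

context weierstrass_curve begin

definition horizontal_cubic :: "'a \<Rightarrow> 'a poly" where
  "horizontal_cubic y = - reg_norm [:-y:] 1"

lemma horizontal_cubic_eq: "horizontal_cubic y = [:a6 - y\<^sup>2 - a3 * y, a4 - a1 * y, a2, 1:]"
  by (simp add: horizontal_cubic_def reg_norm_def ycoeff_def cubic_def power2_eq_square algebra_simps)

lemma poly_horizontal_cubic_eq_0_iff: "poly (horizontal_cubic y) x = 0 \<longleftrightarrow> on_curve W x y"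
  by (auto simp: horizontal_cubic_eq on_curve_def algebra_simps power2_eq_square power3_eq_cube)

lemma collinear_horizontal_iff:
  "collinear 0 y x1 x2 x3 \<longleftrightarrow> horizontal_cubic y = [:-x1, 1:] * [:-x2, 1:] * [:-x3, 1:]"
  by (simp only: collinear_def horizontal_cubic_def minus_equation_iff[of "reg_norm _ _"]
      minus_zero pCons_0_0) auto

lemma ex_collinear_horizontal:
  assumes "[:-x1, 1:] * [:-x2, 1:] dvd horizontal_cubic y"
  shows "\<exists>x3. collinear 0 y x1 x2 x3"
proof -
  obtain q where q: "horizontal_cubic y = [:-x1, 1:] * [:-x2, 1:] * q" using assms by (elim dvdE)
  have deg: "degree (horizontal_cubic y) = 3" and lead: "lead_coeff (horizontal_cubic y) = 1"
    by (simp_all add: horizontal_cubic_eq)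
  have "q \<noteq> 0" using deg q by auto
  hence "degree q = 1" using deg unfolding q by (simp add: degree_mult_eq del: mult_pCons_left)
  moreover have "lead_coeff q = 1" using lead unfolding q
    by (simp add: lead_coeff_mult del: mult_pCons_left)
  ultimately have "q = [:- (- coeff q 0), 1:]"
    by (intro poly_eqI) (auto simp: coeff_pCons coeff_eq_0 split: nat.splits)
  thus ?thesis unfolding collinear_horizontal_iff q by metis
qed

end

lemma (in curve_over) coeffs_in_horizontal_cubic: "y \<in> F \<Longrightarrow> coeffs_in F (horizontal_cubic y)"
  unfolding horizontal_cubic_eq by (intro coeffs_in_closed(1,6)[OF field] field_closed) simp_all

lemma curve_hom_simple_ext:
  assumes F: "curve_over W F" and hom: "subfield_hom (simple_ext F a) s" and fixed: "\<And>c. c \<in> F \<Longrightarrow> s c = c"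
  shows "curve_hom W (simple_ext F a) s"
proof -
  interpret curve_over W F by (rule F)
  interpret subfield_hom "simple_ext F a" s by (rule hom)
  show ?thesis
    using curve_over_mono[OF F subset_simple_ext[OF field] hom_subfield] hom fixed coefficients
    by (auto simp: curve_hom_def curve_hom_axioms_def)
qed

lemma simple_ext_rational_point:
  assumes "is_subfield F" "\<And>c. c \<in> F \<Longrightarrow> s c = c" "pt_over F T"
  shows "pt_over (simple_ext F a) T" "map_point s T = T"
  using pt_over_mono[OF assms(3) subset_simple_ext[OF assms(1)]] map_point_id_on[OF assms(3)] assms(2)
  by blast+

lemma simple_ext_generator_point: "is_subfield F \<Longrightarrow> y \<in> F \<Longrightarrow> pt_over (simple_ext F x) (Affine x y)"
  using subset_simple_ext[of F x] generator_in_simple_ext[of F x] by auto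

lemma ex_quadratic_conjugation:
  assumes F: "is_subfield F" and "x + u \<in> F" "x * u \<in> F" "x \<notin> F"
  obtains s where "subfield_hom (simple_ext F x) s" "s x = u" "\<And>c. c \<in> F \<Longrightarrow> s c = c"
proof -
  let ?f = "[:x * u, - (x + u), 1:]"
  have "coeffs_in F ?f"
    by (intro coeffs_in_closed(1,6)[OF F] assms(3) is_subfield_minus[OF F assms(2)] is_subfieldD(2)[OF F])
  moreover have "?f \<noteq> 0" "poly ?f x = 0" "poly ?f u = 0" by (simp_all add: algebra_simps)
  ultimately have f: "coeffs_in F ?f" "?f \<noteq> 0" "poly ?f x = 0" "poly ?f u = 0" by blast+
  obtain m where m: "minpol F x m" using ex_minpol f by blast
  obtain q where f_eq: "?f = q * m" using minpol_dvd[OF F m f(1,3)] .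
  have nonzero: "q \<noteq> 0" "m \<noteq> 0" using f_eq f(2) by auto
  have "degree q + degree m = 2" using arg_cong[OF f_eq, of degree] nonzero by (simp add: degree_mult_eq)
  hence "degree q = 0" using degree_minpol_ge_2[OF F m assms(4)] by simp
  hence "poly q u \<noteq> 0" using nonzero(1) by (auto elim!: degree_eq_zeroE)
  hence "poly m u = 0" using f(4) unfolding f_eq by simp
  from ex_conjugation[OF F m this] that show thesis by blast
qed


section \<open>Conjugates of a basis point with a rational ordinate\<close>

lemma cong_1_if_cube_cong_1:
  fixes j p :: nat
  assumes p: "prime p" "[p = 2] (mod 3)" and cube: "[j ^ 3 = 1] (mod p)"
  shows "[j = 1] (mod p)"
proof -
  have "\<not> p dvd j"
  proof
    assume "p dvd j"
    hence "p dvd 1" using cong_dvd_iff[OF cube] by (simp add: power3_eq_cube)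
    thus False using p(1) by simp
  qed
  hence "ord p j dvd p - 1" using fermat_theorem[OF p(1)] ord_divides by blast
  moreover have "p mod 3 = 2" using p(2) by (simp add: cong_def)
  hence "\<not> 3 dvd p - 1" by presburger
  hence "coprime 3 (p - 1)" by (intro prime_imp_coprime) simp_all
  moreover have "ord p j dvd 3" using cube ord_divides by blast
  ultimately have "ord p j dvd 1" using coprime_common_divisor by blast
  thus ?thesis using ord_divides[of j 1 p] by simp
qed

lemma not_dvd_square_add_self_add_1:
  fixes j p :: nat
  assumes p: "prime p" "[p = 2] (mod 3)"
  shows "\<not> p dvd j * j + j + 1"
proof
  let ?u = "j * j + j + 1"
  assume "p dvd ?u"
  hence u: "[?u = 0] (mod p)" by (simp add: cong_0_iff)
  have "[j ^ 3 + ?u = j ^ 3 + 0] (mod p)" "[1 + ?u * j = 1 + 0 * j] (mod p)"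
    by (intro cong_add cong_mult u cong_refl)+
  moreover have "j ^ 3 + ?u = 1 + ?u * j" by (simp add: algebra_simps power3_eq_cube)
  ultimately have "[j ^ 3 = 1] (mod p)" by (metis add_0_right mult_0 cong_sym cong_trans)
  hence "[j = 1] (mod p)" by (rule cong_1_if_cube_cong_1[OF p])
  hence "[?u = 1 * 1 + 1 + 1] (mod p)" by (intro cong_add cong_mult cong_refl)
  hence "[3 = 0] (mod p)" using u cong_sym cong_trans by (simp add: numeral_3_eq_3) blast
  hence "p dvd 3" by (simp add: cong_0_iff)
  hence "p = 3" using p(1) primes_dvd_imp_eq[of p 3] by simp
  thus False using p(2) by (simp add: cong_def)
qed

text \<open>
  In matrix form: an involution with the columns \<open>(1, 0)\<close> and \<open>(i, j)\<close> is the identity unless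
  \<open>j = -1\<close>.
\<close>

lemma dvd_Suc_of_involution:
  fixes i j p :: nat
  assumes "prime p" "odd p" and "[i + i * j = 0] (mod p)" "[j * j = 1] (mod p)"
    and nontrivial: "\<not> ([i = 0] (mod p) \<and> [j = 1] (mod p))"
  shows "p dvd j + 1"
proof -
  have "p dvd i * (j + 1)" using assms(3) by (simp add: cong_0_iff algebra_simps)
  hence "p dvd i \<or> p dvd j + 1" by (rule prime_dvd_multD[OF assms(1)])
  moreover have "p dvd j + 1" if "p dvd i"
  proof -
    have "[j \<noteq> 1] (mod p)" using nontrivial that by (simp add: cong_0_iff)
    hence not_1: "\<not> int p dvd int j - 1" by (simp add: cong_iff_dvd_diff flip: cong_int_iff)
    have "int p dvd int j * int j - 1" using assms(4) by (simp add: cong_iff_dvd_diff flip: cong_int_iff)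
    also have "int j * int j - 1 = (int j - 1) * int (j + 1)" by (simp add: algebra_simps)
    finally have "int p dvd int (j + 1)" using not_1 assms(1) by (simp add: prime_dvd_mult_iff)
    thus ?thesis by (simp only: of_nat_dvd_iff)
  qed
  ultimately show ?thesis by blast
qed

context ec_torsion_basis begin

lemma pt_over_if_double_over:
  assumes "curve_over W F" "pt_over F (ec_add W Q Q)"
  shows "pt_over F Q"
proof -
  interpret curve_over W F by (rule assms(1))
  have "ec_add W Q Q = mul Q 2" using Q(1) by (simp add: numeral_2_eq_2)
  hence "mul (ec_add W Q Q) ((p + 1) div 2) = mul Q (2 * ((p + 1) div 2))" using G.nat_pow_pow[OF Q(1)]
    by simp
  also have "2 * ((p + 1) div 2) = Suc p" using p(2) by simp
  also have "mul Q (Suc p) = Q" using Q by simp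
  finally show ?thesis using mul_over[OF assms(2)] by metis
qed

lemma tangent_third_abscissa:
  assumes F: "curve_over W F" and Q_xy: "Q = Affine x2 y2" "y2 \<in> F" "x2 \<notin> F" and "p \<noteq> 3"
    and collinear: "collinear 0 y2 x2 x2 v"
  shows "v \<noteq> x2" "v \<notin> F"
proof -
  interpret curve_over W F by (rule F)
  have double: "ec_add W Q Q = ec_neg W (Affine v y2)"
    using ec_add_collinear[OF collinear] by (simp add: Q_xy)
  show "v \<noteq> x2"
  proof
    assume "v = x2"
    hence "ec_add W Q Q = ec_neg W Q" using double by (simp only: Q_xy(1))
    hence "ec_add W Q (ec_add W Q Q) = Infinity" by simp
    hence "mul Q 3 = Infinity" using Q(1) by (simp add: numeral_3_eq_3 ec_add_assoc)
    hence "p dvd 3" by (simp add: mul_Q_eq_Infinity_iff)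
    thus False using p(1) \<open>p \<noteq> 3\<close> primes_dvd_imp_eq[of p 3] by simp
  qed
  show "v \<notin> F"
  proof
    assume "v \<in> F"
    hence "pt_over F (ec_add W Q Q)" using Q_xy(2) by (simp add: double field_closed)
    thus False using pt_over_if_double_over[OF F] Q_xy by simp
  qed
qed

text \<open>
  If \<open>x2\<close> were the only root of its minimal polynomial, the horizontal line through \<open>Q\<close> would be
  tangent at \<open>Q\<close>, so that \<open>3 Q = O\<close> or the third intersection \<open>- 2 Q\<close> is defined over \<open>F\<close>.
\<close>

lemma ex_conjugate_on_horizontal_line:
  assumes F: "curve_over W F" and Q_xy: "Q = Affine x2 y2" "y2 \<in> F" "x2 \<notin> F" and "p \<noteq> 3"
    and m: "minpol F x2 m"
  obtains u v where "collinear 0 y2 x2 u v" "poly m u = 0" "u \<noteq> x2"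
proof -
  interpret curve_over W F by (rule F)
  let ?c = "horizontal_cubic y2"
  have "poly ?c x2 = 0" using Q(1) by (simp add: Q_xy poly_horizontal_cubic_eq_0_iff)
  then obtain q where q: "coeffs_in F q" "?c = q * m"
    using minpol_dvd[OF field m coeffs_in_horizontal_cubic[OF Q_xy(2)]] by blast
  have "poly m x2 = 0" "degree m \<ge> 2"
    using m degree_minpol_ge_2[OF field m Q_xy(3)] by (simp_all add: minpol_def)
  then obtain t where t: "[:-x2, 1:] * [:-t, 1:] dvd m" using ex_linear_product_dvd by blast
  hence root: "poly m t = 0" by (metis dvd_mult_right poly_eq_0_iff_dvd)
  obtain v where v: "collinear 0 y2 x2 t v" using ex_collinear_horizontal t q(2) by (metis dvd_mult)
  show thesis
  proof (cases "t = x2")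
    case False
    thus ?thesis using that v root by blast
  next
    case True
    note third = tangent_third_abscissa[OF F Q_xy \<open>p \<noteq> 3\<close> v[unfolded True]]
    have "?c \<noteq> 0" "degree ?c = 3" by (simp_all add: horizontal_cubic_eq)
    hence "q \<noteq> 0" "m \<noteq> 0" "degree (q * m) = 3" using q(2) by auto
    hence "q \<noteq> 0" "degree q \<le> 1" using \<open>degree m \<ge> 2\<close> by (simp_all add: degree_mult_eq)
    hence "poly q v \<noteq> 0" using root_of_linear_in_subfield[OF field q(1)] third(2) by blast
    moreover have "poly ?c v = 0"
      using on_curve_iff_collinear[OF v, of v] by (simp add: poly_horizontal_cubic_eq_0_iff)
    ultimately have "poly m v = 0" unfolding q(2) by simp
    thus ?thesis using that[of v x2] third(1) v True collinear_rotate by blast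
  qed
qed

lemma map_point_lincomb:
  assumes "curve_hom W K s" and over: "pt_over K P" "pt_over K Q" and P_fixed: "map_point s P = P"
    and image: "map_point s Q = B.lincomb i j"
  shows "map_point s (B.lincomb a b) = B.lincomb (a + i * b) (j * b)"
proof -
  interpret curve_hom W K s by (rule assms(1))
  have "map_point s (B.lincomb a b) = ec_add W (mul (map_point s P) a) (mul (map_point s Q) b)"
    using ec_add_map_point mul_map_point mul_over over by (simp add: B.lincomb_def)
  also have "\<dots> = B.lincomb (a + i * b) (j * b)"
    unfolding P_fixed image B.lincomb_pow using B.lincomb_mult[of a 0 "i * b" "j * b"]
    by (simp add: B.lincomb_0_right)
  finally show ?thesis .
qed

text \<open>
  If the conjugation \<open>Q \<mapsto> i P + j Q\<close> permuted the three intersections cyclically, their sum \<open>O\<close>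
  would give \<open>j\<^sup>2 + j + 1 = 0\<close> modulo \<open>p\<close>.
\<close>

lemma conjugation_not_cyclic:
  assumes collinear: "collinear 0 y x u v" and Q_xy: "Q = Affine x y" and T: "Affine u y = B.lincomb i j"
    and p_mod_3: "[p = 2] (mod 3)"
  shows "B.lincomb (i + i * j) (j * j) \<noteq> Affine v y"
proof
  assume third: "B.lincomb (i + i * j) (j * j) = Affine v y"
  have "ec_add W Q (Affine u y) = ec_neg W (Affine v y)"
    using ec_add_collinear[OF collinear] by (simp add: Q_xy)
  hence "ec_add W (ec_add W Q (Affine u y)) (Affine v y) = Infinity" by (simp del: ec_neg_simps)
  hence "B.lincomb (i + (i + i * j)) (1 + j + j * j) = Infinity"
    using B.lincomb_mult[of 0 1 i j] B.lincomb_mult[of i "1 + j" "i + i * j" "j * j"] by (simp add: T third)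
  hence "p dvd j * j + j + 1" by (simp add: B.lincomb_eq_one_iff ac_simps)
  thus False using not_dvd_square_add_self_add_1[OF p(1) p_mod_3] by contradiction
qed

lemma conjugation_is_reflection:
  assumes hom: "curve_hom W K s" and over: "pt_over K P" "pt_over K Q" and P_fixed: "map_point s P = P"
    and Q_xy: "Q = Affine x2 y2" and sQ: "map_point s Q = Affine u y2" "u \<noteq> x2"
    and collinear: "collinear 0 y2 x2 u v" and p_mod_3: "[p = 2] (mod 3)"
  obtains i j where "Affine u y2 = B.lincomb i j" "p dvd j + 1"
proof -
  interpret curve_hom W K s by (rule hom)
  have s_xy: "s x2 = u" "s y2 = y2" using sQ(1) Q_xy by simp_all
  have "mul (map_point s Q) p = Infinity" using mul_map_point[OF over(2), of p] Q(2) by simp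
  then obtain i j where T: "Affine u y2 = B.lincomb i j"
    using B.torsion_eq_lincomb[of "Affine u y2"] collinear_on_curve(2)[OF collinear] sQ(1) by auto
  have sT: "Affine (s u) y2 = B.lincomb (i + i * j) (j * j)"
    using map_point_lincomb[OF hom over P_fixed sQ(1)[unfolded T], of i j] s_xy(2) by (simp flip: T)
  have "pt_over K (B.lincomb i j)" unfolding B.lincomb_def by (intro ec_add_over mul_over over)
  hence "u \<in> K" by (simp flip: T)
  hence "s u \<noteq> u" using map_eq_iff[of u x2] over(2) s_xy(1) sQ(2) Q_xy by auto
  moreover have "s u \<noteq> v" using conjugation_not_cyclic[OF collinear Q_xy T p_mod_3] sT by metis
  moreover have "on_curve W (s u) y2" using B.lincomb_closed[of "i + i * j" "j * j"] by (simp flip: sT)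
  ultimately have "s u = x2" using on_curve_iff_collinear[OF collinear, of "s u"] by simp
  hence "B.lincomb 0 1 = B.lincomb (i + i * j) (j * j)" using sT Q_xy lincomb_0_1(1) by metis
  hence "[0 = i + i * j] (mod p) \<and> [1 = j * j] (mod p)" by (rule B.lincomb_eq_iff[THEN iffD1])
  hence "[i + i * j = 0] (mod p)" "[j * j = 1] (mod p)" by (auto intro: cong_sym)
  moreover have "\<not> ([i = 0] (mod p) \<and> [j = 1] (mod p))"
  proof
    assume "[i = 0] (mod p) \<and> [j = 1] (mod p)"
    hence "B.lincomb i j = B.lincomb 0 1" by (rule B.lincomb_eq_iff[THEN iffD2])
    hence "Affine u y2 = Q" unfolding T lincomb_0_1 .
    thus False using sQ(2) Q_xy by simp
  qed
  ultimately show thesis using that[OF T] dvd_Suc_of_involution p by blast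
qed

lemma conjugate_and_ordinate_rational:
  assumes F: "curve_over W F" "pt_over F P" and L: "is_subfield L" "F \<subseteq> L"
    and Q_xy: "Q = Affine x2 y2" "y2 \<in> L" "x2 \<notin> L" and p_mod_3: "[p = 2] (mod 3)"
  obtains u v i j where "collinear 0 y2 x2 u v" "Affine u y2 = B.lincomb i j" "p dvd j + 1" "v \<in> F" "y2 \<in> F"
proof -
  interpret F: curve_over W F by (rule F(1))
  have L_over: "curve_over W L" by (rule curve_over_mono[OF F(1) L(2,1)])
  interpret L: curve_over W L by (rule L_over)
  have "p \<noteq> 3" using p_mod_3 by (auto simp: cong_def)
  obtain m where m: "minpol L x2 m"
  proof -
    have "poly (horizontal_cubic y2) x2 = 0" using Q(1)
      by (simp add: Q_xy(1) poly_horizontal_cubic_eq_0_iff)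
    moreover have "horizontal_cubic y2 \<noteq> 0" by (simp add: horizontal_cubic_eq)
    ultimately show thesis using ex_minpol[OF L.coeffs_in_horizontal_cubic[OF Q_xy(2)]] that by blast
  qed
  obtain u v where uv: "collinear 0 y2 x2 u v" "poly m u = 0" "u \<noteq> x2"
    using ex_conjugate_on_horizontal_line[OF L_over Q_xy \<open>p \<noteq> 3\<close> m] .
  obtain s where s: "subfield_hom (simple_ext L x2) s" "s x2 = u" "\<And>c. c \<in> L \<Longrightarrow> s c = c"
    using ex_conjugation[OF L(1) m uv(2)] by blast
  note P = simple_ext_rational_point[OF L(1) s(3) pt_over_mono[OF F(2) L(2)]]
  note Q_over = simple_ext_generator_point[OF L(1) Q_xy(2), of x2, folded Q_xy(1)]
  have "map_point s Q = Affine u y2" using s Q_xy by simp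
  then obtain i j where ij: "Affine u y2 = B.lincomb i j" "p dvd j + 1"
    using conjugation_is_reflection[OF curve_hom_simple_ext[OF L_over s(1,3)]
      P(1) Q_over P(2) Q_xy(1) _ uv(3,1) p_mod_3]
    by blast
  have "ec_neg W (Affine v y2) = ec_add W Q (Affine u y2)"
    using ec_add_collinear[OF uv(1)] by (simp add: Q_xy)
  also have "\<dots> = B.lincomb i (1 + j)" using B.lincomb_mult[of 0 1 i j] ij(1) by simp
  also have "\<dots> = B.lincomb i 0" using ij(2) by (simp add: B.lincomb_eq_iff cong_0_iff)
  finally have "pt_over F (ec_neg W (Affine v y2))" using F.mul_over[OF F(2)]
    by (simp only: B.lincomb_0_right)
  hence "pt_over F (Affine v y2)" using F.ec_neg_over[of "ec_neg W (Affine v y2)"]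
    by (simp only: ec_neg_ec_neg)
  thus thesis using that uv(1) ij by simp
qed

lemma abscissa_in_field_of_eigenvalue:
  assumes F: "curve_over W F" "pt_over F P" and L: "is_subfield L" "F \<subseteq> L"
    and Q_xy: "Q = Affine x2 y2" "y2 \<in> L" "x2 \<notin> L" and p_mod_3: "[p = 2] (mod 3)"
    and w: "nontrivial_root w" "eigenfun w Q = 0" and N: "is_subfield N" "F \<subseteq> N" "w \<in> N"
  shows "x2 \<in> N"
proof (rule ccontr)
  assume "x2 \<notin> N"
  interpret F: curve_over W F by (rule F(1))
  obtain u v i j where uv: "collinear 0 y2 x2 u v" and ij: "Affine u y2 = B.lincomb i j" "p dvd j + 1"
    and vy: "v \<in> F" "y2 \<in> F"
    using conjugate_and_ordinate_rational[OF F L Q_xy p_mod_3] .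
  have sum: "x2 + u = - a2 - v" and prod: "x2 * u = a4 - a1 * y2 - (x2 + u) * v"
    using uv by (simp_all add: collinear_iff_Vieta algebra_simps)
  have "x2 + u \<in> F" unfolding sum using vy by (simp add: F.field_closed)
  moreover from this have "x2 * u \<in> F" unfolding prod using vy by (simp add: F.field_closed)
  ultimately have "x2 + u \<in> N" "x2 * u \<in> N" using N(2) by blast+
  then obtain s where s: "subfield_hom (simple_ext N x2) s" "s x2 = u" "\<And>c. c \<in> N \<Longrightarrow> s c = c"
    using ex_quadratic_conjugation[OF N(1) _ _ \<open>x2 \<notin> N\<close>] by blast
  have N_over: "curve_over W N" by (rule curve_over_mono[OF F(1) N(2,1)])
  note P = simple_ext_rational_point[OF N(1) s(3) pt_over_mono[OF F(2) N(2)]]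
  have "y2 \<in> N" using vy(2) N(2) by blast
  note Q_over = simple_ext_generator_point[OF N(1) this, of x2, folded Q_xy(1)]
  have "w \<in> simple_ext N x2" using N(3) subset_simple_ext[OF N(1)] by blast
  hence "eigenfun w (map_point s Q) = s (eigenfun w Q)"
    using s(3)[OF N(3)] by (intro eigenfun_map_point[OF curve_hom_simple_ext[OF N_over s(1,3)] P] Q_over)
  also have "\<dots> = 0" using w(2) subfield_hom.map_0[OF s(1)] by simp
  also have "map_point s Q = B.lincomb i j" using ij(1) s(2) s(3)[OF \<open>y2 \<in> N\<close>] Q_xy(1) by simp
  finally have "eigenfun w (B.lincomb i j) = 0" .
  moreover have "\<not> p dvd j" using ij(2) p(1) by (metis dvd_add_right_iff not_prime_unit)
  ultimately have "[j = 1] (mod p)" using eigenfun_zero_lincombD[OF w] by blast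
  hence "[j + 1 = 1 + 1] (mod p)" by (intro cong_add cong_refl)
  hence "p dvd 2" using ij(2) cong_dvd_iff unfolding one_add_one by blast
  thus False using not_p_dvd_2 by contradiction
qed

end


section \<open>The field of the torsion points\<close>

lemma elliptic_curve_map_to_ac: "elliptic_curve E \<Longrightarrow> elliptic_curve (map_weierstrass to_ac E)"
proof -
  have "w_discriminant (map_weierstrass to_ac E) = to_ac (w_discriminant E)"
    by (cases E) (simp add: w_discriminant_def Let_def)
  thus "elliptic_curve E \<Longrightarrow> elliptic_curve (map_weierstrass to_ac E)" by (simp add: elliptic_curve_def)
qed

lemma curve_over_adjoin: "curve_over (map_weierstrass to_ac E) (adjoin S)"
  using range_to_ac_subset_adjoin by unfold_locales (auto simp: is_subfield_adjoin weierstrass.set_map)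

lemma division_field_eq_adjoin_basis:
  assumes "torsion_basis (ec_closure_group E) n (Affine x1 y1) (Affine x2 y2)"
  shows "division_field E n = adjoin {x1, y1, x2, y2}"
proof -
  let ?M = "adjoin {x1, y1, x2, y2}" and ?T = "torsion (ec_closure_group E) n"
  interpret curve_over "map_weierstrass to_ac E" ?M by (rule curve_over_adjoin)
  have "set_point R \<subseteq> ?M" if R: "R \<in> ?T" for R
  proof -
    obtain i j where "R = ec_add (map_weierstrass to_ac E) (mul (Affine x1 y1) i) (mul (Affine x2 y2) j)"
      using assms R by (auto simp: torsion_basis_def ec_closure_group_def)
    moreover have "pt_over ?M (Affine x1 y1)" "pt_over ?M (Affine x2 y2)" by (simp_all add: in_adjoin)
    ultimately have "pt_over ?M R" using ec_add_over mul_over by blast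
    thus ?thesis by (simp add: pt_over_def)
  qed
  hence "coordinates ?T \<subseteq> ?M" by (auto simp: coordinates_def)
  moreover have "Affine x1 y1 \<in> ?T" "Affine x2 y2 \<in> ?T" using assms by (simp_all add: torsion_basis_def)
  hence "{x1, y1, x2, y2} \<subseteq> coordinates ?T" unfolding coordinates_def by force
  hence "{x1, y1, x2, y2} \<subseteq> adjoin (coordinates ?T)" using in_adjoin by blast
  ultimately show ?thesis unfolding division_field_def by (simp only: adjoin_eq_iff simp_thms)
qed

theorem theorem3p4:
  fixes E :: "'k::field weierstrass"
    and p :: nat
    and x1 y1 x2 y2 \<zeta> :: "'k alg_closure"
  assumes "elliptic_curve E"
    and "prime p" and "odd p" and "[p = 2] (mod 3)" and "p \<noteq> CHAR('k)"
    and "torsion_basis (ec_closure_group E) p (Affine x1 y1) (Affine x2 y2)"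
    and "primitive_root_of_unity p \<zeta>"
  shows "division_field E p = adjoin {x1, y1, y2} \<or> division_field E p = adjoin {x1, y1, \<zeta>}"
proof -
  interpret ec_torsion_basis "map_weierstrass to_ac E" p "Affine x1 y1" "Affine x2 y2"
    using assms by unfold_locales (simp_all add: elliptic_curve_map_to_ac ec_closure_group_def)
  note division = division_field_eq_adjoin_basis[OF assms(6)]
  show ?thesis
  proof (cases "x2 \<in> adjoin {x1, y1, y2}")
    case True
    thus ?thesis unfolding division by (simp add: adjoin_eq_iff in_adjoin)
  next
    case False
    obtain w where w: "nontrivial_root w" "eigenfun w (Affine x2 y2) = 0"
      and w_iff: "\<And>F. is_subfield F \<Longrightarrow> w \<in> F \<longleftrightarrow> \<zeta> \<in> F"
      using ex_eigenvalue_generating_roots_of_unity[OF assms(7)] by blast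
    have P: "pt_over (adjoin {x1, y1}) (Affine x1 y1)"
      and sub: "adjoin {x1, y1} \<subseteq> adjoin {x1, y1, y2}" "adjoin {x1, y1} \<subseteq> adjoin {x1, y1, \<zeta>}"
      by (simp_all add: in_adjoin adjoin_subset_iff)
    note conjugation = curve_over_adjoin P is_subfield_adjoin sub(1) refl in_adjoin False assms(4)
    have "y2 \<in> adjoin {x1, y1}"
      by (rule conjugate_and_ordinate_rational[OF conjugation]) simp_all
    moreover have "x2 \<in> adjoin {x1, y1, \<zeta>}"
      using abscissa_in_field_of_eigenvalue[OF conjugation w is_subfield_adjoin sub(2)]
      by (simp add: w_iff is_subfield_adjoin in_adjoin)
    moreover have "w \<in> adjoin {x1, y1, x2, y2}"
      using assms(2,5) w
      by (intro eigenvalue_in_field curve_over_adjoin of_nat_prime_neq_0) (simp_all add: in_adjoin)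
    ultimately show ?thesis
      unfolding division using sub(2) by (auto simp: w_iff is_subfield_adjoin adjoin_eq_iff in_adjoin)
  qed
qed

end
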